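(* Let $M$ be a smooth manifold and $(P,\theta,F,Z_a,\xi^a)$ $(a=1,\dots,h)$ a normal generalized almost contact structure of codimension $h$ on $M$. Let $\mathcal{Z}$ be the foliation of $M$ tangent to $\mathrm{span}\{Z_1,\dots,Z_h\}$ (the $Z_a$ commute and are linearly independent). Then the structure projects to a generalized complex structure of the space of leaves of $\mathcal{Z}$: the tensor fields $F,P,\theta$ project to tensor fields $(A,\pi,\sigma)$ on the (local) space of leaves, and $(A,\pi,\sigma)$ is a generalized complex structure there.
   Context: All objects are $C^\infty$. For a bivector field $P$, $\sharp_P$ is defined by $\beta(\sharp_P\alpha)=P(\alpha,\beta)$; for a $2$-form $\theta$, $\flat_\theta(X)=i(X)\theta$. A generalized almost contact structure of codimension $h$ on $M$ is a system $(P,\theta,F,Z_a,\xi^a)$, $a=1,\dots,h$, with $P$ a bivector field, $\theta$ a $2$-form, $F$ a $(1,1)$-tensor field, $Z_a$ vector fields and $\xi^a$ $1$-forms, satisfying $$P(\alpha\circ F,\beta)=P(\alpha,\beta\circ F),\quad\theta(FX,Y)=\theta(X,FY),$$ $$F(Z_a)=0,\ \ \xi^a\circ F=0,\ \ i(Z_a)\theta=0,\ \ i(\xi^a)P=0,\ \ \xi^a(Z_b)=\delta^a_b,$$ $$F^2=-Id-\sharp_P\circ\flat_\theta+\sum_{a=1}^h\xi^a\otimes Z_a.$$ Let $\mathbf{T}_h^{big}M=(TM\times\mathbb{R}^h)\oplus(T^*M\times\mathbb{R}^h)$ and $$\Phi\big((X,u)\oplus(\alpha,v)\big)=\Big(FX+\sharp_P\alpha-\sum_av_aZ_a,\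 (\alpha(Z_a))_a\Big)\oplus\Big(\flat_\theta X-\sum_au^a\xi^a-\alpha\circ F,\ (\xi^a(X))_a\Big),$$ so $\Phi^2=-Id$. The structure is normal if the sections of the $\sqrt{-1}$-eigenbundle of $\Phi$ in $\mathbf{T}_h^{big}M\otimes\mathbb{C}$ are closed under the ($\mathbb{C}$-linear extension of the) untwisted stable Courant bracket $$[(X_1,u_1)\oplus(\alpha_1,v_1),(X_2,u_2)\oplus(\alpha_2,v_2)]=([X_1,X_2],X_1u_2-X_2u_1)\oplus\Big(L_{X_1}\alpha_2-L_{X_2}\alpha_1+\tfrac12d(\alpha_1(X_2)-\alpha_2(X_1))+\tfrac12(u_2\cdot dv_1+v_2\cdot du_1-u_1\cdot dv_2-v_1\cdot du_2),\ X_1v_2-X_2v_1\Big).$$ A generalized complex structure on a manifold $N$ is a triple $(A,\pi,\sigma)$, with $A\in\Gamma(\mathrm{End}\,TN)$, $\pi$ a bivector field, $\sigma$ a $2$-form, such that the endomorphism $X\oplus\alpha\mapsto(AX+\sharp_\pi\alpha)\oplus(\flat_\sigma X-\alpha\circ A)$ of $TN\oplus T^*N$ has square $-Id$ and its $\sqrt{-1}$-eigenbundle is closed under the (untwisted) Courant bracket $[X\oplus\alpha,Y\oplus\beta]=[X,Y]\oplus(L_X\beta-L_Y\alpha-\tfrac12d(\beta(X)-\alpha(Y)))$. Projection to the space of leaves: unless $M/\mathcal{Z}$ is a Hausdorff manifold, the space of leaves is understood locally, i.e. for neighborhoods $U$ adapted to $\mathcal{Z}$ one uses the submersion $q:U\to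 N=U/(\mathcal{Z}|_U)$ (equivalently, local transversal submanifolds); if $M/\mathcal{Z}$ is a manifold, take $q:M\to N=M/\mathcal{Z}$. The tensor fields $F,P,\theta$ project to $(A,\pi,\sigma)$ on $N$ if $q_*\circ F=A\circ q_*$, $P$ is $q$-related to $\pi$, and $\theta=q^*\sigma$. *)

theory Defs
  imports "HOL-Analysis.Analysis" "HOL-Library.Function_Algebras"
begin

section \<open>Vector spaces\<close>

text \<open>
  Tangent vectors, covectors and sections are functions into a real vector space, so the pointwise
  vector space structure lets the library notions (sum, span, independent, ...) apply to them.
\<close>

instantiation "fun" :: (type, real_vector) real_vector
begin

definition scaleR_fun_def: "c *\<^sub>R f = (\<lambda>x. c *\<^sub>R f x)" for f :: "'a \<Rightarrow> 'b"

instance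
  by standard (simp_all add: scaleR_fun_def fun_eq_iff scaleR_add_right scaleR_add_left)

end

text \<open>
  Model spaces of manifolds. The class \<open>euclidean_space\<close> forces positive dimension; here dimension 0
  is allowed as well, since the space of leaves is 0-dimensional when the codimension \<open>h\<close> of the
  structure is the dimension of the manifold. (Completeness is automatic in finite dimension.)
\<close>

class finite_dim_inner = real_inner + banach +
  assumes ex_finite_spanning: "\<exists>B. finite B \<and> (\<forall>x. \<exists>c. x = (\<Sum>b\<in>B. c b *\<^sub>R b))"

instance euclidean_space \<subseteq> finite_dim_inner
  by standard (metis euclidean_representation finite_Basis)

definition linear_on_subspace :: "'a::real_vector set \<Rightarrow> ('a \<Rightarrow> 'b::real_vector) \<Rightarrow> bool" where
  "linear_on_subspace S f \<longleftrightarrow>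
     (\<forall>x\<in>S. \<forall>y\<in>S. f (x + y) = f x + f y) \<and> (\<forall>c. \<forall>x\<in>S. f (c *\<^sub>R x) = c *\<^sub>R f x)"

definition skew_bilinear_on :: "'a::real_vector set \<Rightarrow> ('a \<Rightarrow> 'a \<Rightarrow> real) \<Rightarrow> bool" where
  "skew_bilinear_on S b \<longleftrightarrow>
     (\<forall>x\<in>S. linear_on_subspace S (b x)) \<and> (\<forall>y\<in>S. linear_on_subspace S (\<lambda>x. b x y)) \<and>
     (\<forall>x\<in>S. \<forall>y\<in>S. b x y = - b y x)"


section \<open>Smooth manifolds\<close>

primrec ck_on ::
  "nat \<Rightarrow> 'a::real_normed_vector set \<Rightarrow> ('a \<Rightarrow> 'b::real_normed_vector) \<Rightarrow> bool" where
  "ck_on 0 S f \<longleftrightarrow> continuous_on S f"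
| "ck_on (Suc k) S f \<longleftrightarrow>
     (\<forall>x\<in>S. f differentiable (at x)) \<and> (\<forall>v. ck_on k S (\<lambda>x. frechet_derivative f (at x) v))"

text \<open>Only used for open \<open>S\<close> in finite-dimensional spaces.\<close>

definition cinf_on ::
  "'a::real_normed_vector set \<Rightarrow> ('a \<Rightarrow> 'b::real_normed_vector) \<Rightarrow> bool" where
  "cinf_on S f \<longleftrightarrow> (\<forall>k. ck_on k S f)"

text \<open>
  The underlying space of a manifold is a whole type, with the topology of its type class. A smooth
  structure is given by a (not necessarily maximal) atlas. A chart is a pair \<open>(U, \<phi>)\<close>; the values of
  \<open>\<phi>\<close> outside \<open>U\<close> are irrelevant.
\<close>

type_synonym ('m, 'e) atlas = "('m set \<times> ('m \<Rightarrow> 'e)) set"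

definition smooth_manifold ::
  "('m::{t2_space,second_countable_topology}, 'e::finite_dim_inner) atlas \<Rightarrow> bool" where
  "smooth_manifold M \<longleftrightarrow>
     (\<Union>(U, \<phi>)\<in>M. U) = UNIV \<and>
     (\<forall>(U, \<phi>)\<in>M. open U \<and> open (\<phi> ` U) \<and> homeomorphism U (\<phi> ` U) \<phi> (inv_into U \<phi>)) \<and>
     (\<forall>(U, \<phi>)\<in>M. \<forall>(V, \<psi>)\<in>M. cinf_on (\<phi> ` (U \<inter> V)) (\<psi> \<circ> inv_into U \<phi>))"

definition line_atlas :: "(real, real) atlas" where
  "line_atlas = {(UNIV, id)}"

definition smooth_fun_on ::
  "('m::topological_space, 'e::real_normed_vector) atlas \<Rightarrow> 'm set \<Rightarrow> ('m \<Rightarrow> real) \<Rightarrow> bool" where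
  "smooth_fun_on M W f \<longleftrightarrow> (\<forall>(U, \<phi>)\<in>M. cinf_on (\<phi> ` (U \<inter> W)) (f \<circ> inv_into U \<phi>))"

definition smooth_near ::
  "('m::topological_space, 'e::real_normed_vector) atlas \<Rightarrow> 'm \<Rightarrow> ('m \<Rightarrow> real) \<Rightarrow> bool" where
  "smooth_near M p f \<longleftrightarrow> (\<exists>W. open W \<and> p \<in> W \<and> smooth_fun_on M W f)"

definition smooth_map_on ::
  "('m::topological_space, 'e::real_normed_vector) atlas \<Rightarrow>
   ('n::topological_space, 'f::real_normed_vector) atlas \<Rightarrow> 'm set \<Rightarrow> ('m \<Rightarrow> 'n) \<Rightarrow> bool" where
  "smooth_map_on M N W q \<longleftrightarrow> continuous_on W q \<and>
     (\<forall>(U, \<phi>)\<in>M. \<forall>(V, \<psi>)\<in>N. cinf_on (\<phi> ` (U \<inter> W \<inter> q -` V)) (\<psi> \<circ> q \<circ> inv_into U \<phi>))"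


section \<open>Tangent and cotangent vectors, tensor fields\<close>

text \<open>
  A tangent vector at \<open>p\<close> is the directional derivative at \<open>p\<close>, in some chart, acting on the functions
  that are smooth near \<open>p\<close>. Its value on other functions is set to 0, so that equality of
  tangent vectors is equality of functions. Likewise a covector at \<open>p\<close> is a linear functional on the
  tangent space that is set to 0 outside the tangent space.
\<close>

type_synonym 'm tvec = "('m \<Rightarrow> real) \<Rightarrow> real"
type_synonym 'm covec = "'m tvec \<Rightarrow> real"

definition tangent_space ::
  "('m::topological_space, 'e::real_normed_vector) atlas \<Rightarrow> 'm \<Rightarrow> 'm tvec set" where
  "tangent_space M p = {v. \<exists>(U, \<phi>)\<in>M. \<exists>e. p \<in> U \<and>
     v = (\<lambda>f. if smooth_near M p f
              then frechet_derivative (f \<circ> inv_into U \<phi>) (at (\<phi> p)) e else 0)}"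

definition on_tangent ::
  "('m::topological_space, 'e::real_normed_vector) atlas \<Rightarrow> 'm \<Rightarrow> ('m tvec \<Rightarrow> real) \<Rightarrow> 'm covec" where
  "on_tangent M p g = (\<lambda>v. if v \<in> tangent_space M p then g v else 0)"

definition cotangent_space ::
  "('m::topological_space, 'e::real_normed_vector) atlas \<Rightarrow> 'm \<Rightarrow> 'm covec set" where
  "cotangent_space M p =
     {\<alpha>. linear_on_subspace (tangent_space M p) \<alpha> \<and> (\<forall>v. v \<notin> tangent_space M p \<longrightarrow> \<alpha> v = 0)}"

definition vector_field ::
  "('m::topological_space, 'e::real_normed_vector) atlas \<Rightarrow> ('m \<Rightarrow> 'm tvec) \<Rightarrow> bool" where
  "vector_field M X \<longleftrightarrow> (\<forall>p. X p \<in> tangent_space M p) \<and>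
     (\<forall>W f. open W \<longrightarrow> smooth_fun_on M W f \<longrightarrow> smooth_fun_on M W (\<lambda>p. X p f))"

definition one_form ::
  "('m::topological_space, 'e::real_normed_vector) atlas \<Rightarrow> ('m \<Rightarrow> 'm covec) \<Rightarrow> bool" where
  "one_form M \<alpha> \<longleftrightarrow> (\<forall>p. \<alpha> p \<in> cotangent_space M p) \<and>
     (\<forall>X. vector_field M X \<longrightarrow> smooth_fun_on M UNIV (\<lambda>p. \<alpha> p (X p)))"

definition endomorphism_field ::
  "('m::topological_space, 'e::real_normed_vector) atlas \<Rightarrow> ('m \<Rightarrow> 'm tvec \<Rightarrow> 'm tvec) \<Rightarrow> bool" where
  "endomorphism_field M F \<longleftrightarrow>
     (\<forall>p. linear_on_subspace (tangent_space M p) (F p) \<and>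
          F p ` tangent_space M p \<subseteq> tangent_space M p) \<and>
     (\<forall>X. vector_field M X \<longrightarrow> vector_field M (\<lambda>p. F p (X p)))"

definition bivector_field ::
  "('m::topological_space, 'e::real_normed_vector) atlas \<Rightarrow>
   ('m \<Rightarrow> 'm covec \<Rightarrow> 'm covec \<Rightarrow> real) \<Rightarrow> bool" where
  "bivector_field M P \<longleftrightarrow> (\<forall>p. skew_bilinear_on (cotangent_space M p) (P p)) \<and>
     (\<forall>\<alpha> \<beta>. one_form M \<alpha> \<longrightarrow> one_form M \<beta> \<longrightarrow> smooth_fun_on M UNIV (\<lambda>p. P p (\<alpha> p) (\<beta> p)))"

definition two_form ::
  "('m::topological_space, 'e::real_normed_vector) atlas \<Rightarrow>
   ('m \<Rightarrow> 'm tvec \<Rightarrow> 'm tvec \<Rightarrow> real) \<Rightarrow> bool" where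
  "two_form M \<theta> \<longleftrightarrow> (\<forall>p. skew_bilinear_on (tangent_space M p) (\<theta> p)) \<and>
     (\<forall>X Y. vector_field M X \<longrightarrow> vector_field M Y \<longrightarrow> smooth_fun_on M UNIV (\<lambda>p. \<theta> p (X p) (Y p)))"

definition sharp ::
  "('m::topological_space, 'e::real_normed_vector) atlas \<Rightarrow>
   ('m \<Rightarrow> 'm covec \<Rightarrow> 'm covec \<Rightarrow> real) \<Rightarrow> 'm \<Rightarrow> 'm covec \<Rightarrow> 'm tvec" where
  "sharp M P p \<alpha> =
     (THE v. v \<in> tangent_space M p \<and> (\<forall>\<beta>\<in>cotangent_space M p. \<beta> v = P p \<alpha> \<beta>))"

definition flat ::
  "('m::topological_space, 'e::real_normed_vector) atlas \<Rightarrow>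
   ('m \<Rightarrow> 'm tvec \<Rightarrow> 'm tvec \<Rightarrow> real) \<Rightarrow> 'm \<Rightarrow> 'm tvec \<Rightarrow> 'm covec" where
  "flat M \<theta> p v = on_tangent M p (\<theta> p v)"

text \<open>The covector \<open>\<alpha> \<circ> F\<close>.\<close>

definition cov_comp ::
  "('m::topological_space, 'e::real_normed_vector) atlas \<Rightarrow>
   ('m \<Rightarrow> 'm tvec \<Rightarrow> 'm tvec) \<Rightarrow> 'm \<Rightarrow> 'm covec \<Rightarrow> 'm covec" where
  "cov_comp M F p \<alpha> = on_tangent M p (\<alpha> \<circ> F p)"

definition ext_d ::
  "('m::topological_space, 'e::real_normed_vector) atlas \<Rightarrow> ('m \<Rightarrow> real) \<Rightarrow> 'm \<Rightarrow> 'm covec" where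
  "ext_d M f p = on_tangent M p (\<lambda>v. v f)"

definition lie_bracket ::
  "('m::topological_space, 'e::real_normed_vector) atlas \<Rightarrow>
   ('m \<Rightarrow> 'm tvec) \<Rightarrow> ('m \<Rightarrow> 'm tvec) \<Rightarrow> 'm \<Rightarrow> 'm tvec" where
  "lie_bracket M X Y p =
     (\<lambda>f. if smooth_near M p f then X p (\<lambda>x. Y x f) - Y p (\<lambda>x. X x f) else 0)"

text \<open>The Lie derivative: \<open>(L\<^sub>X \<alpha>)(Y) = X(\<alpha>(Y)) - \<alpha>([X, Y])\<close>.\<close>

definition lie_form ::
  "('m::topological_space, 'e::real_normed_vector) atlas \<Rightarrow>
   ('m \<Rightarrow> 'm tvec) \<Rightarrow> ('m \<Rightarrow> 'm covec) \<Rightarrow> 'm \<Rightarrow> 'm covec" where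
  "lie_form M X \<alpha> = (THE \<omega>. one_form M \<omega> \<and>
     (\<forall>Y. vector_field M Y \<longrightarrow>
        (\<forall>p. \<omega> p (Y p) = X p (\<lambda>x. \<alpha> x (Y x)) - \<alpha> p (lie_bracket M X Y p))))"


section \<open>Complexification and integrability of an eigenbundle\<close>

text \<open>
  An element \<open>z = s + it\<close> of a complexified real vector space is the pair \<open>(s, t)\<close>. For a real
  endomorphism \<open>J\<close> of the bundle, \<open>Jz = iz\<close> reads \<open>Js = - t\<close> and \<open>Jt = s\<close>.
\<close>

definition eigen_sections ::
  "('m \<Rightarrow> 'v::real_vector) set \<Rightarrow> ('m \<Rightarrow> 'v \<Rightarrow> 'v) \<Rightarrow> (('m \<Rightarrow> 'v) \<times> ('m \<Rightarrow> 'v)) set" where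
  "eigen_sections \<Gamma> J =
     {(s, t). s \<in> \<Gamma> \<and> t \<in> \<Gamma> \<and> (\<forall>p. J p (s p) = - t p \<and> J p (t p) = s p)}"

definition complex_bracket ::
  "('s \<Rightarrow> 's \<Rightarrow> 's::real_vector) \<Rightarrow> 's \<times> 's \<Rightarrow> 's \<times> 's \<Rightarrow> 's \<times> 's" where
  "complex_bracket br z w =
     (br (fst z) (fst w) - br (snd z) (snd w), br (fst z) (snd w) + br (snd z) (fst w))"

definition eigenbundle_closed ::
  "('m \<Rightarrow> 'v::real_vector) set \<Rightarrow> ('m \<Rightarrow> 'v \<Rightarrow> 'v) \<Rightarrow>
   (('m \<Rightarrow> 'v) \<Rightarrow> ('m \<Rightarrow> 'v) \<Rightarrow> ('m \<Rightarrow> 'v)) \<Rightarrow> bool" where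
  "eigenbundle_closed \<Gamma> J br \<longleftrightarrow>
     (\<forall>z\<in>eigen_sections \<Gamma> J. \<forall>w\<in>eigen_sections \<Gamma> J. complex_bracket br z w \<in> eigen_sections \<Gamma> J)"


section \<open>Generalized almost contact structures of codimension h\<close>

definition gen_almost_contact ::
  "('m::topological_space, 'e::real_normed_vector) atlas \<Rightarrow> nat \<Rightarrow>
   ('m \<Rightarrow> 'm covec \<Rightarrow> 'm covec \<Rightarrow> real) \<Rightarrow> ('m \<Rightarrow> 'm tvec \<Rightarrow> 'm tvec \<Rightarrow> real) \<Rightarrow>
   ('m \<Rightarrow> 'm tvec \<Rightarrow> 'm tvec) \<Rightarrow> (nat \<Rightarrow> 'm \<Rightarrow> 'm tvec) \<Rightarrow> (nat \<Rightarrow> 'm \<Rightarrow> 'm covec) \<Rightarrow> bool" where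
  "gen_almost_contact M h P \<theta> F Z \<xi> \<longleftrightarrow>
     bivector_field M P \<and> two_form M \<theta> \<and> endomorphism_field M F \<and>
     (\<forall>a\<in>{1..h}. vector_field M (Z a) \<and> one_form M (\<xi> a)) \<and>
     (\<forall>p. \<forall>\<alpha>\<in>cotangent_space M p. \<forall>\<beta>\<in>cotangent_space M p.
        P p (cov_comp M F p \<alpha>) \<beta> = P p \<alpha> (cov_comp M F p \<beta>)) \<and>
     (\<forall>p. \<forall>v\<in>tangent_space M p. \<forall>w\<in>tangent_space M p. \<theta> p (F p v) w = \<theta> p v (F p w)) \<and>
     (\<forall>p. \<forall>a\<in>{1..h}.
        F p (Z a p) = 0 \<and>
        (\<forall>v\<in>tangent_space M p. \<xi> a p (F p v) = 0) \<and>
        (\<forall>v\<in>tangent_space M p. \<theta> p (Z a p) v = 0) \<and>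
        (\<forall>\<beta>\<in>cotangent_space M p. P p (\<xi> a p) \<beta> = 0) \<and>
        (\<forall>b\<in>{1..h}. \<xi> a p (Z b p) = (if a = b then 1 else 0))) \<and>
     (\<forall>p. \<forall>v\<in>tangent_space M p.
        F p (F p v) = - v - sharp M P p (flat M \<theta> p v) + (\<Sum>a\<in>{1..h}. \<xi> a p v *\<^sub>R Z a p))"

text \<open>
  The fibre of \<open>(TM \<times> \<real>\<^sup>h) \<oplus> (T\<^sup>*M \<times> \<real>\<^sup>h)\<close>; an element of \<open>\<real>\<^sup>h\<close> is a function that vanishes
  outside \<open>{1..h}\<close>.
\<close>

type_synonym 'm big_vec = "('m tvec \<times> (nat \<Rightarrow> real)) \<times> ('m covec \<times> (nat \<Rightarrow> real))"

definition big_sections ::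
  "('m::topological_space, 'e::real_normed_vector) atlas \<Rightarrow> nat \<Rightarrow> ('m \<Rightarrow> 'm big_vec) set" where
  "big_sections M h = {\<lambda>p. ((X p, \<lambda>a. u a p), (\<alpha> p, \<lambda>a. v a p)) | X u \<alpha> v.
     vector_field M X \<and> one_form M \<alpha> \<and>
     (\<forall>a\<in>{1..h}. smooth_fun_on M UNIV (u a) \<and> smooth_fun_on M UNIV (v a)) \<and>
     (\<forall>a. a \<notin> {1..h} \<longrightarrow> u a = 0 \<and> v a = 0)}"

definition big_Phi ::
  "('m::topological_space, 'e::real_normed_vector) atlas \<Rightarrow> nat \<Rightarrow>
   ('m \<Rightarrow> 'm covec \<Rightarrow> 'm covec \<Rightarrow> real) \<Rightarrow> ('m \<Rightarrow> 'm tvec \<Rightarrow> 'm tvec \<Rightarrow> real) \<Rightarrow>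
   ('m \<Rightarrow> 'm tvec \<Rightarrow> 'm tvec) \<Rightarrow> (nat \<Rightarrow> 'm \<Rightarrow> 'm tvec) \<Rightarrow> (nat \<Rightarrow> 'm \<Rightarrow> 'm covec) \<Rightarrow>
   'm \<Rightarrow> 'm big_vec \<Rightarrow> 'm big_vec" where
  "big_Phi M h P \<theta> F Z \<xi> p = (\<lambda>((X, u), (\<alpha>, v)).
     ((F p X + sharp M P p \<alpha> - (\<Sum>a\<in>{1..h}. v a *\<^sub>R Z a p),
       \<lambda>a. if a \<in> {1..h} then \<alpha> (Z a p) else 0),
      (flat M \<theta> p X - (\<Sum>a\<in>{1..h}. u a *\<^sub>R \<xi> a p) - cov_comp M F p \<alpha>,
       \<lambda>a. if a \<in> {1..h} then \<xi> a p X else 0)))"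

definition stable_courant_bracket ::
  "('m::topological_space, 'e::real_normed_vector) atlas \<Rightarrow> nat \<Rightarrow>
   ('m \<Rightarrow> 'm big_vec) \<Rightarrow> ('m \<Rightarrow> 'm big_vec) \<Rightarrow> 'm \<Rightarrow> 'm big_vec" where
  "stable_courant_bracket M h s1 s2 =
     (let X1 = (\<lambda>p. fst (fst (s1 p))); u1 = (\<lambda>a p. snd (fst (s1 p)) a);
          \<alpha>1 = (\<lambda>p. fst (snd (s1 p))); v1 = (\<lambda>a p. snd (snd (s1 p)) a);
          X2 = (\<lambda>p. fst (fst (s2 p))); u2 = (\<lambda>a p. snd (fst (s2 p)) a);
          \<alpha>2 = (\<lambda>p. fst (snd (s2 p))); v2 = (\<lambda>a p. snd (snd (s2 p)) a)
      in (\<lambda>p.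
        ((lie_bracket M X1 X2 p, \<lambda>a. X1 p (u2 a) - X2 p (u1 a)),
         (lie_form M X1 \<alpha>2 p - lie_form M X2 \<alpha>1 p
            + (1/2) *\<^sub>R ext_d M (\<lambda>x. \<alpha>1 x (X2 x) - \<alpha>2 x (X1 x)) p
            + (1/2) *\<^sub>R (\<Sum>a\<in>{1..h}. u2 a p *\<^sub>R ext_d M (v1 a) p + v2 a p *\<^sub>R ext_d M (u1 a) p
                                   - u1 a p *\<^sub>R ext_d M (v2 a) p - v1 a p *\<^sub>R ext_d M (u2 a) p),
          \<lambda>a. X1 p (v2 a) - X2 p (v1 a)))))"

definition normal_gen_almost_contact ::
  "('m::topological_space, 'e::real_normed_vector) atlas \<Rightarrow> nat \<Rightarrow>
   ('m \<Rightarrow> 'm covec \<Rightarrow> 'm covec \<Rightarrow> real) \<Rightarrow> ('m \<Rightarrow> 'm tvec \<Rightarrow> 'm tvec \<Rightarrow> real) \<Rightarrow>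
   ('m \<Rightarrow> 'm tvec \<Rightarrow> 'm tvec) \<Rightarrow> (nat \<Rightarrow> 'm \<Rightarrow> 'm tvec) \<Rightarrow> (nat \<Rightarrow> 'm \<Rightarrow> 'm covec) \<Rightarrow> bool" where
  "normal_gen_almost_contact M h P \<theta> F Z \<xi> \<longleftrightarrow>
     gen_almost_contact M h P \<theta> F Z \<xi> \<and>
     eigenbundle_closed (big_sections M h) (big_Phi M h P \<theta> F Z \<xi>) (stable_courant_bracket M h)"


section \<open>Generalized complex structures\<close>

definition gen_sections ::
  "('n::topological_space, 'f::real_normed_vector) atlas \<Rightarrow> ('n \<Rightarrow> 'n tvec \<times> 'n covec) set" where
  "gen_sections N = {\<lambda>p. (X p, \<alpha> p) | X \<alpha>. vector_field N X \<and> one_form N \<alpha>}"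

definition gen_endo ::
  "('n::topological_space, 'f::real_normed_vector) atlas \<Rightarrow>
   ('n \<Rightarrow> 'n tvec \<Rightarrow> 'n tvec) \<Rightarrow> ('n \<Rightarrow> 'n covec \<Rightarrow> 'n covec \<Rightarrow> real) \<Rightarrow>
   ('n \<Rightarrow> 'n tvec \<Rightarrow> 'n tvec \<Rightarrow> real) \<Rightarrow> 'n \<Rightarrow> 'n tvec \<times> 'n covec \<Rightarrow> 'n tvec \<times> 'n covec" where
  "gen_endo N A \<pi> \<sigma> p =
     (\<lambda>(X, \<alpha>). (A p X + sharp N \<pi> p \<alpha>, flat N \<sigma> p X - cov_comp N A p \<alpha>))"

definition courant_bracket ::
  "('n::topological_space, 'f::real_normed_vector) atlas \<Rightarrow>
   ('n \<Rightarrow> 'n tvec \<times> 'n covec) \<Rightarrow> ('n \<Rightarrow> 'n tvec \<times> 'n covec) \<Rightarrow> 'n \<Rightarrow> 'n tvec \<times> 'n covec" where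
  "courant_bracket N s t =
     (let X = (\<lambda>p. fst (s p)); \<alpha> = (\<lambda>p. snd (s p)); Y = (\<lambda>p. fst (t p)); \<beta> = (\<lambda>p. snd (t p))
      in (\<lambda>p. (lie_bracket N X Y p,
              lie_form N X \<beta> p - lie_form N Y \<alpha> p
                - (1/2) *\<^sub>R ext_d N (\<lambda>x. \<beta> x (X x) - \<alpha> x (Y x)) p)))"

definition gen_complex ::
  "('n::topological_space, 'f::real_normed_vector) atlas \<Rightarrow>
   ('n \<Rightarrow> 'n tvec \<Rightarrow> 'n tvec) \<Rightarrow> ('n \<Rightarrow> 'n covec \<Rightarrow> 'n covec \<Rightarrow> real) \<Rightarrow>
   ('n \<Rightarrow> 'n tvec \<Rightarrow> 'n tvec \<Rightarrow> real) \<Rightarrow> bool" where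
  "gen_complex N A \<pi> \<sigma> \<longleftrightarrow>
     endomorphism_field N A \<and> bivector_field N \<pi> \<and> two_form N \<sigma> \<and>
     (\<forall>p. \<forall>z\<in>tangent_space N p \<times> cotangent_space N p.
        gen_endo N A \<pi> \<sigma> p (gen_endo N A \<pi> \<sigma> p z) = - z) \<and>
     eigenbundle_closed (gen_sections N) (gen_endo N A \<pi> \<sigma>) (courant_bracket N)"


section \<open>Spaces of leaves and projection\<close>

definition push_vec ::
  "('n::topological_space, 'f::real_normed_vector) atlas \<Rightarrow> ('m \<Rightarrow> 'n) \<Rightarrow> 'm \<Rightarrow> 'm tvec \<Rightarrow> 'n tvec" where
  "push_vec N q p v = (\<lambda>g. if smooth_near N (q p) g then v (g \<circ> q) else 0)"

definition pull_covec ::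
  "('m::topological_space, 'e::real_normed_vector) atlas \<Rightarrow>
   ('n::topological_space, 'f::real_normed_vector) atlas \<Rightarrow> ('m \<Rightarrow> 'n) \<Rightarrow> 'm \<Rightarrow> 'n covec \<Rightarrow> 'm covec" where
  "pull_covec M N q p \<beta> = on_tangent M p (\<lambda>v. \<beta> (push_vec N q p v))"

definition velocity ::
  "('m::topological_space, 'e::real_normed_vector) atlas \<Rightarrow> (real \<Rightarrow> 'm) \<Rightarrow> real \<Rightarrow> 'm tvec" where
  "velocity M \<gamma> t = (\<lambda>f. if smooth_near M (\<gamma> t) f then deriv (f \<circ> \<gamma>) t else 0)"

text \<open>
  For an involutive distribution \<open>D\<close> of constant rank and open \<open>U\<close>, the leaf through \<open>x\<close> of the
  restriction to \<open>U\<close> of the foliation tangent to \<open>D\<close> consists of the endpoints of the smooth curves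
  in \<open>U\<close> that start at \<open>x\<close> and are tangent to \<open>D\<close>.
\<close>

definition same_leaf ::
  "('m::topological_space, 'e::real_normed_vector) atlas \<Rightarrow> ('m \<Rightarrow> 'm tvec set) \<Rightarrow> 'm set \<Rightarrow>
   'm \<Rightarrow> 'm \<Rightarrow> bool" where
  "same_leaf M D U x y \<longleftrightarrow> (\<exists>J \<gamma>. open J \<and> {0..1} \<subseteq> J \<and> smooth_map_on line_atlas M J \<gamma> \<and>
     \<gamma> ` J \<subseteq> U \<and> \<gamma> 0 = x \<and> \<gamma> 1 = y \<and> (\<forall>t\<in>J. velocity M \<gamma> t \<in> D (\<gamma> t)))"

text \<open>
  \<open>N\<close> is the (Hausdorff, second countable) manifold of leaves of the foliation restricted to the open
  set \<open>U\<close>, and \<open>q\<close> is the projection \<open>U \<rightarrow> N\<close>: a surjective submersion whose fibres are the leaves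
  and whose vertical spaces are tangent to the leaves. \<open>U = UNIV\<close> is the case where the global
  space of leaves is a manifold. The values of \<open>q\<close> outside \<open>U\<close> are irrelevant.
\<close>

definition leaf_space ::
  "('m::topological_space, 'e::real_normed_vector) atlas \<Rightarrow> ('m \<Rightarrow> 'm tvec set) \<Rightarrow> 'm set \<Rightarrow>
   ('n::{t2_space,second_countable_topology}, 'f::finite_dim_inner) atlas \<Rightarrow> ('m \<Rightarrow> 'n) \<Rightarrow> bool" where
  "leaf_space M D U N q \<longleftrightarrow>
     open U \<and> smooth_manifold N \<and> smooth_map_on M N U q \<and> q ` U = UNIV \<and>
     (\<forall>p\<in>U. push_vec N q p ` tangent_space M p = tangent_space N (q p)) \<and>
     (\<forall>p\<in>U. {v \<in> tangent_space M p. push_vec N q p v = 0} = D p) \<and>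
     (\<forall>x\<in>U. \<forall>y\<in>U. q x = q y \<longleftrightarrow> same_leaf M D U x y)"

definition projects_to ::
  "('m::topological_space, 'e::real_normed_vector) atlas \<Rightarrow> 'm set \<Rightarrow>
   ('n::topological_space, 'f::real_normed_vector) atlas \<Rightarrow> ('m \<Rightarrow> 'n) \<Rightarrow>
   ('m \<Rightarrow> 'm tvec \<Rightarrow> 'm tvec) \<Rightarrow> ('m \<Rightarrow> 'm covec \<Rightarrow> 'm covec \<Rightarrow> real) \<Rightarrow>
   ('m \<Rightarrow> 'm tvec \<Rightarrow> 'm tvec \<Rightarrow> real) \<Rightarrow>
   ('n \<Rightarrow> 'n tvec \<Rightarrow> 'n tvec) \<Rightarrow> ('n \<Rightarrow> 'n covec \<Rightarrow> 'n covec \<Rightarrow> real) \<Rightarrow>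
   ('n \<Rightarrow> 'n tvec \<Rightarrow> 'n tvec \<Rightarrow> real) \<Rightarrow> bool" where
  "projects_to M U N q F P \<theta> A \<pi> \<sigma> \<longleftrightarrow> (\<forall>p\<in>U.
     (\<forall>v\<in>tangent_space M p. push_vec N q p (F p v) = A (q p) (push_vec N q p v)) \<and>
     (\<forall>\<alpha>\<in>cotangent_space N (q p). \<forall>\<beta>\<in>cotangent_space N (q p).
        P p (pull_covec M N q p \<alpha>) (pull_covec M N q p \<beta>) = \<pi> (q p) \<alpha> \<beta>) \<and>
     (\<forall>v\<in>tangent_space M p. \<forall>w\<in>tangent_space M p.
        \<theta> p v w = \<sigma> (q p) (push_vec N q p v) (push_vec N q p w)))"

end

theory Submission
  imports Defs
begin

text \<open>
  Write \<open>\<Phi>\<close> for the endomorphism of the big tangent bundle. For every section \<open>s\<close> the pair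
  \<open>\<Phi>s + is\<close> is a section of the eigenbundle, so normality says that the Nijenhuis torsion of \<open>\<Phi>\<close> with
  respect to the stable Courant bracket vanishes on any two global sections. Inserting
  \<open>s = (Z\<^sub>a, 0; 0, 0)\<close>, for which \<open>\<Phi>s\<close> is the constant section \<open>(0, 0; 0, e\<^sub>a)\<close>, yields
  \<open>[Z\<^sub>a, Z\<^sub>b] = 0\<close> and the invariance of \<open>F\<close>, \<open>P\<close>, \<open>\<theta>\<close> under the \<open>Z\<^sub>a\<close>. As \<open>F\<close> and \<open>\<theta>\<close> also annihilate the
  \<open>Z\<^sub>a\<close>, evaluating the three tensors on lifts from \<open>N\<close> gives functions that are constant along the
  curves tangent to the leaves, hence tensors \<open>(A, \<pi>, \<sigma>)\<close> on \<open>N\<close>; these are smooth because a function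
  whose pullback under a submersion is smooth is itself smooth. Finally \<open>\<Phi>\<close> and the stable bracket of
  lifted sections project, up to vertical vectors, to the endomorphism and the Courant bracket of
  \<open>N\<close>, so the vanishing of the torsion passes to \<open>N\<close>.
\<close>


section \<open>Calculus in finite-dimensional spaces\<close>

text \<open>Closedness, \<open>lie_form\<close> and smoothness of tensors are stated with global
  fields and forms, but lifts through q exist only near a point. Hence a lift is a global object
  that has to match only near a given p (\<open>related\<close>, \<open>related_form\<close>);
  cut-off functions provide it, and this suffices because all operators involved are local.

  q is a submersion only in the sense that its differentials are onto, and no local normal form is
  derived. Fields are lifted by row operations with smooth coefficients. For descent of smoothness,
  a local section of q that is differentiable at a single point yields first derivatives; higher
  orders follow because a coordinate derivative of f pulls back to the derivative of
  \<open>f \<circ> q\<close> along a lifted field.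

  The passage back to the eigenbundle on N works since every eigensection has the form
  \<open>Js + is\<close>, so that a torsion identity for real sections is equivalent to closedness.
  Dimension 0 is possible for N, so all coordinate expansions use the possibly empty basis
  \<open>onb\<close>.\<close>

lemma scaleR_fun_apply: "(c *\<^sub>R f) x = c *\<^sub>R f x"
  by (simp add: scaleR_fun_def)

lemma sum_fun_apply: "(\<Sum>i\<in>I. f i) x = (\<Sum>i\<in>I. f i x)"
  by (induct I rule: infinite_finite_induct) auto

lemma skewD:
  assumes "skew_bilinear_on S b" "x \<in> S" "y \<in> S"
  shows "b x y = - b y x"
    and "z \<in> S \<Longrightarrow> b x (y + z) = b x y + b x z" "b x (c *\<^sub>R y) = c * b x y"
    and "z \<in> S \<Longrightarrow> b (x + z) y = b x y + b z y" "b (c *\<^sub>R x) y = c * b x y"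
proof -
  have "linear_on_subspace S (b x)" "linear_on_subspace S (\<lambda>x. b x y)"
    and "\<forall>x\<in>S. \<forall>y\<in>S. b x y = - b y x"
    using assms unfolding skew_bilinear_on_def by blast+
  note l = this(1,2)[unfolded linear_on_subspace_def] and s = this(3)
  show "b x y = - b y x" using s assms(2,3) by blast
  show "z \<in> S \<Longrightarrow> b x (y + z) = b x y + b x z" using l(1) assms(3) by blast
  show "z \<in> S \<Longrightarrow> b (x + z) y = b x y + b z y" using l(2) assms(2) by blast
  show "b x (c *\<^sub>R y) = c * b x y" using l(1) assms(3) by simp
  show "b (c *\<^sub>R x) y = c * b x y" using l(2) assms(2) by simp
qed

section \<open>Orthonormal bases and compact balls in the model spaces\<close>

definition onb :: "'a::finite_dim_inner set" where
  "onb = (SOME B. finite B \<and> (\<forall>b\<in>B. \<forall>c\<in>B. b \<bullet> c = (if b = c then 1 else 0)) \<and>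
     (\<forall>x. x = (\<Sum>b\<in>B. (x \<bullet> b) *\<^sub>R b)))"

text \<open>An orthogonal set with the same span as a finite spanning set is stripped of 0 and
  normalised. The residual of the expansion is orthogonal to the whole span, hence to itself. In
  dimension 0 the basis is empty.\<close>

lemma ex_orthonormal_basis:
  "\<exists>B::'a::finite_dim_inner set. finite B \<and> (\<forall>b\<in>B. \<forall>c\<in>B. b \<bullet> c = (if b = c then 1 else 0)) \<and>
     (\<forall>x. x = (\<Sum>b\<in>B. (x \<bullet> b) *\<^sub>R b))"
proof -
  obtain B0 :: "'a set" where B0: "finite B0" "\<forall>x. \<exists>c. x = (\<Sum>b\<in>B0. c b *\<^sub>R b)"
    using ex_finite_spanning by blast
  have sp: "span B0 = UNIV"
    by (metis (mono_tags, lifting) B0(2) UNIV_eq_I span_base span_scale span_sum)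
  obtain C where C: "finite C" "span C = span B0" "pairwise orthogonal C"
    using basis_orthogonal[OF B0(1)] by blast
  define B where "B = (\<lambda>c. c /\<^sub>R norm c) ` (C - {0})"
  have fB: "finite B" unfolding B_def using C by simp
  have orth: "b \<bullet> c = (if b = c then 1 else 0)" if "b \<in> B" "c \<in> B" for b c
  proof -
    have "\<exists>x. x \<in> C \<and> x \<noteq> 0 \<and> b = x /\<^sub>R norm x" using that(1) unfolding B_def by blast
    then obtain x where x: "x \<in> C" "x \<noteq> 0" "b = x /\<^sub>R norm x" by blast
    have "\<exists>y. y \<in> C \<and> y \<noteq> 0 \<and> c = y /\<^sub>R norm y" using that(2) unfolding B_def by blast
    then obtain y where y: "y \<in> C" "y \<noteq> 0" "c = y /\<^sub>R norm y" by blast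
    show ?thesis
    proof (cases "x = y")
      case True
      then show ?thesis using x y by (auto simp: dot_square_norm power2_eq_square)
    next
      case False
      then have o: "x \<bullet> y = 0" using C(3) x y by (auto simp: pairwise_def orthogonal_def)
      then have bc: "b \<bullet> c = 0" using x y by simp
      moreover have "b \<bullet> b = 1" using x by (auto simp: dot_square_norm power2_eq_square)
      ultimately show ?thesis by auto
    qed
  qed
  have "C \<subseteq> span B"
  proof
    fix c assume "c \<in> C"
    show "c \<in> span B"
    proof (cases "c = 0")
      case False
      then have "c = norm c *\<^sub>R (c /\<^sub>R norm c)" by simp
      moreover have "c /\<^sub>R norm c \<in> B" using \<open>c \<in> C\<close> False B_def by auto
      ultimately show ?thesis by (metis span_base span_scale)
    qed (simp add: span_zero)
  qed
  then have spB: "span B = UNIV"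
    using C(2) sp by (metis UNIV_eq_I span_mono span_span subsetD UNIV_I)
  have exp: "x = (\<Sum>b\<in>B. (x \<bullet> b) *\<^sub>R b)" for x
  proof -
    define y where "y = x - (\<Sum>b\<in>B. (x \<bullet> b) *\<^sub>R b)"
    have yb: "y \<bullet> b = 0" if "b \<in> B" for b
    proof -
      have "(\<Sum>c\<in>B. (x \<bullet> c) *\<^sub>R c) \<bullet> b = (\<Sum>c\<in>B. (x \<bullet> c) * (c \<bullet> b))"
        by (simp add: inner_sum_left)
      also have "\<dots> = (\<Sum>c\<in>B. if c = b then x \<bullet> c else 0)"
        by (rule sum.cong) (use orth that in auto)
      also have "\<dots> = x \<bullet> b" using that fB by simp
      finally show ?thesis unfolding y_def by (simp add: inner_diff_left)
    qed
    have "y \<bullet> z = 0" if "z \<in> span B" for z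
      using that by (induct rule: span_induct_alt) (auto simp: inner_add_right yb)
    then have "y \<bullet> y = 0" using spB by auto
    then show ?thesis unfolding y_def by simp
  qed
  show ?thesis using fB orth exp by blast
qed

lemma finite_onb [simp]: "finite (onb :: 'a::finite_dim_inner set)"
  and inner_onb: "b \<in> onb \<Longrightarrow> c \<in> onb \<Longrightarrow> b \<bullet> c = (if b = (c::'a) then 1 else 0)"
  and onb_expansion: "(\<Sum>b\<in>onb. (x \<bullet> b) *\<^sub>R b) = (x :: 'a)"
  using someI_ex[OF ex_orthonormal_basis[where 'a='a]] unfolding onb_def[symmetric] by auto

lemma linear_onb_expansion:
  fixes x :: "'a::finite_dim_inner"
  assumes "linear f"
  shows "f x = (\<Sum>b\<in>onb. (x \<bullet> b) *\<^sub>R f b)"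
proof -
  have "f x = f (\<Sum>b\<in>onb. (x \<bullet> b) *\<^sub>R b)" by (simp add: onb_expansion)
  also have "\<dots> = (\<Sum>b\<in>onb. (x \<bullet> b) *\<^sub>R f b)"
    using assms by (simp add: linear_sum linear_scale)
  finally show ?thesis .
qed

text \<open>The explicit constant matters: for the derivative of a C^1 map it is a continuous
  function of the point, which \<open>local_right_inverse\<close> exploits.\<close>

lemma linear_on_onb_bounded:
  fixes f :: "'a::finite_dim_inner \<Rightarrow> 'b::real_normed_vector"
  assumes "linear f"
  shows "norm (f x) \<le> (\<Sum>b\<in>onb. norm (f b)) * norm x"
proof -
  have "norm (f x) = norm (\<Sum>b\<in>onb. (x \<bullet> b) *\<^sub>R f b)"
    by (subst linear_onb_expansion[OF assms]) (rule refl)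
  also have "\<dots> \<le> (\<Sum>b\<in>onb. norm ((x \<bullet> b) *\<^sub>R f b))" by (rule norm_sum)
  also have "\<dots> \<le> (\<Sum>b\<in>onb. norm (f b) * norm x)"
  proof (rule sum_mono)
    fix b :: 'a assume b: "b \<in> onb"
    have "b \<bullet> b = 1" using inner_onb[OF b b] by simp
    then have "norm b = 1" by (simp add: norm_eq_sqrt_inner)
    then have "\<bar>x \<bullet> b\<bar> \<le> norm x" using Cauchy_Schwarz_ineq2[of x b] by simp
    then show "norm ((x \<bullet> b) *\<^sub>R f b) \<le> norm (f b) * norm x"
      using mult_right_mono[of "\<bar>x \<bullet> b\<bar>" "norm x" "norm (f b)"]
      by (simp add: mult.commute)
  qed
  finally show ?thesis by (simp add: sum_distrib_right)
qed

lemma linear_finite_dim_bounded: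
  fixes f :: "'a::finite_dim_inner \<Rightarrow> 'b::real_normed_vector"
  assumes "linear f"
  shows "bounded_linear f"
  using linear_on_onb_bounded[OF assms] assms
  by (intro bounded_linear_intro[where K="\<Sum>b\<in>onb. norm (f b)"])
     (auto simp: linear_add linear_scale mult.commute)

text \<open>A set of combinations with coefficients bounded by r is a sum of finitely many segments,
  hence compact. By Cauchy-Schwarz the ball lies in such a set for the orthonormal basis, and a
  closed part of a compact set is compact.\<close>

lemma compact_cball_finite_dim: "compact (cball (x0::'a::finite_dim_inner) r)"
proof -
  have "compact {y. \<exists>c. y = (\<Sum>b\<in>B. c b *\<^sub>R b) \<and> (\<forall>b\<in>B. \<bar>c b\<bar> \<le> r)}"
    if "finite B" for B :: "'a set" and r
    using that
  proof (induct rule: finite_induct)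
    case empty
    then show ?case by simp
  next
    case (insert b B)
    let ?S = "\<lambda>B. {y. \<exists>c. y = (\<Sum>b\<in>B. c b *\<^sub>R b) \<and> (\<forall>b\<in>B. \<bar>c b\<bar> \<le> r)}"
    have "compact ((\<lambda>t. t *\<^sub>R b) ` {-r..r})"
      by (intro compact_continuous_image continuous_intros compact_Icc)
    then have "compact {x + y | x y. x \<in> (\<lambda>t. t *\<^sub>R b) ` {-r..r} \<and> y \<in> ?S B}"
      using insert.hyps by (intro compact_sums) auto
    also have "{x + y | x y. x \<in> (\<lambda>t. t *\<^sub>R b) ` {-r..r} \<and> y \<in> ?S B} = ?S (insert b B)" (is "?L = ?R")
    proof
      show "?L \<subseteq> ?R"
      proof
        fix z assume "z \<in> ?L"
        then obtain u y where uy: "z = u + y" "u \<in> (\<lambda>t. t *\<^sub>R b) ` {-r..r}" "y \<in> ?S B" by blast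
        obtain t where t: "u = t *\<^sub>R b" "t \<in> {-r..r}" using uy(2) by blast
        obtain c where c: "y = (\<Sum>b\<in>B. c b *\<^sub>R b)" "\<forall>b\<in>B. \<bar>c b\<bar> \<le> r" using uy(3) by blast
        have tc: "\<bar>t\<bar> \<le> r" "z = t *\<^sub>R b + (\<Sum>b\<in>B. c b *\<^sub>R b)" "\<forall>b\<in>B. \<bar>c b\<bar> \<le> r"
          using uy(1) t c by auto
        have "(\<Sum>x\<in>B. (c(b := t)) x *\<^sub>R x) = (\<Sum>b\<in>B. c b *\<^sub>R b)"
          by (rule sum.cong) (use insert.hyps in auto)
        then have "z = (\<Sum>x\<in>insert b B. (c(b := t)) x *\<^sub>R x)"
          using insert.hyps tc(2) by simp
        moreover have "\<forall>x\<in>insert b B. \<bar>(c(b := t)) x\<bar> \<le> r" using tc by auto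
        ultimately show "z \<in> ?R" by blast
      qed
      show "?R \<subseteq> ?L"
      proof
        fix z assume "z \<in> ?R"
        then obtain c where c: "z = (\<Sum>b\<in>insert b B. c b *\<^sub>R b)" "\<forall>b\<in>insert b B. \<bar>c b\<bar> \<le> r" by blast
        then have "z = c b *\<^sub>R b + (\<Sum>b\<in>B. c b *\<^sub>R b)" using insert.hyps by simp
        moreover have "c b \<in> {-r..r}" using c(2) by auto
        ultimately show "z \<in> ?L" using c(2) by blast
      qed
    qed
    finally show ?case .
  qed
  note K = this
  let ?K = "{y. \<exists>c. y = (\<Sum>b\<in>(onb::'a set). c b *\<^sub>R b) \<and> (\<forall>b\<in>onb. \<bar>c b\<bar> \<le> norm x0 + r)}"
  have "cball x0 r \<subseteq> ?K"
  proof
    fix y assume "y \<in> cball x0 r"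
    then have "dist x0 y \<le> r" by simp
    then have ny: "norm y \<le> norm x0 + r"
      using norm_triangle_ineq4[of x0 "x0 - y"] by (simp add: dist_norm)
    have "\<bar>y \<bullet> b\<bar> \<le> norm x0 + r" if b: "b \<in> onb" for b
    proof -
      have "b \<bullet> b = 1" using inner_onb[OF b b] by simp
      then have "norm b = 1" by (simp add: norm_eq_sqrt_inner)
      then show ?thesis using Cauchy_Schwarz_ineq2[of y b] ny by simp
    qed
    then show "y \<in> ?K"
      by (intro CollectI exI[of _ "\<lambda>b. y \<bullet> b"]) (auto simp: onb_expansion)
  qed
  then have e: "?K \<inter> cball x0 r = cball x0 r" by blast
  show ?thesis using compact_Int_closed[OF K[OF finite_onb, of "norm x0 + r"] closed_cball[of x0 r]] unfolding e .
qed

section \<open>Rules for k times continuously differentiable maps\<close>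

lemma ck_on_cong:
  assumes "open S" "\<And>x. x \<in> S \<Longrightarrow> f x = g x" "ck_on k S f"
  shows "ck_on k S g"
  using assms(2,3)
proof (induct k arbitrary: f g)
  case 0
  then show ?case using continuous_on_eq by auto
next
  case (Suc k)
  have d: "f differentiable at x" if "x \<in> S" for x using Suc.prems that by auto
  have gd: "g differentiable at x" if "x \<in> S" for x
    using d[OF that] Suc.prems(1) assms(1) that
    by (metis differentiable_def has_derivative_transform_within_open)
  have "ck_on k S (\<lambda>x. frechet_derivative g (at x) v)" for v
  proof (rule Suc.hyps)
    show "ck_on k S (\<lambda>x. frechet_derivative f (at x) v)" using Suc.prems by auto
    show "\<And>x. x \<in> S \<Longrightarrow> frechet_derivative f (at x) v = frechet_derivative g (at x) v"
      using frechet_derivative_transform_within_open[OF d assms(1)] Suc.prems(1) by metis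
  qed
  then show ?case using gd by auto
qed

lemma ck_on_subset: "ck_on k S f \<Longrightarrow> T \<subseteq> S \<Longrightarrow> ck_on k T f"
  by (induct k arbitrary: f) (auto intro: continuous_on_subset)

lemma ck_on_SucD: "ck_on (Suc k) S f \<Longrightarrow> ck_on k S f"
proof (induct k arbitrary: f)
  case 0
  then show ?case
    by (auto intro!: continuous_at_imp_continuous_on differentiable_imp_continuous_within)
next
  case (Suc k)
  have 1: "\<forall>x\<in>S. f differentiable at x"
    and 2: "\<And>v. ck_on (Suc k) S (\<lambda>x. frechet_derivative f (at x) v)"
    using Suc.prems by (simp_all (no_asm_use) only: ck_on.simps(2)) blast+
  have "\<And>v. ck_on k S (\<lambda>x. frechet_derivative f (at x) v)" by (rule Suc.hyps) (rule 2)
  then show ?case using 1 by simp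
qed

lemma ck_on_local:
  assumes "\<And>x. x \<in> S \<Longrightarrow> \<exists>T. open T \<and> x \<in> T \<and> ck_on k T f"
  shows "ck_on k S f"
  using assms
proof (induct k arbitrary: f)
  case 0
  then show ?case
    by (metis ck_on.simps(1) continuous_at_imp_continuous_on continuous_on_eq_continuous_at)
next
  case (Suc k)
  have "f differentiable at x" if "x \<in> S" for x using Suc.prems[OF that] by auto
  moreover have "ck_on k S (\<lambda>x. frechet_derivative f (at x) v)" for v
    by (rule Suc.hyps) (use Suc.prems in \<open>auto; blast\<close>)
  ultimately show ?case by auto
qed

lemma ck_on_const [simp]: "ck_on k S (\<lambda>x. c)"
  by (induct k arbitrary: c) (auto simp: frechet_derivative_const)

lemma ck_on_bounded_linear: "bounded_linear f \<Longrightarrow> ck_on k S f"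
proof (cases k)
  case 0
  then show "bounded_linear f \<Longrightarrow> ck_on k S f" by (auto intro: linear_continuous_on)
next
  case (Suc n)
  assume f: "bounded_linear f"
  then have "(f has_derivative f) (at x)" for x by (rule bounded_linear_imp_has_derivative)
  then have "f differentiable at x" "frechet_derivative f (at x) = f" for x
    by (auto simp: differentiable_def frechet_derivative_at[symmetric])
  then show ?thesis using Suc by auto
qed

lemma frechet_at_eq: "(f has_derivative f') (at x) \<Longrightarrow> frechet_derivative f (at x) = f'"
  using frechet_derivative_at by metis

lemma ck_on_add:
  assumes "open S" "ck_on k S f" "ck_on k S g"
  shows "ck_on k S (\<lambda>x. f x + g x)"
  using assms(2,3)
proof (induct k arbitrary: f g)
  case 0
  then show ?case by (auto intro: continuous_intros)
next
  case (Suc k)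
  have d: "f differentiable at x" "g differentiable at x" if "x \<in> S" for x
    using Suc.prems that by auto
  have e: "frechet_derivative (\<lambda>x. f x + g x) (at x) =
      (\<lambda>v. frechet_derivative f (at x) v + frechet_derivative g (at x) v)" if "x \<in> S" for x
    using d[OF that] by (intro frechet_at_eq has_derivative_add) (auto simp: frechet_derivative_works)
  have "ck_on k S (\<lambda>x. frechet_derivative (\<lambda>x. f x + g x) (at x) v)" for v
    by (rule ck_on_cong[OF assms(1) _ Suc.hyps[of "\<lambda>x. frechet_derivative f (at x) v"
      "\<lambda>x. frechet_derivative g (at x) v"]]) (use e Suc.prems in auto)
  then show ?case using d by auto
qed

text \<open>Stated for an arbitrary bounded bilinear map because real products, scalar multiples and
  inner products all occur below.\<close>

lemma ck_on_bilinear: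
  assumes b: "bounded_bilinear mul" and S: "open S" and "ck_on k S f" "ck_on k S g"
  shows "ck_on k S (\<lambda>x. mul (f x) (g x))"
  using assms(3,4)
proof (induct k arbitrary: f g)
  case 0
  then show ?case using bounded_bilinear.continuous_on[OF b] by auto
next
  case (Suc k)
  have d: "(f has_derivative frechet_derivative f (at x)) (at x)"
    "(g has_derivative frechet_derivative g (at x)) (at x)" if "x \<in> S" for x
    using Suc.prems that by (auto simp: frechet_derivative_works)
  note D = bounded_bilinear.FDERIV[OF b d]
  have "ck_on k S (\<lambda>x. mul (f x) (frechet_derivative g (at x) v) +
      mul (frechet_derivative f (at x) v) (g x))" for v
    using Suc.prems ck_on_SucD[OF Suc.prems(1)] ck_on_SucD[OF Suc.prems(2)]
    by (intro ck_on_add[OF S] Suc.hyps) auto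
  then have "ck_on k S (\<lambda>x. frechet_derivative (\<lambda>x. mul (f x) (g x)) (at x) v)" for v
    by (rule ck_on_cong[OF S, rotated]) (simp add: frechet_at_eq[OF D])
  then show ?case using D by (auto simp: differentiable_def)
qed

lemma ck_on_sum:
  assumes "open S" "\<And>i. i \<in> I \<Longrightarrow> ck_on k S (f i)"
  shows "ck_on k S (\<lambda>x. \<Sum>i\<in>I. f i x)"
  using assms(2) by (induct I rule: infinite_finite_induct) (auto intro: ck_on_add[OF assms(1)])

lemma ck_on_inverse:
  fixes f :: "'a::real_normed_vector \<Rightarrow> real"
  assumes "open S" "ck_on k S f" "\<And>x. x \<in> S \<Longrightarrow> f x \<noteq> 0"
  shows "ck_on k S (\<lambda>x. inverse (f x))"
  using assms(2)
proof (induct k)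
  case 0
  then show ?case using assms by (auto intro!: continuous_intros)
next
  case (Suc k)
  have d: "(f has_derivative frechet_derivative f (at x)) (at x)" if "x \<in> S" for x
    using Suc.prems that by (auto simp: frechet_derivative_works)
  have D: "((\<lambda>x. inverse (f x)) has_derivative
    (\<lambda>v. - (inverse (f x) * frechet_derivative f (at x) v * inverse (f x)))) (at x)" if "x \<in> S" for x
    by (rule Deriv.has_derivative_inverse[OF assms(3)[OF that] d[OF that]])
  have i: "ck_on k S (\<lambda>x. inverse (f x))" using Suc ck_on_SucD by blast
  have "ck_on k S (\<lambda>x. (- 1) * (inverse (f x) * frechet_derivative f (at x) v * inverse (f x)))" for v
    using Suc.prems
    by (intro ck_on_bilinear[OF bounded_bilinear_mult assms(1)] i ck_on_const) auto
  note I = this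
  have "ck_on k S (\<lambda>x. frechet_derivative (\<lambda>x. inverse (f x)) (at x) v)" for v
    by (rule ck_on_cong[OF assms(1) _ I[of v]]) (simp add: frechet_at_eq[OF D])
  then show ?case using D by (auto simp: differentiable_def)
qed

lemma ck_on_compose:
  fixes g :: "'a::real_normed_vector \<Rightarrow> 'b::finite_dim_inner"
  assumes S: "open S" and "ck_on k T f" "ck_on k S g" "g ` S \<subseteq> T"
  shows "ck_on k S (f \<circ> g)"
  using assms(2,3)
proof (induct k arbitrary: f)
  case 0
  then show ?case using assms(4) continuous_on_compose[of S g f] continuous_on_subset[of T f] by auto
next
  case (Suc k)
  have dg: "(g has_derivative frechet_derivative g (at x)) (at x)" if "x \<in> S" for x
    using Suc.prems that by (auto simp: frechet_derivative_works)
  have df: "(f has_derivative frechet_derivative f (at (g x))) (at (g x))" if "x \<in> S" for x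
    using Suc.prems that assms(4) by (auto simp: frechet_derivative_works)
  note D = diff_chain_at[OF dg df]
  have gk: "ck_on k S g" using Suc.prems ck_on_SucD by blast
  \<comment> \<open>\<open>ck_on\<close> controls derivatives only in fixed directions, whereas the
    chain rule differentiates f in the moving direction Dg(x)v. Expanding this direction in
    \<open>onb\<close> leaves fixed directions b with scalar coefficients of class k.\<close>
  have "ck_on k S (\<lambda>x. \<Sum>b\<in>onb. (frechet_derivative g (at x) v \<bullet> b) *\<^sub>R
      ((\<lambda>y. frechet_derivative f (at y) b) \<circ> g) x)" for v
    using Suc.prems Suc.hyps[OF _ gk]
    by (intro ck_on_sum[OF S] ck_on_bilinear[OF bounded_bilinear_scaleR S]
          ck_on_bilinear[OF bounded_bilinear_inner S] ck_on_const) (auto simp del: o_apply)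
  then have "ck_on k S (\<lambda>x. frechet_derivative (f \<circ> g) (at x) v)" for v
  proof (rule ck_on_cong[OF S, rotated])
    fix x assume x: "x \<in> S"
    have "linear (frechet_derivative f (at (g x)))"
      using df[OF x] bounded_linear.linear has_derivative_bounded_linear by blast
    then show "(\<Sum>b\<in>onb. (frechet_derivative g (at x) v \<bullet> b) *\<^sub>R
      ((\<lambda>y. frechet_derivative f (at y) b) \<circ> g) x) = frechet_derivative (f \<circ> g) (at x) v"
      using linear_onb_expansion[of "frechet_derivative f (at (g x))" "frechet_derivative g (at x) v"]
      by (simp add: frechet_at_eq[OF D[OF x x]])
  qed
  then show ?case using D unfolding ck_on.simps differentiable_def by blast
qed


lemma cinf_on_cong: "open S \<Longrightarrow> (\<And>x. x \<in> S \<Longrightarrow> f x = g x) \<Longrightarrow> cinf_on S f \<Longrightarrow> cinf_on S g"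
  unfolding cinf_on_def using ck_on_cong by blast

lemma cinf_on_subset: "cinf_on S f \<Longrightarrow> T \<subseteq> S \<Longrightarrow> cinf_on T f"
  unfolding cinf_on_def using ck_on_subset by blast

lemma cinf_on_local: "(\<And>x. x \<in> S \<Longrightarrow> \<exists>T. open T \<and> x \<in> T \<and> cinf_on T f) \<Longrightarrow> cinf_on S f"
  unfolding cinf_on_def by (metis ck_on_local)

lemma cinf_on_const [simp]: "cinf_on S (\<lambda>x. c)"
  unfolding cinf_on_def by simp

lemma cinf_on_bounded_linear: "bounded_linear f \<Longrightarrow> cinf_on S f"
  unfolding cinf_on_def using ck_on_bounded_linear by blast

lemma cinf_on_add: "open S \<Longrightarrow> cinf_on S f \<Longrightarrow> cinf_on S g \<Longrightarrow> cinf_on S (\<lambda>x. f x + g x)"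
  unfolding cinf_on_def using ck_on_add by blast

lemma cinf_on_bilinear:
  "bounded_bilinear mul \<Longrightarrow> open S \<Longrightarrow> cinf_on S f \<Longrightarrow> cinf_on S g \<Longrightarrow> cinf_on S (\<lambda>x. mul (f x) (g x))"
  unfolding cinf_on_def using ck_on_bilinear by blast

lemma cinf_on_inverse:
  fixes f :: "'a::real_normed_vector \<Rightarrow> real"
  shows "open S \<Longrightarrow> cinf_on S f \<Longrightarrow> (\<And>x. x \<in> S \<Longrightarrow> f x \<noteq> 0) \<Longrightarrow> cinf_on S (\<lambda>x. inverse (f x))"
  unfolding cinf_on_def using ck_on_inverse by blast

lemma cinf_on_compose:
  fixes g :: "'a::real_normed_vector \<Rightarrow> 'b::finite_dim_inner"
  shows "open S \<Longrightarrow> cinf_on T f \<Longrightarrow> cinf_on S g \<Longrightarrow> g ` S \<subseteq> T \<Longrightarrow> cinf_on S (f \<circ> g)"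
  unfolding cinf_on_def using ck_on_compose by blast

lemma cinf_on_differentiable: "cinf_on S f \<Longrightarrow> x \<in> S \<Longrightarrow> f differentiable at x"
  unfolding cinf_on_def by (metis ck_on.simps(2))

lemma cinf_on_frechet: "cinf_on S f \<Longrightarrow> cinf_on S (\<lambda>x. frechet_derivative f (at x) v)"
  unfolding cinf_on_def by (metis ck_on.simps(2))

lemma cinf_on_continuous: "cinf_on S f \<Longrightarrow> continuous_on S f"
  unfolding cinf_on_def by (metis ck_on.simps(1))


section \<open>Smooth bump functions\<close>

definition exp_tail :: "nat \<Rightarrow> real \<Rightarrow> real" where
  "exp_tail n t = (if t > 0 then inverse t ^ n * exp (- inverse t) else 0)"

lemma exp_tail_tendsto_0: "(exp_tail n \<longlongrightarrow> 0) (at 0)"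
proof -
  have "((\<lambda>x::real. x ^ n / exp x) \<longlongrightarrow> 0) at_top" by (rule tendsto_power_div_exp_0)
  then have "((\<lambda>t::real. inverse t ^ n / exp (inverse t)) \<longlongrightarrow> 0) (at_right 0)"
    using filterlim_inverse_at_top_right by (rule filterlim_compose)
  then have "(exp_tail n \<longlongrightarrow> 0) (at_right 0)"
    by (rule Lim_transform_eventually)
       (auto simp: eventually_at_filter exp_tail_def exp_minus field_simps)
  moreover have "(exp_tail n \<longlongrightarrow> 0) (at_left 0)"
    by (rule Lim_transform_eventually[OF tendsto_const])
       (auto simp: eventually_at_filter exp_tail_def)
  ultimately show ?thesis by (simp add: filterlim_at_split)
qed

text \<open>Up to linear combinations the functions t^(-n) exp(-1/t), extended by 0, are closed
  under differentiation; therefore one induction over k, with n arbitrary, gives smoothness of all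
  of them.\<close>

lemma exp_tail_deriv:
  "(exp_tail n has_real_derivative exp_tail (n + 2) t - real n * exp_tail (n + 1) t) (at t)"
proof -
  consider "t > 0" | "t < 0" | "t = 0" by linarith
  then show ?thesis
  proof cases
    case 1
    have "((\<lambda>t. inverse t ^ n * exp (- inverse t)) has_real_derivative
       exp_tail (n + 2) t - real n * exp_tail (n + 1) t) (at t)"
    proof (cases n)
      case 0
      then show ?thesis using 1
        by (auto intro!: derivative_eq_intros simp: exp_tail_def power2_eq_square)
    next
      case (Suc m)
      then show ?thesis using 1
        by (auto intro!: derivative_eq_intros simp: exp_tail_def power2_eq_square algebra_simps)
          (cases m; simp)
    qed
    then show ?thesis
      by (rule has_field_derivative_transform_within_open[where S="{0<..}"]) (use 1 in \<open>auto simp: exp_tail_def\<close>)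
  next
    case 2
    have "((\<lambda>t. 0) has_real_derivative exp_tail (n + 2) t - real n * exp_tail (n + 1) t) (at t)"
      using 2 by (simp add: exp_tail_def)
    then show ?thesis
      by (rule has_field_derivative_transform_within_open[where S="{..<0}"]) (use 2 in \<open>auto simp: exp_tail_def\<close>)
  next
    case 3
    \<comment> \<open>At 0 the difference quotient is \<open>exp_tail (n + 1)\<close>, so its limit
      is the one from \<open>exp_tail_tendsto_0\<close>.\<close>
    have "((\<lambda>y. (exp_tail n y - exp_tail n 0) / (y - 0)) \<longlongrightarrow> 0) (at 0)"
      by (rule Lim_transform_eventually[OF exp_tail_tendsto_0[of "n + 1"]])
         (auto simp: eventually_at_filter exp_tail_def field_simps)
    then show ?thesis using 3 by (simp add: has_field_derivative_iff exp_tail_def)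
  qed
qed

lemma ck_on_exp_tail: "ck_on k UNIV (exp_tail n)"
proof (induct k arbitrary: n)
  case 0
  then show ?case
    by (auto intro!: continuous_at_imp_continuous_on DERIV_isCont[OF exp_tail_deriv])
next
  case (Suc k)
  have D: "(exp_tail n has_derivative (\<lambda>v. (exp_tail (n + 2) t - real n * exp_tail (n + 1) t) * v)) (at t)" for t
    using exp_tail_deriv[of n t] by (simp add: has_field_derivative_def)
  have "ck_on k UNIV (\<lambda>t. (exp_tail (n + 2) t + (- real n) * exp_tail (n + 1) t) * v)" for v
    by (intro ck_on_bilinear[OF bounded_bilinear_mult] ck_on_add Suc ck_on_const open_UNIV)
  note I = this
  have "ck_on k UNIV (\<lambda>t. frechet_derivative (exp_tail n) (at t) v)" for v
    by (rule ck_on_cong[OF open_UNIV _ I[of v]]) (simp add: frechet_at_eq[OF D])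
  then show ?case using D by (auto simp: differentiable_def)
qed

text \<open>p is positive exactly inside radius R, s exactly outside radius r. As r < R, the sum
  \<open>p + s\<close> never vanishes, and \<open>p / (p + s)\<close> is 1 where s vanishes and 0
  where p vanishes.\<close>

lemma ex_smooth_bump:
  fixes x0 :: "'a::finite_dim_inner"
  assumes "0 < r" "r < R"
  shows "\<exists>\<rho>::'a \<Rightarrow> real. cinf_on UNIV \<rho> \<and> (\<forall>x\<in>ball x0 r. \<rho> x = 1) \<and> (\<forall>x. x \<notin> cball x0 R \<longrightarrow> \<rho> x = 0)"
proof -
  define d where "d x = (x - x0) \<bullet> (x - x0)" for x :: 'a
  have dn: "d x = (dist x0 x)\<^sup>2" for x by (simp add: d_def dot_square_norm dist_norm norm_minus_commute)
  have dc: "cinf_on UNIV d"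
  proof -
    have "cinf_on UNIV (\<lambda>x. x + (- x0))"
      by (intro cinf_on_add open_UNIV cinf_on_const cinf_on_bounded_linear bounded_linear_ident)
    then show ?thesis
      unfolding d_def by (intro cinf_on_bilinear[OF bounded_bilinear_inner]) auto
  qed
  define p where "p = exp_tail 0 \<circ> (\<lambda>x. R\<^sup>2 + (-1) * d x)"
  define s where "s = exp_tail 0 \<circ> (\<lambda>x. d x + (- r\<^sup>2))"
  have pc: "cinf_on UNIV p" and sc: "cinf_on UNIV s"
    unfolding p_def s_def
    by (intro cinf_on_compose[where T=UNIV] cinf_on_add dc cinf_on_const
        cinf_on_bilinear[OF bounded_bilinear_mult]; simp add: cinf_on_def ck_on_exp_tail)+
  have r2: "r\<^sup>2 < R\<^sup>2" using assms by (intro power_strict_mono) auto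
  have pos: "p x + s x \<noteq> 0" for x
  proof -
    have "R\<^sup>2 - d x > 0 \<or> d x - r\<^sup>2 > 0" using r2 by linarith
    then have "p x + s x > 0" unfolding p_def s_def exp_tail_def
      by (auto intro: add_pos_nonneg add_nonneg_pos)
    then show ?thesis by simp
  qed
  define \<rho> where "\<rho> x = p x * inverse (p x + s x)" for x
  have "cinf_on UNIV \<rho>" unfolding \<rho>_def
    by (intro cinf_on_bilinear[OF bounded_bilinear_mult] cinf_on_inverse cinf_on_add pc sc open_UNIV pos)
  moreover have "\<rho> x = 1" if "x \<in> ball x0 r" for x
  proof -
    have "d x \<le> r\<^sup>2" unfolding dn using that by (intro power_mono) auto
    then have "s x = 0" unfolding s_def exp_tail_def by simp
    then show ?thesis using pos[of x] by (simp add: \<rho>_def)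
  qed
  moreover have "\<rho> x = 0" if "x \<notin> cball x0 R" for x
  proof -
    have "d x \<ge> R\<^sup>2" unfolding dn using that assms by (intro power_mono) auto
    then have "p x = 0" unfolding p_def exp_tail_def by simp
    then show ?thesis by (simp add: \<rho>_def)
  qed
  ultimately show ?thesis by blast
qed

section \<open>Symmetry of second derivatives and a local right inverse\<close>

lemma frechet_symmetric:
  fixes f :: "'a::real_normed_vector \<Rightarrow> real"
  assumes S: "open S" and f: "ck_on 2 S f" and x: "x \<in> S"
  shows "frechet_derivative (\<lambda>y. frechet_derivative f (at y) v) (at x) w =
         frechet_derivative (\<lambda>y. frechet_derivative f (at y) w) (at x) v"
proof -
  define D where "D v w y = frechet_derivative (\<lambda>y. frechet_derivative f (at y) v) (at y) w" for v w y
  have fd: "(f has_derivative frechet_derivative f (at y)) (at y)" if "y \<in> S" for y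
    using f that by (auto simp: numeral_2_eq_2 frechet_derivative_works)
  have fd2: "((\<lambda>y. frechet_derivative f (at y) v) has_derivative (\<lambda>w. D v w y)) (at y)" if "y \<in> S" for y v
    using f that unfolding D_def by (auto simp: numeral_2_eq_2 frechet_derivative_works)
  have Dc: "continuous_on S (D v w)" for v w
    using f unfolding D_def[abs_def] by (auto simp: numeral_2_eq_2)
  obtain d where d: "d > 0" "ball x d \<subseteq> S" using S x openE by blast
  \<comment> \<open>The second difference of \<open>f\<close> over a parallelogram is \<open>s\<^sup>2\<close> times a second derivative at an inner point,
      for either order of differentiation.\<close>
  have key: "\<exists>y. dist y x \<le> s * (norm v + norm w) \<and>
     f (x + s *\<^sub>R v + s *\<^sub>R w) - f (x + s *\<^sub>R v) - f (x + s *\<^sub>R w) + f x = s\<^sup>2 * D v w y"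
    if s: "s > 0" "s * (norm v + norm w) < d" for s v w
  proof -
    have inS: "x + a *\<^sub>R v + b *\<^sub>R w \<in> S \<and> dist (x + a *\<^sub>R v + b *\<^sub>R w) x \<le> s * (norm v + norm w)"
      if "0 \<le> a" "a \<le> s" "0 \<le> b" "b \<le> s" for a b
    proof -
      have "norm (a *\<^sub>R v + b *\<^sub>R w) \<le> a * norm v + b * norm w"
        using norm_triangle_ineq[of "a *\<^sub>R v" "b *\<^sub>R w"] that by simp
      also have "\<dots> \<le> s * norm v + s * norm w"
        using that by (intro add_mono mult_right_mono) auto
      finally have *: "dist (x + a *\<^sub>R v + b *\<^sub>R w) x \<le> s * (norm v + norm w)"
        by (simp add: dist_norm algebra_simps)
      then have "x + a *\<^sub>R v + b *\<^sub>R w \<in> ball x d" using s by (simp add: dist_commute)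
      then show ?thesis using d * by auto
    qed
    define g where "g a = f (x + a *\<^sub>R v + s *\<^sub>R w) - f (x + a *\<^sub>R v)" for a
    define g' where "g' a = frechet_derivative f (at (x + a *\<^sub>R v + s *\<^sub>R w)) v
        - frechet_derivative f (at (x + a *\<^sub>R v)) v" for a
    have comp: "((\<lambda>a. h (x + a *\<^sub>R v + b *\<^sub>R w)) has_real_derivative h' v) (at a)"
      if "(h has_derivative h') (at (x + a *\<^sub>R v + b *\<^sub>R w))" for h h' a b v w
    proof -
      interpret h': bounded_linear h' using that by (rule has_derivative_bounded_linear)
      have "((\<lambda>a. x + a *\<^sub>R v + b *\<^sub>R w) has_derivative (\<lambda>t. t *\<^sub>R v)) (at a)"
        by (auto intro!: derivative_eq_intros)
      from has_derivative_compose[OF this that]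
      show ?thesis unfolding has_field_derivative_def
        by (rule has_derivative_eq_rhs) (auto simp: h'.scaleR)
    qed
    have g: "DERIV g a :> g' a" if "0 \<le> a" "a \<le> s" for a
    proof -
      have "((\<lambda>a. f (x + a *\<^sub>R v + s *\<^sub>R w)) has_real_derivative
        frechet_derivative f (at (x + a *\<^sub>R v + s *\<^sub>R w)) v) (at a)"
        using comp[OF fd] inS[of a s] that s by auto
      moreover have "((\<lambda>a. f (x + a *\<^sub>R v)) has_real_derivative
        frechet_derivative f (at (x + a *\<^sub>R v)) v) (at a)"
        using comp[of f _ a v 0 w, OF fd] inS[of a 0] that s by auto
      ultimately show ?thesis unfolding g_def[abs_def] g'_def by (rule DERIV_diff)
    qed
    obtain a where a: "0 < a" "a < s" "g s - g 0 = (s - 0) * g' a"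
      using MVT2[of 0 s g g'] s g by auto
    have k: "DERIV (\<lambda>b. frechet_derivative f (at (x + b *\<^sub>R w + a *\<^sub>R v)) v) b :> D v w (x + b *\<^sub>R w + a *\<^sub>R v)"
      if "0 \<le> b" "b \<le> s" for b
    proof -
      have e: "x + b *\<^sub>R w + a *\<^sub>R v = x + a *\<^sub>R v + b *\<^sub>R w" by (simp add: algebra_simps)
      have "x + b *\<^sub>R w + a *\<^sub>R v \<in> S" unfolding e using inS[of a b] a that by simp
      from comp[OF fd2[OF this]] show ?thesis .
    qed
    obtain b where b: "0 < b" "b < s" "frechet_derivative f (at (x + s *\<^sub>R w + a *\<^sub>R v)) v -
        frechet_derivative f (at (x + 0 *\<^sub>R w + a *\<^sub>R v)) v = (s - 0) * D v w (x + b *\<^sub>R w + a *\<^sub>R v)"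
      using MVT2[OF s(1) k] by auto
    have "g' a = s * D v w (x + b *\<^sub>R w + a *\<^sub>R v)"
      using b(3) unfolding g'_def by (simp add: add.assoc add.left_commute add.commute)
    then have "g s - g 0 = s\<^sup>2 * D v w (x + a *\<^sub>R v + b *\<^sub>R w)"
      using a by (simp add: power2_eq_square algebra_simps)
    then show ?thesis using inS[of a b] a b unfolding g_def by (intro exI[of _ "x + a *\<^sub>R v + b *\<^sub>R w"]) auto
  qed
  show ?thesis
  proof (rule ccontr)
    assume "\<not> ?thesis"
    then have ne: "D v w x \<noteq> D w v x" by (simp add: D_def)
    \<comment> \<open>With half the gap as tolerance, both mixed derivatives stay on their own side
      of the midpoint near x, while the common second difference forces a nearby value of one to
      equal a nearby value of the other.\<close>
    define e where "e = \<bar>D v w x - D w v x\<bar> / 2"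
    have e: "e > 0" using ne by (simp add: e_def)
    have cont: "\<exists>r>0. \<forall>y. dist y x < r \<longrightarrow> \<bar>D v w y - D v w x\<bar> < e" for v w
    proof -
      have "continuous (at x) (D v w)" using Dc S x continuous_on_eq_continuous_at by blast
      then show ?thesis using e unfolding continuous_at_eps_delta by (auto simp: dist_norm)
    qed
    obtain r1 where r1: "r1 > 0" "\<And>y. dist y x < r1 \<Longrightarrow> \<bar>D v w y - D v w x\<bar> < e" using cont by blast
    obtain r2 where r2: "r2 > 0" "\<And>y. dist y x < r2 \<Longrightarrow> \<bar>D w v y - D w v x\<bar> < e" using cont by blast
    define m where "m = min d (min r1 r2)"
    \<comment> \<open>Makes the parallelogram smaller than m; the summand 1 keeps the denominator
      positive when v and w vanish.\<close>
    define s where "s = m / (2 * (norm v + norm w + 1))"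
    have m: "m > 0" using d r1 r2 by (simp add: m_def)
    have n0: "norm v + norm w + 1 > 0" by (simp add: add_nonneg_pos)
    have s0: "s > 0" unfolding s_def using m n0 by simp
    have "s * (norm v + norm w) \<le> s * (norm v + norm w + 1)" using s0 by simp
    also have "\<dots> = m / 2" unfolding s_def using n0 by (simp add: field_simps)
    also have "\<dots> < m" using m by simp
    finally have sm: "s * (norm v + norm w) < m" .
    then have sm2: "s * (norm w + norm v) < m" by (simp add: add.commute)
    obtain y where y: "dist y x \<le> s * (norm v + norm w)"
      "f (x + s *\<^sub>R v + s *\<^sub>R w) - f (x + s *\<^sub>R v) - f (x + s *\<^sub>R w) + f x = s\<^sup>2 * D v w y"
      using key[of s v w] s0 sm unfolding m_def by auto
    obtain z where z: "dist z x \<le> s * (norm w + norm v)"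
      "f (x + s *\<^sub>R w + s *\<^sub>R v) - f (x + s *\<^sub>R w) - f (x + s *\<^sub>R v) + f x = s\<^sup>2 * D w v z"
      using key[of s w v] s0 sm2 unfolding m_def by auto
    have e: "x + s *\<^sub>R w + s *\<^sub>R v = x + s *\<^sub>R v + s *\<^sub>R w" by (simp add: algebra_simps)
    have "s\<^sup>2 * D v w y = s\<^sup>2 * D w v z" using y(2) z(2) unfolding e by linarith
    then have "D v w y = D w v z" using s0 by simp
    moreover have "\<bar>D v w y - D v w x\<bar> < e" using r1(2) y(1) sm unfolding m_def by auto
    moreover have "\<bar>D w v z - D w v x\<bar> < e" using r2(2) z(1) sm2 unfolding m_def by auto
    ultimately show False unfolding e_def by (simp add: abs_if split: if_splits)
  qed
qed

text \<open>The existence half of the inverse function theorem: a root of \<open>g x = y\<close> is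
  a fixed point of the map taking x to \<open>y + (x - g x)\<close>, which contracts near x0. The
  right inverse is shown differentiable only at \<open>g x0\<close>, and this is what
  \<open>descend_differentiable\<close> consumes.\<close>

lemma local_right_inverse:
  fixes g :: "'a::finite_dim_inner \<Rightarrow> 'a"
  assumes S: "open S" "x0 \<in> S" and g: "ck_on 1 S g"
    and id: "\<And>v. frechet_derivative g (at x0) v = v"
  obtains s T where "open T" "g x0 \<in> T" "s (g x0) = x0" "\<And>y. y \<in> T \<Longrightarrow> s y \<in> S \<and> g (s y) = y"
    "s differentiable at (g x0)"
proof -
  have gd: "(g has_derivative frechet_derivative g (at x)) (at x)" if "x \<in> S" for x
    using g that by (auto simp: frechet_derivative_works)
  \<comment> \<open>A continuous upper bound for the operator norm of Id - Dg: by
    \<open>linear_on_onb_bounded\<close> the values on the basis suffice. It vanishes at x0, hence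
    is at most 1/2 on a small ball.\<close>
  define h where "h x = (\<Sum>b\<in>(onb::'a set). norm (frechet_derivative g (at x) b - b))" for x
  have hc: "continuous_on S h" unfolding h_def
    using g by (intro continuous_intros) auto
  have "h x0 = 0" by (simp add: h_def id)
  moreover have "continuous (at x0) h" using hc S continuous_on_eq_continuous_at by blast
  ultimately have "\<forall>e>0. \<exists>d>0. \<forall>x. dist x x0 < d \<longrightarrow> \<bar>h x\<bar> < e"
    unfolding continuous_at_eps_delta by (simp add: dist_norm)
  from this[rule_format, of "1/2"]
  obtain r1 where r1: "r1 > 0" "\<And>x. dist x x0 < r1 \<Longrightarrow> \<bar>h x\<bar> < 1/2" by auto
  obtain r2 where r2: "r2 > 0" "cball x0 r2 \<subseteq> S" using S open_contains_cball by blast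
  define r where "r = min (r1 / 2) r2"
  have r: "r > 0" "cball x0 r \<subseteq> S" "\<And>x. x \<in> cball x0 r \<Longrightarrow> h x \<le> 1/2"
  proof -
    show "r > 0" using r1 r2 by (simp add: r_def)
    show "cball x0 r \<subseteq> S" using r2 by (auto simp: r_def)
    fix x assume "x \<in> cball x0 r"
    then have "dist x x0 < r1" using r1 by (simp add: r_def dist_commute)
    then show "h x \<le> 1/2" using r1(2)[of x] by simp
  qed
  define k where "k x = x - g x" for x
  define k' where "k' x v = v - frechet_derivative g (at x) v" for x v
  have kd: "(k has_derivative k' x) (at x within cball x0 r)" if "x \<in> cball x0 r" for x
    unfolding k_def[abs_def] k'_def[abs_def] 
    by (rule has_derivative_diff[OF has_derivative_ident has_derivative_at_withinI[OF gd]])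
       (use r(2) that in auto)
  have kn: "onorm (k' x) \<le> 1/2" if x: "x \<in> cball x0 r" for x
  proof -
    have B: "norm (k' x v) \<le> 1/2 * norm v" for v
    proof -
    have "linear (k' x)" using kd[OF x] bounded_linear.linear has_derivative_bounded_linear by blast
    then have "norm (k' x v) \<le> (\<Sum>b\<in>onb. norm (k' x b)) * norm v"
      by (rule linear_on_onb_bounded)
    also have "(\<Sum>b\<in>onb. norm (k' x b)) = h x" unfolding h_def k'_def by (simp add: norm_minus_commute)
    also have "h x * norm v \<le> 1/2 * norm v" using r(3)[OF x] by (intro mult_right_mono) auto
    finally show ?thesis .
    qed
    show ?thesis by (rule onorm_bound[OF _ B]) simp
  qed
  have kL: "norm (k x - k y) \<le> 1/2 * norm (x - y)" if "x \<in> cball x0 r" "y \<in> cball x0 r" for x y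
    by (rule differentiable_bound[OF convex_cball kd kn that])
  \<comment> \<open>Half of the radius is spent on the displacement of y, the other half on the
    image of the ball under the 1/2-Lipschitz map k.\<close>
  define T where "T = ball (g x0) (r/2)"
  have ex: "\<exists>x\<in>cball x0 r. g x = y" if "y \<in> T" for y
  proof -
    have "\<exists>!x\<in>cball x0 r. y + k x = x"
    proof (rule Banach_fix[where c="1/2"])
      show "complete (cball x0 r)" by (simp add: complete_eq_closed)
      show "cball x0 r \<noteq> {}" using r by simp
      show "(\<lambda>x. y + k x) ` cball x0 r \<subseteq> cball x0 r"
      proof clarify
        fix x assume x: "x \<in> cball x0 r"
        have "y + k x - x0 = (y - g x0) + (k x - k x0)" by (simp add: k_def)
        then have "norm (y + k x - x0) \<le> norm (y - g x0) + norm (k x - k x0)"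
          using norm_triangle_ineq by metis
        also have "\<dots> \<le> r/2 + 1/2 * norm (x - x0)"
          using kL[OF x, of x0] r that by (intro add_mono) (auto simp: T_def dist_norm norm_minus_commute)
        also have "\<dots> \<le> r" using x by (simp add: dist_norm norm_minus_commute)
        finally show "y + k x \<in> cball x0 r" by (simp add: dist_norm norm_minus_commute)
      qed
      fix x z assume "x \<in> cball x0 r" "z \<in> cball x0 r"
      then show "dist (y + k x) (y + k z) \<le> 1/2 * dist x z" using kL[of x z] by (simp add: dist_norm)
    qed auto
    then obtain x where x: "x \<in> cball x0 r" "y + k x = x" by blast
    have "g x = y + k x - k x" unfolding x(2) by (simp add: k_def)
    then show ?thesis using x(1) by auto
  qed
  define s where "s y = (SOME x. x \<in> cball x0 r \<and> g x = y)" for y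
  have s: "s y \<in> cball x0 r" "g (s y) = y" if "y \<in> T" for y
    using someI_ex[of "\<lambda>x. x \<in> cball x0 r \<and> g x = y"] ex[OF that] unfolding s_def by blast+
  \<comment> \<open>Since k has Lipschitz constant 1/2, g shrinks distances at most by the factor
    1/2. This pins down \<open>s (g x0)\<close> and makes s continuous there.\<close>
  have lip: "norm (x - z) \<le> 2 * norm (g x - g z)" if "x \<in> cball x0 r" "z \<in> cball x0 r" for x z
  proof -
    have "x - z = (k x - k z) + (g x - g z)" by (simp add: k_def)
    then have "norm (x - z) \<le> norm (k x - k z) + norm (g x - g z)" using norm_triangle_ineq by metis
    then show ?thesis using kL[OF that] by linarith
  qed
  have T: "open T" "g x0 \<in> T" using r by (auto simp: T_def)
  have x0: "x0 \<in> cball x0 r" using r by simp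
  have s0: "s (g x0) = x0" using lip[OF s(1)[OF T(2)] x0] s(2)[OF T(2)] by simp
  have sc: "continuous (at (g x0)) s"
    unfolding continuous_at_eps_delta
  proof (intro allI impI)
    fix e :: real assume e: "e > 0"
    show "\<exists>d>0. \<forall>x'. dist x' (g x0) < d \<longrightarrow> dist (s x') (s (g x0)) < e"
    proof (intro exI[of _ "min (r/2) (e/2)"] conjI allI impI)
      show "0 < min (r/2) (e/2)" using e r by simp
      fix y assume y: "dist y (g x0) < min (r/2) (e/2)"
      then have yT: "y \<in> T" by (simp add: T_def dist_commute)
      show "dist (s y) (s (g x0)) < e"
        using lip[OF s(1)[OF yT] x0] s(2)[OF yT] s0 y by (simp add: dist_norm)
    qed
  qed
  have "frechet_derivative g (at x0) = (\<lambda>v. v)" using id by auto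
  then have g0: "(g has_derivative (\<lambda>v. v)) (at x0)" using gd[OF S(2)] by simp
  have "(s has_derivative (\<lambda>v. v)) (at (g x0))"
    by (rule has_derivative_inverse_basic[OF _ bounded_linear_ident _ sc T])
       (use g0 s0 s(2) in \<open>auto simp: o_def id_def\<close>)
  then have "s differentiable at (g x0)" by (auto simp: differentiable_def)
  then show ?thesis using that[of T s, OF T s0] s r(2) by blast
qed


section \<open>Functions, vector fields and forms on a manifold\<close>

locale manifold =
  fixes M :: "('m::{t2_space,second_countable_topology}, 'e::finite_dim_inner) atlas"
  assumes smooth_manifold: "smooth_manifold M"
begin

abbreviation T where "T \<equiv> tangent_space M"
abbreviation sn where "sn \<equiv> smooth_near M"
abbreviation vfield where "vfield \<equiv> vector_field M"

section \<open>Charts and functions smooth near a point\<close>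

lemma ex_chart: obtains U \<phi> where "(U, \<phi>) \<in> M" "p \<in> U"
proof -
  have "(\<Union>(U, \<phi>)\<in>M. U) = UNIV" using smooth_manifold by (simp add: smooth_manifold_def)
  then have "p \<in> (\<Union>(U, \<phi>)\<in>M. U)" by simp
  then show ?thesis using that by auto
qed

lemma chart:
  assumes "(U, \<phi>) \<in> M"
  shows "open U" "open (\<phi> ` U)" "continuous_on U \<phi>" "continuous_on (\<phi> ` U) (inv_into U \<phi>)"
    and "inj_on \<phi> U"
proof -
  have h: "open U \<and> open (\<phi> ` U) \<and> homeomorphism U (\<phi> ` U) \<phi> (inv_into U \<phi>)"
    using assms smooth_manifold by (auto simp: smooth_manifold_def)
  then show "open U" "open (\<phi> ` U)" "continuous_on U \<phi>" "continuous_on (\<phi> ` U) (inv_into U \<phi>)"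
    by (auto simp: homeomorphism_def)
  show "inj_on \<phi> U" using h by (intro inj_on_inverseI[of U "inv_into U \<phi>"]) (auto simp: homeomorphism_def)
qed

lemma chart_inv [simp]: "(U, \<phi>) \<in> M \<Longrightarrow> p \<in> U \<Longrightarrow> inv_into U \<phi> (\<phi> p) = p"
  using chart(5) by simp

lemma transition:
  "(U, \<phi>) \<in> M \<Longrightarrow> (V, \<psi>) \<in> M \<Longrightarrow> cinf_on (\<phi> ` (U \<inter> V)) (\<psi> \<circ> inv_into U \<phi>)"
  using smooth_manifold by (fastforce simp: smooth_manifold_def)

lemma open_chart_image:
  assumes c: "(U, \<phi>) \<in> M" and W: "open W"
  shows "open (\<phi> ` (U \<inter> W))"
proof -
  have "\<phi> ` (U \<inter> W) = \<phi> ` U \<inter> inv_into U \<phi> -` W"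
    using c by (auto simp: image_iff)
  then show ?thesis using chart[OF c] W continuous_open_preimage by metis
qed

lemma smooth_fun_on_chart:
  "smooth_fun_on M W f \<Longrightarrow> (U, \<phi>) \<in> M \<Longrightarrow> cinf_on (\<phi> ` (U \<inter> W)) (f \<circ> inv_into U \<phi>)"
  unfolding smooth_fun_on_def by blast

lemma smooth_fun_on_local:
  assumes "\<And>p. p \<in> W \<Longrightarrow> \<exists>A. open A \<and> p \<in> A \<and> smooth_fun_on M A f"
  shows "smooth_fun_on M W f"
  unfolding smooth_fun_on_def
proof clarify
  fix U \<phi> assume c: "(U, \<phi>) \<in> M"
  show "cinf_on (\<phi> ` (U \<inter> W)) (f \<circ> inv_into U \<phi>)"
  proof (rule cinf_on_local)
    fix x assume "x \<in> \<phi> ` (U \<inter> W)"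
    then obtain p where p: "p \<in> U" "p \<in> W" "x = \<phi> p" by blast
    obtain A where A: "open A" "p \<in> A" "smooth_fun_on M A f" using assms[OF p(2)] by blast
    show "\<exists>T. open T \<and> x \<in> T \<and> cinf_on T (f \<circ> inv_into U \<phi>)"
      using open_chart_image[OF c A(1)] smooth_fun_on_chart[OF A(3) c] p A(2) by blast
  qed
qed

lemma smooth_near_iff_on:
  assumes "open W"
  shows "smooth_fun_on M W f \<longleftrightarrow> (\<forall>p\<in>W. sn p f)"
  using assms smooth_fun_on_local[of W f] unfolding smooth_near_def by blast

lemma sn_open: "sn p f \<Longrightarrow> \<forall>\<^sub>F x in nhds p. sn x f"
  unfolding eventually_nhds smooth_near_def by blast

text \<open>One chart suffices: every other chart representation is this one composed with a smooth
  transition map.\<close>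

lemma sn_chartI:
  assumes c: "(U, \<phi>) \<in> M" and A: "open A" "p \<in> A" "A \<subseteq> U" and f: "cinf_on (\<phi> ` A) (f \<circ> inv_into U \<phi>)"
  shows "sn p f"
  unfolding smooth_near_def
proof (intro exI conjI)
  show "smooth_fun_on M A f" unfolding smooth_fun_on_def
  proof clarify
    fix V \<psi> assume c': "(V, \<psi>) \<in> M"
    have o: "open (\<psi> ` (V \<inter> A))" by (rule open_chart_image[OF c' A(1)])
    have "cinf_on (\<psi> ` (V \<inter> A)) ((f \<circ> inv_into U \<phi>) \<circ> (\<phi> \<circ> inv_into V \<psi>))"
    proof (rule cinf_on_compose[OF o f])
      show "cinf_on (\<psi> ` (V \<inter> A)) (\<phi> \<circ> inv_into V \<psi>)"
        by (rule cinf_on_subset[OF transition[OF c' c]]) (use A(3) in blast)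
      show "(\<phi> \<circ> inv_into V \<psi>) ` \<psi> ` (V \<inter> A) \<subseteq> \<phi> ` A" using c' by auto
    qed
    then show "cinf_on (\<psi> ` (V \<inter> A)) (f \<circ> inv_into V \<psi>)"
      by (rule cinf_on_cong[OF o, rotated]) (use c c' A(3) in auto)
  qed
qed (use A in auto)

lemma sn_chartD:
  assumes f: "sn p f" and c: "(U, \<phi>) \<in> M" and p: "p \<in> U"
  obtains A where "open A" "p \<in> A" "A \<subseteq> U" "cinf_on (\<phi> ` A) (f \<circ> inv_into U \<phi>)" "open (\<phi> ` A)"
    "\<And>x. x \<in> A \<Longrightarrow> sn x f"
proof -
  obtain W where W: "open W" "p \<in> W" "smooth_fun_on M W f" using f unfolding smooth_near_def by blast
  show ?thesis
    by (rule that[of "U \<inter> W"])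
       (use W chart[OF c] p smooth_fun_on_chart[OF W(3) c] open_chart_image[OF c W(1)]
          in \<open>auto simp: smooth_near_def\<close>)
qed

lemma sn_cong:
  assumes f: "sn p f" and e: "\<forall>\<^sub>F x in nhds p. f x = g x"
  shows "sn p g"
proof -
  obtain U \<phi> where c: "(U, \<phi>) \<in> M" "p \<in> U" by (rule ex_chart)
  obtain A where A: "open A" "p \<in> A" "A \<subseteq> U" "cinf_on (\<phi> ` A) (f \<circ> inv_into U \<phi>)" "open (\<phi> ` A)"
    by (rule sn_chartD[OF f c])
  obtain S where S: "open S" "p \<in> S" "\<forall>x\<in>S. f x = g x" using e unfolding eventually_nhds by blast
  have sub: "S \<inter> A \<subseteq> U" using A by blast
  then have o: "open (\<phi> ` (S \<inter> A))"
    using open_chart_image[OF c(1), of "S \<inter> A"] S(1) A(1) by (simp add: Int_absorb1 open_Int)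
  have "cinf_on (\<phi> ` (S \<inter> A)) (f \<circ> inv_into U \<phi>)" by (rule cinf_on_subset[OF A(4)]) blast
  then have "cinf_on (\<phi> ` (S \<inter> A)) (g \<circ> inv_into U \<phi>)"
    by (rule cinf_on_cong[OF o, rotated]) (use sub S(3) c in \<open>auto\<close>)
  then show ?thesis by (rule sn_chartI[OF c(1), rotated 3]) (use S A sub in auto)
qed

lemma sn_cong_iff: "\<forall>\<^sub>F x in nhds p. f x = g x \<Longrightarrow> sn p f \<longleftrightarrow> sn p g"
  using sn_cong[of p f g] sn_cong[of p g f] by (auto elim: eventually_mono simp: eq_commute)

lemma sn_const [simp]: "sn p (\<lambda>x. c)"
  unfolding smooth_near_def smooth_fun_on_def o_def by auto

lemma sn_binary:
  assumes op: "\<And>S f g. open S \<Longrightarrow> cinf_on S f \<Longrightarrow> cinf_on S g \<Longrightarrow> cinf_on S (\<lambda>x::'e. op (f x) (g x))"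
    and "sn p f" "sn p g"
  shows "sn p (\<lambda>x. op (f x) (g x))"
proof -
  obtain U \<phi> where c: "(U, \<phi>) \<in> M" "p \<in> U" by (rule ex_chart)
  obtain A where A: "open A" "p \<in> A" "A \<subseteq> U" "cinf_on (\<phi> ` A) (f \<circ> inv_into U \<phi>)"
    by (rule sn_chartD[OF assms(2) c])
  obtain B where B: "open B" "p \<in> B" "B \<subseteq> U" "cinf_on (\<phi> ` B) (g \<circ> inv_into U \<phi>)"
    by (rule sn_chartD[OF assms(3) c])
  have o: "open (\<phi> ` (A \<inter> B))"
    using open_chart_image[OF c(1), of "A \<inter> B"] A B by (simp add: Int_absorb1 open_Int le_infI1)
  have "cinf_on (\<phi> ` (A \<inter> B)) (\<lambda>x. op ((f \<circ> inv_into U \<phi>) x) ((g \<circ> inv_into U \<phi>) x))"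
    by (rule op[OF o cinf_on_subset[OF A(4)] cinf_on_subset[OF B(4)]]) auto
  then show ?thesis
    by (intro sn_chartI[OF c(1), of "A \<inter> B"]) (use A B in \<open>auto simp: o_def\<close>)
qed

lemma sn_add [intro]: "sn p f \<Longrightarrow> sn p g \<Longrightarrow> sn p (\<lambda>x. f x + g x)"
  by (rule sn_binary) (rule cinf_on_add)

lemma sn_mult [intro]: "sn p f \<Longrightarrow> sn p g \<Longrightarrow> sn p (\<lambda>x. f x * g x)"
  by (rule sn_binary) (rule cinf_on_bilinear[OF bounded_bilinear_mult])

lemma sn_minus [intro]: "sn p f \<Longrightarrow> sn p (\<lambda>x. - f x)"
  using sn_mult[of p "\<lambda>x. -1" f] by simp

lemma sn_diff [intro]: "sn p f \<Longrightarrow> sn p g \<Longrightarrow> sn p (\<lambda>x. f x - g x)"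
  using sn_add[of p f "\<lambda>x. - g x"] sn_minus by simp

lemma sn_sum [intro]: "(\<And>i. i \<in> I \<Longrightarrow> sn p (f i)) \<Longrightarrow> sn p (\<lambda>x. \<Sum>i\<in>I. f i x)"
  by (induct I rule: infinite_finite_induct) auto

lemma sn_isCont: "sn p f \<Longrightarrow> isCont f p"
proof -
  assume f: "sn p f"
  obtain U \<phi> where c: "(U, \<phi>) \<in> M" "p \<in> U" by (rule ex_chart)
  obtain A where A: "open A" "p \<in> A" "A \<subseteq> U" "cinf_on (\<phi> ` A) (f \<circ> inv_into U \<phi>)"
    by (rule sn_chartD[OF f c])
  have "continuous_on A ((f \<circ> inv_into U \<phi>) \<circ> \<phi>)"
    by (rule continuous_on_compose[OF continuous_on_subset[OF chart(3)[OF c(1)] A(3)]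
          cinf_on_continuous[OF A(4)]])
  then have "continuous_on A f"
    by (rule continuous_on_eq) (use A(3) c in auto)
  then show "isCont f p" using A continuous_on_eq_continuous_at by blast
qed

lemma sn_inverse:
  assumes f: "sn p f" and "f p \<noteq> 0"
  shows "sn p (\<lambda>x. inverse (f x))"
proof -
  obtain U \<phi> where c: "(U, \<phi>) \<in> M" "p \<in> U" by (rule ex_chart)
  obtain A where A: "open A" "p \<in> A" "A \<subseteq> U" "cinf_on (\<phi> ` A) (f \<circ> inv_into U \<phi>)"
    by (rule sn_chartD[OF f c])
  have "\<forall>\<^sub>F x in nhds p. f x \<noteq> 0"
    using sn_isCont[OF f] assms(2) by (simp add: isCont_def tendsto_imp_eventually_ne
      eventually_nhds_conv_at)
  then obtain B where B: "open B" "p \<in> B" "\<forall>x\<in>B. f x \<noteq> 0" unfolding eventually_nhds by blast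
  have o: "open (\<phi> ` (A \<inter> B))"
    using open_chart_image[OF c(1), of "A \<inter> B"] A B by (simp add: Int_absorb1 open_Int le_infI1)
  have "cinf_on (\<phi> ` (A \<inter> B)) (\<lambda>x. inverse ((f \<circ> inv_into U \<phi>) x))"
    by (rule cinf_on_inverse[OF o cinf_on_subset[OF A(4)]]) (use A(3) B(3) c in auto)
  then show ?thesis
    by (intro sn_chartI[OF c(1), of "A \<inter> B"]) (use A B in \<open>auto simp: o_def\<close>)
qed

section \<open>Tangent vectors\<close>

definition partial_vec :: "'m set \<Rightarrow> ('m \<Rightarrow> 'e) \<Rightarrow> 'm \<Rightarrow> 'e \<Rightarrow> 'm tvec" where
  "partial_vec U \<phi> p e = (\<lambda>f. if sn p f then frechet_derivative (f \<circ> inv_into U \<phi>) (at (\<phi> p)) e else 0)"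

lemma partial_vec_tangent [intro]: "(U, \<phi>) \<in> M \<Longrightarrow> p \<in> U \<Longrightarrow> partial_vec U \<phi> p e \<in> T p"
  unfolding tangent_space_def partial_vec_def by blast

lemma sn_chart_differentiable:
  assumes "sn p f" "(U, \<phi>) \<in> M" "p \<in> U"
  shows "((f \<circ> inv_into U \<phi>) has_derivative frechet_derivative (f \<circ> inv_into U \<phi>) (at (\<phi> p))) (at (\<phi> p))"
proof -
  obtain A where A: "open A" "p \<in> A" "A \<subseteq> U" "cinf_on (\<phi> ` A) (f \<circ> inv_into U \<phi>)"
    by (rule sn_chartD[OF assms])
  then show ?thesis using cinf_on_differentiable frechet_derivative_works by blast
qed

text \<open>The chain rule for the transition map. It lets all tangent vectors at p be written in
  one prescribed chart, although the definition allows each vector its own.\<close>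

lemma partial_vec_change:
  assumes c: "(U, \<phi>) \<in> M" "p \<in> U" and c': "(V, \<psi>) \<in> M" "p \<in> V"
  shows "partial_vec V \<psi> p e = partial_vec U \<phi> p (frechet_derivative (\<phi> \<circ> inv_into V \<psi>) (at (\<psi> p)) e)"
proof
  fix f
  show "partial_vec V \<psi> p e f = partial_vec U \<phi> p (frechet_derivative (\<phi> \<circ> inv_into V \<psi>) (at (\<psi> p)) e) f"
  proof (cases "sn p f")
    case True
    let ?t = "\<phi> \<circ> inv_into V \<psi>"
    have t: "(?t has_derivative frechet_derivative ?t (at (\<psi> p))) (at (\<psi> p))"
      using transition[OF c'(1) c(1)] c c' cinf_on_differentiable frechet_derivative_works by blast
    have tp: "?t (\<psi> p) = \<phi> p" using c' by simp
    have "((f \<circ> inv_into U \<phi>) has_derivative frechet_derivative (f \<circ> inv_into U \<phi>) (at (\<phi> p))) (at (?t (\<psi> p)))"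
      unfolding tp by (rule sn_chart_differentiable[OF True c])
    from diff_chain_at[OF t this]
    have "((f \<circ> inv_into V \<psi>) has_derivative
       frechet_derivative (f \<circ> inv_into U \<phi>) (at (\<phi> p)) \<circ> frechet_derivative ?t (at (\<psi> p))) (at (\<psi> p))"
    proof (rule has_derivative_transform_within_open)
      show "open (\<psi> ` (V \<inter> U))" using open_chart_image[OF c'(1) chart(1)[OF c(1)]] .
    qed (use c c' in auto)
    then show ?thesis using True by (simp add: partial_vec_def frechet_at_eq)
  qed (simp add: partial_vec_def)
qed

lemma tangent_iff:
  assumes "(U, \<phi>) \<in> M" "p \<in> U"
  shows "v \<in> T p \<longleftrightarrow> (\<exists>e. v = partial_vec U \<phi> p e)"
proof
  assume "v \<in> T p"
  then obtain V \<psi> e where "(V, \<psi>) \<in> M" "p \<in> V" "v = partial_vec V \<psi> p e"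
    unfolding tangent_space_def partial_vec_def by blast
  then show "\<exists>e. v = partial_vec U \<phi> p e" using partial_vec_change[OF assms] by blast
qed (use assms in auto)

lemma partial_vec_linear:
  assumes "(U, \<phi>) \<in> M" "p \<in> U"
  shows "partial_vec U \<phi> p (x + y) = partial_vec U \<phi> p x + partial_vec U \<phi> p y"
    and "partial_vec U \<phi> p (c *\<^sub>R x) = c *\<^sub>R partial_vec U \<phi> p x"
proof -
  have l: "sn p f \<Longrightarrow> linear (frechet_derivative (f \<circ> inv_into U \<phi>) (at (\<phi> p)))" for f
    using sn_chart_differentiable[OF _ assms] bounded_linear.linear has_derivative_bounded_linear by blast
  show "partial_vec U \<phi> p (x + y) = partial_vec U \<phi> p x + partial_vec U \<phi> p y"
    "partial_vec U \<phi> p (c *\<^sub>R x) = c *\<^sub>R partial_vec U \<phi> p x"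
    using linear_add[OF l] linear_scale[OF l] by (auto simp: partial_vec_def fun_eq_iff scaleR_fun_def)
qed

lemma tangent_add [intro]: "v \<in> T p \<Longrightarrow> w \<in> T p \<Longrightarrow> v + w \<in> T p"
  by (rule ex_chart[of p]) (metis partial_vec_linear(1) tangent_iff)

lemma tangent_scale [intro]: "v \<in> T p \<Longrightarrow> c *\<^sub>R v \<in> T p"
  by (rule ex_chart[of p]) (metis partial_vec_linear(2) tangent_iff)

lemma tangent_zero [simp]: "0 \<in> T p"
proof -
  obtain U \<phi> where c: "(U, \<phi>) \<in> M" "p \<in> U" by (rule ex_chart)
  then have "partial_vec U \<phi> p 0 \<in> T p" by blast
  then have "0 *\<^sub>R partial_vec U \<phi> p 0 \<in> T p" by blast
  then show ?thesis by simp
qed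

lemma tangent_minus [intro]: "v \<in> T p \<Longrightarrow> - v \<in> T p"
  using tangent_scale[of v p "-1"] by simp

lemma tangent_diff [intro]: "v \<in> T p \<Longrightarrow> w \<in> T p \<Longrightarrow> v - w \<in> T p"
  using tangent_add[of v p "- w"] by auto

lemma tangent_sum [intro]: "(\<And>i. i \<in> I \<Longrightarrow> v i \<in> T p) \<Longrightarrow> (\<Sum>i\<in>I. v i) \<in> T p"
  by (induct I rule: infinite_finite_induct) auto

lemma tv_nonsmooth: "v \<in> T p \<Longrightarrow> \<not> sn p f \<Longrightarrow> v f = 0"
  unfolding tangent_space_def by auto

lemma tv_eqI: "v \<in> T p \<Longrightarrow> w \<in> T p \<Longrightarrow> (\<And>f. sn p f \<Longrightarrow> v f = w f) \<Longrightarrow> v = w"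
  using tv_nonsmooth by (metis ext)

lemma tv_repr:
  assumes v: "v \<in> T p"
  obtains U \<phi> e where "(U, \<phi>) \<in> M" "p \<in> U"
    "\<And>f. sn p f \<Longrightarrow> v f = frechet_derivative (f \<circ> inv_into U \<phi>) (at (\<phi> p)) e"
  using assms unfolding tangent_space_def by auto

text \<open>Tangent vectors see only germs. Smoothness at p is itself a property of the germ, so the
  default value 0 is taken on both functions or on neither.\<close>

lemma tv_cong:
  assumes v: "v \<in> T p" and e: "\<forall>\<^sub>F x in nhds p. f x = g x"
  shows "v f = v g"
proof (cases "sn p f")
  case True
  then have g: "sn p g" using e sn_cong by blast
  obtain U \<phi> d where c: "(U, \<phi>) \<in> M" "p \<in> U"
    and v: "\<And>f. sn p f \<Longrightarrow> v f = frechet_derivative (f \<circ> inv_into U \<phi>) (at (\<phi> p)) d"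
    using tv_repr[OF v] by metis
  obtain S where S: "open S" "p \<in> S" "\<forall>x\<in>S. f x = g x" using e unfolding eventually_nhds by blast
  have "frechet_derivative (f \<circ> inv_into U \<phi>) (at (\<phi> p)) = frechet_derivative (g \<circ> inv_into U \<phi>) (at (\<phi> p))"
  proof (rule frechet_derivative_transform_within_open)
    show "open (\<phi> ` (U \<inter> S))" using open_chart_image[OF c(1) S(1)] .
    show "f \<circ> inv_into U \<phi> differentiable at (\<phi> p)"
      using sn_chart_differentiable[OF True c] differentiable_def by blast
  qed (use c S in auto)
  then show ?thesis using v True g by simp
next
  case False
  then have "\<not> sn p g" using e sn_cong_iff by blast
  then show ?thesis using False v tv_nonsmooth by metis
qed

lemma tv_const [simp]: "v \<in> T p \<Longrightarrow> v (\<lambda>x. c) = 0"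
  by (erule tv_repr) (auto simp: o_def frechet_derivative_const)

lemma tv_zero [simp]: "v \<in> T p \<Longrightarrow> v 0 = 0"
  using tv_const[of v p 0] by (simp add: zero_fun_def)

lemma tv_add: "v \<in> T p \<Longrightarrow> sn p f \<Longrightarrow> sn p g \<Longrightarrow> v (\<lambda>x. f x + g x) = v f + v g"
proof -
  assume v: "v \<in> T p" and f: "sn p f" and g: "sn p g"
  obtain U \<phi> d where c: "(U, \<phi>) \<in> M" "p \<in> U"
    and v: "\<And>f. sn p f \<Longrightarrow> v f = frechet_derivative (f \<circ> inv_into U \<phi>) (at (\<phi> p)) d"
    using tv_repr[OF v] by metis
  have "((\<lambda>x. f x + g x) \<circ> inv_into U \<phi> has_derivative
     (\<lambda>d. frechet_derivative (f \<circ> inv_into U \<phi>) (at (\<phi> p)) d +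
          frechet_derivative (g \<circ> inv_into U \<phi>) (at (\<phi> p)) d)) (at (\<phi> p))"
    using has_derivative_add[OF sn_chart_differentiable[OF f c] sn_chart_differentiable[OF g c]]
    by (simp add: o_def)
  then show ?thesis using v[OF f] v[OF g] v[OF sn_add[OF f g]] by (simp add: frechet_at_eq)
qed

lemma tv_mult: "v \<in> T p \<Longrightarrow> sn p f \<Longrightarrow> sn p g \<Longrightarrow> v (\<lambda>x. f x * g x) = f p * v g + v f * g p"
proof -
  assume v: "v \<in> T p" and f: "sn p f" and g: "sn p g"
  obtain U \<phi> d where c: "(U, \<phi>) \<in> M" "p \<in> U"
    and v: "\<And>f. sn p f \<Longrightarrow> v f = frechet_derivative (f \<circ> inv_into U \<phi>) (at (\<phi> p)) d"
    using tv_repr[OF v] by metis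
  have "((\<lambda>x. f x * g x) \<circ> inv_into U \<phi> has_derivative
     (\<lambda>d. f p * frechet_derivative (g \<circ> inv_into U \<phi>) (at (\<phi> p)) d +
          frechet_derivative (f \<circ> inv_into U \<phi>) (at (\<phi> p)) d * g p)) (at (\<phi> p))"
    using has_derivative_mult[OF sn_chart_differentiable[OF f c] sn_chart_differentiable[OF g c]] c
    by (simp add: o_def)
  then show ?thesis using v[OF f] v[OF g] v[OF sn_mult[OF f g]] by (simp add: frechet_at_eq)
qed

lemma tv_cmult: "v \<in> T p \<Longrightarrow> sn p f \<Longrightarrow> v (\<lambda>x. c * f x) = c * v f"
  using tv_mult[of v p "\<lambda>x. c" f] by simp

lemma tv_minus: "v \<in> T p \<Longrightarrow> sn p f \<Longrightarrow> v (\<lambda>x. - f x) = - v f"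
  using tv_cmult[of v p f "-1"] by simp

lemma tv_sum: "v \<in> T p \<Longrightarrow> (\<And>i. i \<in> I \<Longrightarrow> sn p (f i)) \<Longrightarrow> v (\<lambda>x. \<Sum>i\<in>I. f i x) = (\<Sum>i\<in>I. v (f i))"
  by (induct I rule: infinite_finite_induct) (auto simp: tv_add[OF _ _ sn_sum])

section \<open>Cut-off functions and extension of germs\<close>

lemma ex_bump:
  assumes "open W" "p \<in> W"
  obtains \<eta> C where "\<And>x. sn x \<eta>" "\<forall>\<^sub>F x in nhds p. \<eta> x = 1" "closed C" "C \<subseteq> W" "\<And>x. x \<notin> C \<Longrightarrow> \<eta> x = 0"
proof -
  obtain U \<phi> where c: "(U, \<phi>) \<in> M" "p \<in> U" by (rule ex_chart)
  have o: "open (\<phi> ` (U \<inter> W))" by (rule open_chart_image[OF c(1) assms(1)])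
  then obtain R where R: "R > 0" "cball (\<phi> p) R \<subseteq> \<phi> ` (U \<inter> W)"
    using c assms open_contains_cball by blast
  obtain \<rho> :: "'e \<Rightarrow> real" where \<rho>: "cinf_on UNIV \<rho>" "\<And>x. x \<in> ball (\<phi> p) (R/2) \<Longrightarrow> \<rho> x = 1"
    "\<And>x. x \<notin> cball (\<phi> p) R \<Longrightarrow> \<rho> x = 0"
    using ex_smooth_bump[of "R/2" R "\<phi> p"] R by auto
  define C where "C = inv_into U \<phi> ` cball (\<phi> p) R"
  define \<eta> where "\<eta> x = (if x \<in> U then \<rho> (\<phi> x) else 0)" for x
  have CW: "C \<subseteq> U \<inter> W" using R(2) c by (auto simp: C_def)
  \<comment> \<open>C is a closed coordinate ball, so it is compact and, the space being Hausdorff,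
    closed. Its complement is then a neighbourhood of each outer point on which \<eta> is 0, which
    gives smoothness across the boundary of the chart.\<close>
  have "continuous_on (cball (\<phi> p) R) (inv_into U \<phi>)"
    by (rule continuous_on_subset[OF chart(4)[OF c(1)]]) (use R(2) in blast)
  then have C: "closed C"
    unfolding C_def using compact_cball_finite_dim compact_continuous_image compact_imp_closed by blast
  have zero: "\<eta> x = 0" if "x \<notin> C" for x
  proof (cases "x \<in> U")
    case True
    have "\<phi> x \<notin> cball (\<phi> p) R" using that True c(1) unfolding C_def by (metis chart_inv imageI)
    then show ?thesis using \<rho>(3) by (simp add: \<eta>_def)
  qed (simp add: \<eta>_def)
  have "sn x \<eta>" for x
  proof (cases "x \<in> C")
    case True
    then have xU: "x \<in> U" using CW by blast
    have "cinf_on (\<phi> ` U) (\<eta> \<circ> inv_into U \<phi>)"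
      by (rule cinf_on_cong[OF chart(2)[OF c(1)] _ cinf_on_subset[OF \<rho>(1)]]) (use c in \<open>auto simp: \<eta>_def\<close>)
    then show ?thesis using xU chart(1)[OF c(1)] sn_chartI[OF c(1), of U] by blast
  next
    case False
    have "\<forall>\<^sub>F y in nhds x. 0 = \<eta> y"
      unfolding eventually_nhds using C False zero by (intro exI[of _ "- C"]) auto
    then show ?thesis by (rule sn_cong[OF sn_const])
  qed
  moreover have "\<forall>\<^sub>F x in nhds p. \<eta> x = 1"
  proof -
    have "open (U \<inter> \<phi> -` ball (\<phi> p) (R/2))"
      using chart[OF c(1)] continuous_open_preimage by blast
    then show ?thesis unfolding eventually_nhds using R c \<rho>(2)
      by (intro exI[of _ "U \<inter> \<phi> -` ball (\<phi> p) (R/2)"]) (auto simp: \<eta>_def)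
  qed
  ultimately show ?thesis using that C CW zero by blast
qed

text \<open>A cut-off function that is 1 near p extends a germ by 0; off the closed set C the
  product is locally constant 0. Such extensions are indispensable because vector fields and forms
  are required to be global.\<close>

lemma ex_global_extension:
  assumes f: "sn p f"
  obtains g where "\<And>x. sn x g" "\<forall>\<^sub>F x in nhds p. g x = f x"
proof -
  obtain W where W: "open W" "p \<in> W" "\<And>x. x \<in> W \<Longrightarrow> sn x f"
    using sn_open[OF f] unfolding eventually_nhds by blast
  obtain \<eta> C where \<eta>: "\<And>x. sn x \<eta>" "\<forall>\<^sub>F x in nhds p. \<eta> x = 1" "closed C" "C \<subseteq> W" "\<And>x. x \<notin> C \<Longrightarrow> \<eta> x = 0"
    by (rule ex_bump[OF W(1,2)]) blast
  have "sn x (\<lambda>x. \<eta> x * f x)" for x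
  proof (cases "x \<in> C")
    case True
    then show ?thesis using \<eta>(1,4) W by blast
  next
    case False
    have "\<forall>\<^sub>F y in nhds x. 0 = \<eta> y * f y"
      unfolding eventually_nhds using \<eta>(3,5) False by (intro exI[of _ "- C"]) auto
    then show ?thesis by (rule sn_cong[OF sn_const])
  qed
  moreover have "\<forall>\<^sub>F x in nhds p. \<eta> x * f x = f x" using \<eta>(2) by eventually_elim simp
  ultimately show ?thesis using that by blast
qed

section \<open>Vector fields and coordinate frames\<close>

lemma vfield_iff: "vfield X \<longleftrightarrow> (\<forall>p. X p \<in> T p) \<and> (\<forall>p f. sn p f \<longrightarrow> sn p (\<lambda>x. X x f))"
proof -
  have "(\<forall>W f. open W \<longrightarrow> smooth_fun_on M W f \<longrightarrow> smooth_fun_on M W (\<lambda>p. X p f)) \<longleftrightarrow>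
    (\<forall>p f. sn p f \<longrightarrow> sn p (\<lambda>x. X x f))" (is "?L \<longleftrightarrow> ?R")
  proof
    assume L: ?L
    show ?R
    proof (intro allI impI)
      fix p f assume "sn p f"
      then obtain W where "open W" "p \<in> W" "smooth_fun_on M W f" unfolding smooth_near_def by blast
      then show "sn p (\<lambda>x. X x f)" using L unfolding smooth_near_def by blast
    qed
  next
    assume R: ?R
    show ?L
    proof (intro allI impI)
      fix W f assume W: "open W" "smooth_fun_on M W f"
      then have "sn p (\<lambda>x. X x f)" if "p \<in> W" for p using R that smooth_near_iff_on by blast
      then show "smooth_fun_on M W (\<lambda>p. X p f)" using smooth_near_iff_on[OF W(1)] by blast
    qed
  qed
  then show ?thesis unfolding vector_field_def by (rule arg_cong)
qed

lemma vfield_T [intro, simp]: "vfield X \<Longrightarrow> X p \<in> T p"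
  and vfield_sn: "vfield X \<Longrightarrow> sn p f \<Longrightarrow> sn p (\<lambda>x. X x f)"
  by (simp_all add: vfield_iff)

text \<open>Global test functions suffice, because every germ has a global representative and
  tangent vectors see only germs.\<close>

lemma vfieldI:
  assumes "\<And>p. X p \<in> T p" and "\<And>p f. (\<And>x. sn x f) \<Longrightarrow> sn p (\<lambda>x. X x f)"
  shows "vfield X"
  unfolding vfield_iff
proof (intro conjI allI impI)
  fix p f assume "sn p f"
  then obtain g where g: "\<And>x. sn x g" "\<forall>\<^sub>F x in nhds p. g x = f x" using ex_global_extension by blast
  from g(2) have "\<forall>\<^sub>F y in nhds p. \<forall>\<^sub>F x in nhds y. g x = f x" by (simp add: eventually_eventually)
  then have "\<forall>\<^sub>F x in nhds p. X x g = X x f"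
    by eventually_elim (rule tv_cong[OF assms(1)])
  then show "sn p (\<lambda>x. X x f)" by (rule sn_cong[OF assms(2)[OF g(1)]])
qed (rule assms)

lemma vfield_add [intro]: "vfield X \<Longrightarrow> vfield Y \<Longrightarrow> vfield (\<lambda>p. X p + Y p)"
  unfolding vfield_iff by auto

lemma vfield_smult [intro]: "(\<And>x. sn x f) \<Longrightarrow> vfield X \<Longrightarrow> vfield (\<lambda>p. f p *\<^sub>R X p)"
  by (simp add: vfield_iff tangent_scale sn_mult scaleR_fun_apply)

lemma vfield_cmult [intro]: "vfield X \<Longrightarrow> vfield (\<lambda>p. c *\<^sub>R X p)"
  by auto

lemma vfield_zero [simp]: "vfield (\<lambda>p. 0)"
  unfolding vfield_iff by auto

lemma vfield_minus [intro]: "vfield X \<Longrightarrow> vfield (\<lambda>p. - X p)"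
  using vfield_cmult[of X "-1"] by simp

lemma vfield_diff [intro]: "vfield X \<Longrightarrow> vfield Y \<Longrightarrow> vfield (\<lambda>p. X p - Y p)"
  using vfield_add[of X "\<lambda>p. - Y p"] vfield_minus by simp

lemma vfield_sum [intro]: "(\<And>i. i \<in> I \<Longrightarrow> vfield (X i)) \<Longrightarrow> vfield (\<lambda>p. \<Sum>i\<in>I. X i p)"
  by (induct I rule: infinite_finite_induct) auto

text \<open>Properties of cut-off coordinate fields \<open>E\<close> and coordinates
  \<open>xs\<close> at points where the cut-off function is locally 1. The third clause says that
  the fields commute at q; a general frame need not satisfy it, and the tangency of Lie brackets
  rests on it.\<close>

definition frame :: "'m \<Rightarrow> ('e \<Rightarrow> 'm \<Rightarrow> 'm tvec) \<Rightarrow> ('e \<Rightarrow> 'm \<Rightarrow> real) \<Rightarrow> bool" where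
  "frame q E xs \<longleftrightarrow> (\<forall>v\<in>T q. v = (\<Sum>b\<in>onb. v (xs b) *\<^sub>R E b q)) \<and>
     (\<forall>b\<in>onb. \<forall>c\<in>onb. E b q (xs c) = (if b = c then 1 else 0)) \<and>
     (\<forall>f. sn q f \<longrightarrow> (\<forall>b\<in>onb. \<forall>c\<in>onb. E b q (\<lambda>x. E c x f) = E c q (\<lambda>x. E b x f)))"

lemma coord_sn:
  assumes c: "(U, \<phi>) \<in> M" and x: "x \<in> U"
  shows "sn x (\<lambda>q. \<phi> q \<bullet> b)"
proof (rule sn_chartI[OF c chart(1)[OF c] x order_refl])
  have "cinf_on (\<phi> ` U) (\<lambda>y. y \<bullet> b)" by (rule cinf_on_bounded_linear[OF bounded_linear_inner_left])
  then show "cinf_on (\<phi> ` U) ((\<lambda>q. \<phi> q \<bullet> b) \<circ> inv_into U \<phi>)"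
    by (rule cinf_on_cong[OF chart(2)[OF c], rotated]) (use c in auto)
qed

lemma smooth_partial_vec:
  assumes c: "(U, \<phi>) \<in> M" and x: "x \<in> U" and f: "sn x f"
  shows "sn x (\<lambda>q. partial_vec U \<phi> q b f)"
proof -
  obtain A where A: "open A" "x \<in> A" "A \<subseteq> U" "cinf_on (\<phi> ` A) (f \<circ> inv_into U \<phi>)" "open (\<phi> ` A)"
    "\<And>x. x \<in> A \<Longrightarrow> sn x f" by (rule sn_chartD[OF f c x]) blast
  have "cinf_on (\<phi> ` A) ((\<lambda>q. partial_vec U \<phi> q b f) \<circ> inv_into U \<phi>)"
    by (rule cinf_on_cong[OF A(5) _ cinf_on_frechet[OF A(4), of b]])
       (use A c in \<open>auto simp: partial_vec_def subset_iff\<close>)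
  then show ?thesis by (rule sn_chartI[OF c A(1-3)])
qed

lemma partial_vec_coord:
  assumes c: "(U, \<phi>) \<in> M" and q: "q \<in> U"
  shows "partial_vec U \<phi> q e (\<lambda>x. \<phi> x \<bullet> b) = e \<bullet> b"
proof -
  have "((\<lambda>x. \<phi> x \<bullet> b) \<circ> inv_into U \<phi> has_derivative (\<lambda>e. e \<bullet> b)) (at (\<phi> q))"
    by (rule has_derivative_transform_within_open[OF
          bounded_linear_imp_has_derivative[OF bounded_linear_inner_left] chart(2)[OF c]])
       (use c q in auto)
  then show ?thesis using coord_sn[OF c q, of b] by (simp add: partial_vec_def frechet_at_eq)
qed

lemma ex_frame:
  obtains E xs where "\<And>b. vfield (E b)" "\<And>b x. sn x (xs b)" "\<forall>\<^sub>F q in nhds p. frame q E xs"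
proof -
  obtain U \<phi> where c: "(U, \<phi>) \<in> M" "p \<in> U" by (rule ex_chart)
  note o = chart(1)[OF c(1)]
  obtain \<eta> C where \<eta>: "\<And>x. sn x \<eta>" "\<forall>\<^sub>F x in nhds p. \<eta> x = 1" "closed C" "C \<subseteq> U" "\<And>x. x \<notin> C \<Longrightarrow> \<eta> x = 0"
    by (rule ex_bump[OF o c(2)]) blast
  define E where "E b q = (if q \<in> U then \<eta> q *\<^sub>R partial_vec U \<phi> q b else 0)" for b q
  define xs where "xs b q = \<eta> q * (\<phi> q \<bullet> b)" for b q
  have far: "\<forall>\<^sub>F y in nhds x. y \<notin> C" if "x \<notin> C" for x
    unfolding eventually_nhds using that \<eta>(3) by (intro exI[of _ "- C"]) auto
  have inU: "\<forall>\<^sub>F y in nhds x. y \<in> U" if "x \<in> U" for x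
    using that o eventually_nhds_in_open by blast
  note coord = coord_sn[OF c(1)]
  have xs: "sn x (xs b)" for x b
  proof (cases "x \<in> C")
    case True
    then show ?thesis unfolding xs_def using \<eta>(4) by (intro sn_mult \<eta>(1) coord) blast
  next
    case False
    have "\<forall>\<^sub>F y in nhds x. 0 = xs b y" using far[OF False] by eventually_elim (simp add: xs_def \<eta>(5))
    then show ?thesis by (rule sn_cong[OF sn_const])
  qed
  note pds = smooth_partial_vec[OF c(1)]
  have E: "vfield (E b)" for b
    unfolding vfield_iff
  proof (intro conjI allI impI)
    fix q show "E b q \<in> T q" using c by (auto simp: E_def)
  next
    fix x f assume f: "sn x f"
    show "sn x (\<lambda>q. E b q f)"
    proof (cases "x \<in> C")
      case True
      then have xU: "x \<in> U" using \<eta> by blast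
      have "sn x (\<lambda>q. \<eta> q * partial_vec U \<phi> q b f)" by (rule sn_mult[OF \<eta>(1) pds[OF xU f]])
      moreover have "\<forall>\<^sub>F q in nhds x. \<eta> q * partial_vec U \<phi> q b f = E b q f"
        using inU[OF xU] by eventually_elim (simp add: E_def scaleR_fun_def)
      ultimately show ?thesis by (rule sn_cong)
    next
      case False
      have "\<forall>\<^sub>F q in nhds x. 0 = E b q f"
        using far[OF False] by eventually_elim (simp add: E_def \<eta>(5))
      then show ?thesis by (rule sn_cong[OF sn_const])
    qed
  qed
  \<comment> \<open>\<eta> has to be 1 on a neighbourhood of q, not only at q: derivatives of the
    cut-off coordinates and of functions \<open>E b x f\<close> are taken at q. Hence the nested
    filter.\<close>
  have "\<forall>\<^sub>F q in nhds p. \<forall>\<^sub>F x in nhds q. \<eta> x = 1 \<and> x \<in> U"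
    using eventually_conj[OF \<eta>(2) inU[OF c(2)]] by (simp add: eventually_eventually)
  then have "\<forall>\<^sub>F q in nhds p. frame q E xs"
  proof eventually_elim
    case (elim q)
    then have q: "\<eta> q = 1" "q \<in> U" using eventually_nhds_x_imp_x by blast+
    have xe: "\<forall>\<^sub>F x in nhds q. xs b x = \<phi> x \<bullet> b" for b
      using elim by eventually_elim (simp add: xs_def)
    have pdx: "partial_vec U \<phi> q e (xs b) = e \<bullet> b" for e b
    proof -
      have "partial_vec U \<phi> q e (xs b) = partial_vec U \<phi> q e (\<lambda>x. \<phi> x \<bullet> b)"
        using tv_cong[OF partial_vec_tangent[OF c(1) q(2)] xe] .
      also have "\<dots> = e \<bullet> b" by (rule partial_vec_coord[OF c(1) q(2)])
      finally show ?thesis .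
    qed
    have Eq: "E b q = partial_vec U \<phi> q b" for b using q by (simp add: E_def)
    have Ex: "\<forall>\<^sub>F x in nhds q. E b x f = partial_vec U \<phi> x b f" for b f
      using elim by eventually_elim (simp add: E_def)
    show ?case unfolding frame_def
    proof (intro conjI ballI allI impI)
      fix v assume "v \<in> T q"
      then obtain e where e: "v = partial_vec U \<phi> q e" using tangent_iff[OF c(1) q(2)] by blast
      have "linear (partial_vec U \<phi> q)" using partial_vec_linear[OF c(1) q(2)] by (intro linearI)
      then have "v = (\<Sum>b\<in>onb. (e \<bullet> b) *\<^sub>R partial_vec U \<phi> q b)"
        unfolding e by (rule linear_onb_expansion)
      also have "\<dots> = (\<Sum>b\<in>onb. v (xs b) *\<^sub>R E b q)" by (simp add: e pdx Eq)
      finally show "v = (\<Sum>b\<in>onb. v (xs b) *\<^sub>R E b q)" .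
    next
      fix b b' :: 'e assume "b \<in> onb" "b' \<in> onb"
      then show "E b q (xs b') = (if b = b' then 1 else 0)" by (simp add: Eq pdx inner_onb)
    next
      fix f b b' assume f: "sn q f"
      obtain A where A: "open A" "q \<in> A" "A \<subseteq> U" "cinf_on (\<phi> ` A) (f \<circ> inv_into U \<phi>)" "open (\<phi> ` A)"
        "\<And>x. x \<in> A \<Longrightarrow> sn x f" by (rule sn_chartD[OF f c(1) q(2)]) blast
      let ?f = "f \<circ> inv_into U \<phi>"
      \<comment> \<open>The iterated field derivative is an iterated derivative of the chart
        representation, so that the commutation clause becomes
        \<open>frechet_symmetric\<close>.\<close>
      have two: "E b q (\<lambda>x. E b' x f) =
          frechet_derivative (\<lambda>y. frechet_derivative ?f (at y) b') (at (\<phi> q)) b" for b b'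
      proof -
        have "E b q (\<lambda>x. E b' x f) = partial_vec U \<phi> q b (\<lambda>x. partial_vec U \<phi> x b' f)"
          unfolding Eq by (rule tv_cong[OF partial_vec_tangent[OF c(1) q(2)] Ex])
        also have "\<dots> = frechet_derivative ((\<lambda>x. partial_vec U \<phi> x b' f) \<circ> inv_into U \<phi>) (at (\<phi> q)) b"
          using pds[OF q(2) f] by (simp add: partial_vec_def[of U \<phi> q b])
        also have "frechet_derivative ((\<lambda>x. partial_vec U \<phi> x b' f) \<circ> inv_into U \<phi>) (at (\<phi> q)) =
          frechet_derivative (\<lambda>y. frechet_derivative ?f (at y) b') (at (\<phi> q))"
        proof (rule frechet_derivative_transform_within_open[OF _ A(5)])
          show "(\<lambda>x. partial_vec U \<phi> x b' f) \<circ> inv_into U \<phi> differentiable at (\<phi> q)"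
            using sn_chart_differentiable[OF pds[OF q(2) f] c(1) q(2)] differentiable_def by blast
        qed (use A c in \<open>auto simp: partial_vec_def subset_iff\<close>)
        finally show ?thesis .
      qed
      have "ck_on 2 (\<phi> ` A) ?f" using A(4) by (simp add: cinf_on_def)
      then show "E b q (\<lambda>x. E b' x f) = E b' q (\<lambda>x. E b x f)"
        unfolding two using frechet_symmetric[OF A(5)] A(2) by blast
    qed
  qed
  then show ?thesis by (rule that[OF E xs])
qed

abbreviation Ts where "Ts \<equiv> cotangent_space M"
abbreviation form where "form \<equiv> one_form M"
abbreviation bracket where "bracket \<equiv> lie_bracket M"

section \<open>Covectors and one-forms\<close>

lemma cot_linear:
  assumes "\<alpha> \<in> Ts p"
  shows cot_add: "v \<in> T p \<Longrightarrow> w \<in> T p \<Longrightarrow> \<alpha> (v + w) = \<alpha> v + \<alpha> w"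
    and cot_scale: "v \<in> T p \<Longrightarrow> \<alpha> (c *\<^sub>R v) = c * \<alpha> v"
    and cot_outside: "v \<notin> T p \<Longrightarrow> \<alpha> v = 0"
  using assms by (auto simp: cotangent_space_def linear_on_subspace_def)

lemma cot_zero: "\<alpha> \<in> Ts p \<Longrightarrow> \<alpha> 0 = 0"
  using cot_scale[of \<alpha> p 0 0] by simp

lemma cot_minus: "\<alpha> \<in> Ts p \<Longrightarrow> v \<in> T p \<Longrightarrow> \<alpha> (- v) = - \<alpha> v"
  using cot_scale[of \<alpha> p v "-1"] by simp

lemma cot_diff: "\<alpha> \<in> Ts p \<Longrightarrow> v \<in> T p \<Longrightarrow> w \<in> T p \<Longrightarrow> \<alpha> (v - w) = \<alpha> v - \<alpha> w"
  using cot_add[of \<alpha> p v "- w"] cot_minus[of \<alpha> p w] tangent_minus[of w p] by simp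

lemma cot_sum: "\<alpha> \<in> Ts p \<Longrightarrow> (\<And>i. i \<in> I \<Longrightarrow> v i \<in> T p) \<Longrightarrow> \<alpha> (\<Sum>i\<in>I. v i) = (\<Sum>i\<in>I. \<alpha> (v i))"
  by (induct I rule: infinite_finite_induct) (auto simp: cot_zero cot_add tangent_sum)

lemma cot_eqI: "\<alpha> \<in> Ts p \<Longrightarrow> \<beta> \<in> Ts p \<Longrightarrow> (\<And>v. v \<in> T p \<Longrightarrow> \<alpha> v = \<beta> v) \<Longrightarrow> \<alpha> = \<beta>"
  using cot_outside by (metis ext)

lemma on_tangent_apply [simp]: "v \<in> T p \<Longrightarrow> on_tangent M p g v = g v"
  by (simp add: on_tangent_def)

lemma on_tangent_cot:
  assumes "\<And>v w. v \<in> T p \<Longrightarrow> w \<in> T p \<Longrightarrow> g (v + w) = g v + g w"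
    and "\<And>c v. v \<in> T p \<Longrightarrow> g (c *\<^sub>R v) = c * g v"
  shows "on_tangent M p g \<in> Ts p"
  using assms by (auto simp: cotangent_space_def linear_on_subspace_def on_tangent_def
      tangent_add tangent_scale)

lemma cotI:
  assumes "\<And>v w. v \<in> T p \<Longrightarrow> w \<in> T p \<Longrightarrow> \<alpha> (v + w) = \<alpha> v + \<alpha> w"
    and "\<And>c v. v \<in> T p \<Longrightarrow> \<alpha> (c *\<^sub>R v) = c * \<alpha> v" and "\<And>v. v \<notin> T p \<Longrightarrow> \<alpha> v = 0"
  shows "\<alpha> \<in> Ts p"
  using assms by (auto simp: cotangent_space_def linear_on_subspace_def)

lemma cot_closed [intro]:
  shows "\<alpha> \<in> Ts p \<Longrightarrow> \<beta> \<in> Ts p \<Longrightarrow> \<alpha> + \<beta> \<in> Ts p"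
    and "\<alpha> \<in> Ts p \<Longrightarrow> c *\<^sub>R \<alpha> \<in> Ts p"
  by (rule cotI; simp add: cot_add cot_scale cot_outside scaleR_fun_apply distrib_left)+

lemma cot_zero_mem [simp]: "0 \<in> Ts p"
  by (rule cotI) auto

lemma cot_closed_minus [intro]: "\<alpha> \<in> Ts p \<Longrightarrow> - \<alpha> \<in> Ts p"
  using cot_closed(2)[of \<alpha> p "-1"] by simp

lemma cot_closed_diff [intro]: "\<alpha> \<in> Ts p \<Longrightarrow> \<beta> \<in> Ts p \<Longrightarrow> \<alpha> - \<beta> \<in> Ts p"
  using cot_closed(1)[of \<alpha> p "- \<beta>"] by auto

lemma cot_closed_sum [intro]: "(\<And>i. i \<in> I \<Longrightarrow> \<alpha> i \<in> Ts p) \<Longrightarrow> (\<Sum>i\<in>I. \<alpha> i) \<in> Ts p"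
  by (induct I rule: infinite_finite_induct) auto

lemma frame_tv: "frame q E xs \<Longrightarrow> v \<in> T q \<Longrightarrow> v = (\<Sum>b\<in>onb. v (xs b) *\<^sub>R E b q)"
  and frame_dual: "frame q E xs \<Longrightarrow> b \<in> onb \<Longrightarrow> c \<in> onb \<Longrightarrow> E b q (xs c) = (if b = c then 1 else 0)"
  and frame_commute: "frame q E xs \<Longrightarrow> sn q f \<Longrightarrow> b \<in> onb \<Longrightarrow> c \<in> onb \<Longrightarrow>
    E b q (\<lambda>x. E c x f) = E c q (\<lambda>x. E b x f)"
  by (simp_all add: frame_def)

lemma ex_frame_at:
  obtains E xs where "\<And>b. vfield (E b)" "\<And>b x. sn x (xs b)" "frame p E xs"
proof -
  obtain E xs where "\<And>b. vfield (E b)" "\<And>b x. sn x (xs b)" "\<forall>\<^sub>F q in nhds p. frame q E xs"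
    by (rule ex_frame[of p]) blast
  then show ?thesis using that[of E xs] eventually_nhds_x_imp_x[of "\<lambda>q. frame q E xs" p] by blast
qed

lemma frame_cot:
  assumes f: "frame q E xs" and E: "\<And>b. vfield (E b)" and a: "\<alpha> \<in> Ts q" and v: "v \<in> T q"
  shows "\<alpha> v = (\<Sum>b\<in>onb. v (xs b) * \<alpha> (E b q))"
proof -
  have "\<alpha> v = \<alpha> (\<Sum>b\<in>onb. v (xs b) *\<^sub>R E b q)" using frame_tv[OF f v] by simp
  also have "\<dots> = (\<Sum>b\<in>onb. \<alpha> (v (xs b) *\<^sub>R E b q))"
    by (rule cot_sum[OF a]) (use E in \<open>auto simp: tangent_scale\<close>)
  also have "\<dots> = (\<Sum>b\<in>onb. v (xs b) * \<alpha> (E b q))"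
    by (rule sum.cong) (use E in \<open>auto simp: cot_scale[OF a]\<close>)
  finally show ?thesis .
qed

lemma frame_tv_apply:
  assumes "frame q E xs" "v \<in> T q"
  shows "v f = (\<Sum>b\<in>onb. v (xs b) * E b q f)"
proof -
  have "v f = (\<Sum>b\<in>onb. v (xs b) *\<^sub>R E b q) f" using frame_tv[OF assms] by simp
  then show ?thesis by (simp add: sum_fun_apply scaleR_fun_apply)
qed

lemma ex_vf_through:
  assumes "v \<in> T p"
  obtains X where "vfield X" "X p = v"
proof -
  obtain E xs where E: "\<And>b. vfield (E b)" "\<And>b x. sn x (xs b)" "frame p E xs" by (rule ex_frame_at[of p]) blast
  show ?thesis
    by (rule that[of "\<lambda>q. \<Sum>b\<in>onb. v (xs b) *\<^sub>R E b q"])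
       (use E(1) frame_tv[OF E(3) assms, symmetric] in \<open>auto intro!: vfield_sum vfield_cmult\<close>)
qed

lemma form_iff: "form \<alpha> \<longleftrightarrow> (\<forall>p. \<alpha> p \<in> Ts p) \<and> (\<forall>X. vfield X \<longrightarrow> (\<forall>p. sn p (\<lambda>x. \<alpha> x (X x))))"
  by (simp add: one_form_def smooth_near_iff_on[OF open_UNIV])

lemma form_Ts [intro, simp]: "form \<alpha> \<Longrightarrow> \<alpha> p \<in> Ts p"
  and form_sn: "form \<alpha> \<Longrightarrow> vfield X \<Longrightarrow> sn p (\<lambda>x. \<alpha> x (X x))"
  by (simp_all add: form_iff)

lemma form_add [intro]: "form \<alpha> \<Longrightarrow> form \<beta> \<Longrightarrow> form (\<lambda>p. \<alpha> p + \<beta> p)"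
  by (simp add: form_iff cot_closed sn_add)

lemma form_smult [intro]: "(\<And>x. sn x f) \<Longrightarrow> form \<alpha> \<Longrightarrow> form (\<lambda>p. f p *\<^sub>R \<alpha> p)"
  by (simp add: form_iff cot_closed sn_mult scaleR_fun_apply)

lemma form_cmult [intro]: "form \<alpha> \<Longrightarrow> form (\<lambda>p. c *\<^sub>R \<alpha> p)"
  by (rule form_smult) auto

lemma form_zero [simp]: "form (\<lambda>p. 0)"
  by (simp add: form_iff)

lemma form_minus [intro]: "form \<alpha> \<Longrightarrow> form (\<lambda>p. - \<alpha> p)"
  using form_cmult[of \<alpha> "-1"] by simp

lemma form_diff [intro]: "form \<alpha> \<Longrightarrow> form \<beta> \<Longrightarrow> form (\<lambda>p. \<alpha> p - \<beta> p)"
  using form_add[of \<alpha> "\<lambda>p. - \<beta> p"] form_minus by simp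

lemma form_sum [intro]: "(\<And>i. i \<in> I \<Longrightarrow> form (\<alpha> i)) \<Longrightarrow> form (\<lambda>p. \<Sum>i\<in>I. \<alpha> i p)"
  by (induct I rule: infinite_finite_induct) auto

lemma ext_d_apply [simp]: "v \<in> T p \<Longrightarrow> ext_d M f p v = v f"
  by (simp add: ext_d_def)

lemma ext_d_cot [simp, intro]: "ext_d M f p \<in> Ts p"
  unfolding ext_d_def by (rule on_tangent_cot) (simp_all add: scaleR_fun_apply)

lemma form_ext_d [intro]: "(\<And>x. sn x f) \<Longrightarrow> form (ext_d M f)"
  by (simp add: form_iff vfield_sn)

lemma ext_d_cong: "\<forall>\<^sub>F x in nhds p. f x = g x \<Longrightarrow> ext_d M f p = ext_d M g p"
  by (rule cot_eqI) (auto simp: tv_cong)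

lemma ext_d_const [simp]: "ext_d M (\<lambda>x. c) p = 0" "ext_d M 0 p = 0"
  by (rule cot_eqI[of _ p]; simp)+

lemma ext_d_minus: "sn p f \<Longrightarrow> ext_d M (\<lambda>x. - f x) p = - ext_d M f p"
  by (rule cot_eqI[of _ p]) (auto simp: tv_minus intro!: cot_closed_minus)

lemma ex_of_through:
  assumes "\<alpha> \<in> Ts p"
  obtains \<omega> where "form \<omega>" "\<omega> p = \<alpha>"
proof -
  obtain E xs where E: "\<And>b. vfield (E b)" "\<And>b x. sn x (xs b)" "frame p E xs" by (rule ex_frame_at[of p]) blast
  let ?w = "\<lambda>q. \<Sum>b\<in>onb. \<alpha> (E b p) *\<^sub>R ext_d M (xs b) q"
  have "form ?w" using E(2) by (intro form_sum form_cmult form_ext_d)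
  moreover have "?w p = \<alpha>"
  proof (rule cot_eqI[of _ p])
    show "?w p \<in> Ts p" by (rule form_Ts) fact
    fix v assume v: "v \<in> T p"
    then show "?w p v = \<alpha> v"
      by (simp add: frame_cot[OF E(3,1) assms v] sum_fun_apply scaleR_fun_apply mult.commute)
  qed fact
  ultimately show ?thesis by (rule that)
qed

lemma vfield_const [simp]: "vfield X \<Longrightarrow> X p (\<lambda>x. c) = 0"
  by (rule tv_const[OF vfield_T])

section \<open>Lie brackets\<close>

lemma lie_bracket_apply: "sn p f \<Longrightarrow> bracket X Y p f = X p (\<lambda>x. Y x f) - Y p (\<lambda>x. X x f)"
  by (simp add: lie_bracket_def)

lemma lie_bracket_tangent [intro]:
  assumes X: "vfield X" and Y: "vfield Y"
  shows "bracket X Y p \<in> T p"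
proof -
  obtain E xs where E: "\<And>b. vfield (E b)" "\<And>b x. sn x (xs b)" and fr: "\<forall>\<^sub>F q in nhds p. frame q E xs"
    by (rule ex_frame[of p]) blast
  have fp: "frame p E xs" using fr by (rule eventually_nhds_x_imp_x)
  \<comment> \<open>Expanding an iterated derivative in the frame gives a first-order part and a
    part containing \<open>E c (E b f)\<close>. In the commutator the latter cancel because the
    frame commutes, and the remaining first-order operator is the tangent vector
    \<open>?w\<close>.\<close>
  have second: "X p (\<lambda>x. Y x f) = (\<Sum>b\<in>onb. X p (\<lambda>x. Y x (xs b)) * E b p f) +
     (\<Sum>b\<in>onb. \<Sum>c\<in>onb. Y p (xs b) * X p (xs c) * E c p (\<lambda>x. E b x f))"
    if X: "vfield X" and Y: "vfield Y" and f: "sn p f" for X Y f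
  proof -
    have "\<forall>\<^sub>F x in nhds p. Y x f = (\<Sum>b\<in>onb. Y x (xs b) * E b x f)"
      using fr by eventually_elim (rule frame_tv_apply[OF _ vfield_T[OF Y]])
    then have "X p (\<lambda>x. Y x f) = X p (\<lambda>x. \<Sum>b\<in>onb. Y x (xs b) * E b x f)"
      by (rule tv_cong[OF vfield_T[OF X]])
    also have "\<dots> = (\<Sum>b\<in>onb. X p (\<lambda>x. Y x (xs b) * E b x f))"
      by (rule tv_sum[OF vfield_T[OF X]]) (intro sn_mult vfield_sn[OF Y] vfield_sn[OF E(1)] E(2) f)
    also have "\<dots> = (\<Sum>b\<in>onb. X p (\<lambda>x. Y x (xs b)) * E b p f + Y p (xs b) * X p (\<lambda>x. E b x f))"
      by (rule sum.cong[OF refl]) (simp add: tv_mult[OF vfield_T[OF X]] vfield_sn[OF Y] vfield_sn[OF E(1)] E(2) f add.commute)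
    also have "\<dots> = (\<Sum>b\<in>onb. X p (\<lambda>x. Y x (xs b)) * E b p f) + (\<Sum>b\<in>onb. Y p (xs b) * X p (\<lambda>x. E b x f))"
      by (rule sum.distrib)
    also have "(\<Sum>b\<in>onb. Y p (xs b) * X p (\<lambda>x. E b x f)) =
        (\<Sum>b\<in>onb. \<Sum>c\<in>onb. Y p (xs b) * X p (xs c) * E c p (\<lambda>x. E b x f))"
      by (subst frame_tv_apply[OF fp vfield_T[OF X]]) (simp add: sum_distrib_left mult.assoc)
    finally show ?thesis .
  qed
  let ?w = "\<Sum>b\<in>onb. (X p (\<lambda>x. Y x (xs b)) - Y p (\<lambda>x. X x (xs b))) *\<^sub>R E b p"
  have w: "?w \<in> T p" using E(1) by (intro tangent_sum tangent_scale vfield_T)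
  have "bracket X Y p = ?w"
  proof
    fix f
    show "bracket X Y p f = ?w f"
    proof (cases "sn p f")
      case True
      have "(\<Sum>b\<in>onb. \<Sum>c\<in>onb. Y p (xs b) * X p (xs c) * E c p (\<lambda>x. E b x f)) =
        (\<Sum>b\<in>onb. \<Sum>c\<in>onb. X p (xs b) * Y p (xs c) * E c p (\<lambda>x. E b x f))"
        by (subst sum.swap) (intro sum.cong refl, simp add: frame_commute[OF fp True])
      then show ?thesis
        unfolding lie_bracket_apply[OF True] second[OF X Y True] second[OF Y X True]
        by (simp add: sum_fun_apply scaleR_fun_apply left_diff_distrib sum_subtractf)
    next
      case False
      then show ?thesis using tv_nonsmooth[OF w False] by (simp add: lie_bracket_def)
    qed
  qed
  then show ?thesis using w by simp
qed

lemma vfield_lie_bracket [intro]: "vfield X \<Longrightarrow> vfield Y \<Longrightarrow> vfield (bracket X Y)"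
proof (rule vfieldI)
  assume X: "vfield X" and Y: "vfield Y"
  then show "bracket X Y p \<in> T p" for p by blast
  fix p f assume "\<And>x. sn x f"
  then show "sn p (\<lambda>x. bracket X Y x f)"
    using X Y by (simp add: lie_bracket_apply sn_diff vfield_sn)
qed

lemma lie_bracket_zero [simp]: "vfield X \<Longrightarrow> bracket X (\<lambda>x. 0) = (\<lambda>x. 0)" "vfield X \<Longrightarrow> bracket (\<lambda>x. 0) X = (\<lambda>x. 0)"
  by (auto simp: lie_bracket_def fun_eq_iff tv_const[OF vfield_T])

section \<open>Lie derivatives of one-forms\<close>

definition lie_expr :: "('m \<Rightarrow> 'm tvec) \<Rightarrow> ('m \<Rightarrow> 'm covec) \<Rightarrow> 'm \<Rightarrow> ('m \<Rightarrow> 'm tvec) \<Rightarrow> real" where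
  "lie_expr X \<alpha> p Y = X p (\<lambda>x. \<alpha> x (Y x)) - \<alpha> p (bracket X Y p)"

text \<open>The derivatives of the coefficients of \<open>Y\<close> cancel, so the expression is tensorial in \<open>Y\<close>.\<close>

lemma lie_expr_tensorial:
  assumes X: "vfield X" and a: "form \<alpha>"
  obtains G where "\<And>Y. vfield Y \<Longrightarrow> lie_expr X \<alpha> p Y = G (Y p)" "G \<in> Ts p"
proof -
  obtain E xs where E: "\<And>b. vfield (E b)" "\<And>b x. sn x (xs b)" and fr: "\<forall>\<^sub>F q in nhds p. frame q E xs"
    by (rule ex_frame[of p]) blast
  have fp: "frame p E xs" using fr by (rule eventually_nhds_x_imp_x)
  let ?G = "on_tangent M p (\<lambda>v. \<Sum>b\<in>onb. v (xs b) * lie_expr X \<alpha> p (E b))"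
  have "lie_expr X \<alpha> p Y = ?G (Y p)" if Y: "vfield Y" for Y
  proof -
    note XT = vfield_T[OF X, of p] and YT = vfield_T[OF Y, of p]
    have "\<forall>\<^sub>F x in nhds p. \<alpha> x (Y x) = (\<Sum>b\<in>onb. Y x (xs b) * \<alpha> x (E b x))"
      using fr by eventually_elim (rule frame_cot[OF _ E(1) form_Ts[OF a] vfield_T[OF Y]])
    then have "X p (\<lambda>x. \<alpha> x (Y x)) = X p (\<lambda>x. \<Sum>b\<in>onb. Y x (xs b) * \<alpha> x (E b x))"
      by (rule tv_cong[OF XT])
    also have "\<dots> = (\<Sum>b\<in>onb. X p (\<lambda>x. Y x (xs b) * \<alpha> x (E b x)))"
      by (rule tv_sum[OF XT]) (intro sn_mult vfield_sn[OF Y] form_sn[OF a] E)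
    also have "\<dots> = (\<Sum>b\<in>onb. Y p (xs b) * X p (\<lambda>x. \<alpha> x (E b x)) + X p (\<lambda>x. Y x (xs b)) * \<alpha> p (E b p))"
      by (rule sum.cong[OF refl], rule tv_mult[OF XT]) (intro vfield_sn[OF Y] form_sn[OF a] E)+
    finally have 1: "X p (\<lambda>x. \<alpha> x (Y x)) = \<dots>" .
    let ?w = "\<Sum>b\<in>onb. Y p (xs b) *\<^sub>R bracket X (E b) p + X p (\<lambda>x. Y x (xs b)) *\<^sub>R E b p"
    have wT: "Y p (xs b) *\<^sub>R bracket X (E b) p \<in> T p" "X p (\<lambda>x. Y x (xs b)) *\<^sub>R E b p \<in> T p" for b
      using X E(1) by (auto intro!: tangent_scale)
    have w: "bracket X Y p = ?w"
    proof (rule tv_eqI[of _ p])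
      show "bracket X Y p \<in> T p" using X Y by blast
      show "?w \<in> T p" using wT by (intro tangent_sum tangent_add)
      fix f assume f: "sn p f"
      have "\<forall>\<^sub>F x in nhds p. Y x f = (\<Sum>b\<in>onb. Y x (xs b) * E b x f)"
        using fr by eventually_elim (rule frame_tv_apply[OF _ vfield_T[OF Y]])
      then have "X p (\<lambda>x. Y x f) = X p (\<lambda>x. \<Sum>b\<in>onb. Y x (xs b) * E b x f)"
        by (rule tv_cong[OF XT])
      also have "\<dots> = (\<Sum>b\<in>onb. X p (\<lambda>x. Y x (xs b) * E b x f))"
        by (rule tv_sum[OF XT]) (intro sn_mult vfield_sn[OF Y] vfield_sn[OF E(1)] E(2) f)
      also have "\<dots> = (\<Sum>b\<in>onb. Y p (xs b) * X p (\<lambda>x. E b x f) + X p (\<lambda>x. Y x (xs b)) * E b p f)"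
        by (rule sum.cong[OF refl], rule tv_mult[OF XT]) (intro vfield_sn[OF Y] vfield_sn[OF E(1)] E(2) f)+
      finally show "bracket X Y p f = ?w f"
        by (simp add: lie_bracket_apply[OF f] sum_fun_apply scaleR_fun_apply
            frame_tv_apply[OF fp YT, of "\<lambda>x. X x f"] sum_subtractf[symmetric] right_diff_distrib)
           (rule sum.cong[OF refl], simp)
    qed
    have "\<alpha> p ?w = (\<Sum>b\<in>onb. \<alpha> p (Y p (xs b) *\<^sub>R bracket X (E b) p + X p (\<lambda>x. Y x (xs b)) *\<^sub>R E b p))"
      by (rule cot_sum[OF form_Ts[OF a]]) (intro tangent_add wT)
    also have "\<dots> = (\<Sum>b\<in>onb. Y p (xs b) * \<alpha> p (bracket X (E b) p) + X p (\<lambda>x. Y x (xs b)) * \<alpha> p (E b p))"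
      by (rule sum.cong[OF refl])
         (simp add: cot_add[OF form_Ts[OF a] wT] cot_scale[OF form_Ts[OF a]] lie_bracket_tangent X E(1))
    finally have "lie_expr X \<alpha> p Y = (\<Sum>b\<in>onb. Y p (xs b) * lie_expr X \<alpha> p (E b))"
      unfolding lie_expr_def 1 w by (simp add: sum_subtractf[symmetric] right_diff_distrib)
    then show ?thesis using YT by simp
  qed
  moreover have "?G \<in> Ts p"
    by (rule on_tangent_cot)
       (simp_all add: scaleR_fun_apply sum.distrib distrib_right sum_distrib_left mult.assoc)
  ultimately show ?thesis by (rule that)
qed

text \<open>Turns the definite description in \<open>lie_form\<close> into facts. Tensoriality
  provides the covector at each point; uniqueness holds since every tangent vector is the value of a
  global field.\<close>

lemma lie_form_ex1:
  assumes X: "vfield X" and a: "form \<alpha>"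
  shows "\<exists>!\<omega>. form \<omega> \<and> (\<forall>Y. vfield Y \<longrightarrow> (\<forall>p. \<omega> p (Y p) = X p (\<lambda>x. \<alpha> x (Y x)) - \<alpha> p (bracket X Y p)))"
proof -
  have "\<forall>p. \<exists>G. (\<forall>Y. vfield Y \<longrightarrow> lie_expr X \<alpha> p Y = G (Y p)) \<and> G \<in> Ts p"
    using lie_expr_tensorial[OF X a] by metis
  then obtain \<omega> where w: "\<And>p Y. vfield Y \<Longrightarrow> lie_expr X \<alpha> p Y = \<omega> p (Y p)" "\<And>p. \<omega> p \<in> Ts p" by metis
  have "form \<omega>" unfolding form_iff
  proof (intro conjI allI impI)
    show "\<omega> p \<in> Ts p" for p by (rule w)
    fix Y p assume Y: "vfield Y"
    have "sn p (\<lambda>x. X x (\<lambda>y. \<alpha> y (Y y)) - \<alpha> x (bracket X Y x))"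
      by (intro sn_diff vfield_sn[OF X] form_sn[OF a] vfield_lie_bracket X Y)
    then show "sn p (\<lambda>x. \<omega> x (Y x))" using w(1)[OF Y] by (simp add: lie_expr_def)
  qed
  show ?thesis
  proof (rule ex1I[of _ \<omega>])
    show "form \<omega> \<and> (\<forall>Y. vfield Y \<longrightarrow> (\<forall>p. \<omega> p (Y p) = X p (\<lambda>x. \<alpha> x (Y x)) - \<alpha> p (bracket X Y p)))"
      using \<open>form \<omega>\<close> w(1) by (simp add: lie_expr_def)
    fix \<omega>' assume w': "form \<omega>' \<and> (\<forall>Y. vfield Y \<longrightarrow> (\<forall>p. \<omega>' p (Y p) = X p (\<lambda>x. \<alpha> x (Y x)) - \<alpha> p (bracket X Y p)))"
    show "\<omega>' = \<omega>"
    proof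
      fix p show "\<omega>' p = \<omega> p"
      proof (rule cot_eqI[of _ p])
        show "\<omega>' p \<in> Ts p" using w' by simp
        fix v assume "v \<in> T p"
        then obtain Y where "vfield Y" "Y p = v" by (rule ex_vf_through)
        then show "\<omega>' p v = \<omega> p v" using w' w(1)[of Y p] by (auto simp: lie_expr_def)
      qed (rule w)
    qed
  qed
qed

lemma form_lie_form [intro]: "vfield X \<Longrightarrow> form \<alpha> \<Longrightarrow> form (lie_form M X \<alpha>)"
  and lie_form_apply: "vfield X \<Longrightarrow> form \<alpha> \<Longrightarrow> vfield Y \<Longrightarrow>
    lie_form M X \<alpha> p (Y p) = X p (\<lambda>x. \<alpha> x (Y x)) - \<alpha> p (bracket X Y p)"
  using theI'[OF lie_form_ex1, of X \<alpha>] unfolding lie_form_def[symmetric] by simp_all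

lemma lie_form_zero [simp]:
  "vfield X \<Longrightarrow> lie_form M X (\<lambda>x. 0) p = 0" "form \<alpha> \<Longrightarrow> lie_form M (\<lambda>x. 0) \<alpha> p = 0"
proof -
  assume X: "vfield X"
  show "lie_form M X (\<lambda>x. 0) p = 0"
  proof (rule cot_eqI[of _ p])
    fix v assume "v \<in> T p"
    then obtain Y where "vfield Y" "Y p = v" by (rule ex_vf_through)
    then show "lie_form M X (\<lambda>x. 0) p v = 0 v" using lie_form_apply[OF X form_zero, of Y p] X by simp
  qed (rule form_Ts[OF form_lie_form[OF X form_zero]] cot_zero_mem)+
next
  assume a: "form \<alpha>"
  show "lie_form M (\<lambda>x. 0) \<alpha> p = 0"
  proof (rule cot_eqI[of _ p])
    fix v assume "v \<in> T p"
    then obtain Y where "vfield Y" "Y p = v" by (rule ex_vf_through)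
    then show "lie_form M (\<lambda>x. 0) \<alpha> p v = 0 v"
      using lie_form_apply[OF vfield_zero a, of Y p] a by (simp add: cot_zero[OF form_Ts])
  qed (rule form_Ts[OF form_lie_form[OF vfield_zero a]] cot_zero_mem)+
qed

section \<open>Sharp, flat and transposed endomorphisms\<close>

lemma cot_separates:
  assumes v: "v \<in> T p" "w \<in> T p" and e: "\<And>\<beta>. \<beta> \<in> Ts p \<Longrightarrow> \<beta> v = \<beta> w"
  shows "v = w"
  by (rule tv_eqI[OF v]) (use e[OF ext_d_cot] v in simp)

lemma sharp_ex1:
  assumes P: "skew_bilinear_on (Ts p) (P p)" and a: "\<alpha> \<in> Ts p"
  shows "\<exists>!v. v \<in> T p \<and> (\<forall>\<beta>\<in>Ts p. \<beta> v = P p \<alpha> \<beta>)"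
proof -
  obtain E xs where E: "\<And>b. vfield (E b)" "\<And>b x. sn x (xs b)" "frame p E xs" by (rule ex_frame_at[of p]) blast
  \<comment> \<open>The coefficients are forced: the coordinate differentials of the sought vector
    must be the values of \<open>P p \<alpha>\<close> on these differentials.\<close>
  let ?v = "\<Sum>b\<in>onb. P p \<alpha> (ext_d M (xs b) p) *\<^sub>R E b p"
  have v: "?v \<in> T p" using E(1) by (intro tangent_sum tangent_scale vfield_T)
  have P0: "P p \<alpha> 0 = 0" using skewD(3)[OF P a cot_zero_mem, of 0] by simp
  have Psum: "P p \<alpha> (\<Sum>i\<in>I. \<gamma> i) = (\<Sum>i\<in>I. P p \<alpha> (\<gamma> i))" if "\<And>i. i \<in> I \<Longrightarrow> \<gamma> i \<in> Ts p" for I :: "'e set" and \<gamma>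
    using that
  proof (induct I rule: infinite_finite_induct)
    case empty
    show ?case by (simp only: sum.empty P0)
  next
    case (insert i I)
    then have "sum \<gamma> I \<in> Ts p" "\<gamma> i \<in> Ts p" by auto
    note e = skewD(2)[OF P a this(2,1)]
    have IH: "P p \<alpha> (sum \<gamma> I) = (\<Sum>i\<in>I. P p \<alpha> (\<gamma> i))" by (rule insert(3)) (rule insert(4), rule insertI2)
    show ?case unfolding sum.insert[OF insert(1,2)] e IH ..
  next
    case (infinite I)
    show ?case unfolding sum.infinite[OF infinite(1)] P0 ..
  qed
  have main: "\<beta> ?v = P p \<alpha> \<beta>" if b: "\<beta> \<in> Ts p" for \<beta>
  proof -
    have "\<beta> ?v = (\<Sum>b\<in>onb. \<beta> (P p \<alpha> (ext_d M (xs b) p) *\<^sub>R E b p))"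
      by (rule cot_sum[OF b]) (use E(1) in \<open>intro tangent_scale vfield_T\<close>)
    also have "\<dots> = (\<Sum>b\<in>onb. P p \<alpha> (\<beta> (E b p) *\<^sub>R ext_d M (xs b) p))"
      by (rule sum.cong[OF refl]) (simp add: cot_scale[OF b] E(1) skewD(3)[OF P a])
    also have "\<dots> = P p \<alpha> (\<Sum>b\<in>onb. \<beta> (E b p) *\<^sub>R ext_d M (xs b) p)"
      by (rule Psum[symmetric]) auto
    also have "(\<Sum>b\<in>onb. \<beta> (E b p) *\<^sub>R ext_d M (xs b) p) = \<beta>"
    proof (rule cot_eqI[OF _ b])
      show "(\<Sum>b\<in>onb. \<beta> (E b p) *\<^sub>R ext_d M (xs b) p) \<in> Ts p" by auto
      fix v assume v: "v \<in> T p"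
      then show "(\<Sum>b\<in>onb. \<beta> (E b p) *\<^sub>R ext_d M (xs b) p) v = \<beta> v"
        by (simp add: frame_cot[OF E(3,1) b v] sum_fun_apply scaleR_fun_apply mult.commute)
    qed
    finally show ?thesis .
  qed
  show ?thesis
  proof (intro ex1I[of _ ?v] conjI ballI v main)
    fix w assume w: "w \<in> T p \<and> (\<forall>\<beta>\<in>Ts p. \<beta> w = P p \<alpha> \<beta>)"
    show "w = ?v"
    proof (rule cot_separates[OF _ v])
      show "w \<in> T p" using w by blast
      show "\<beta> w = \<beta> ?v" if "\<beta> \<in> Ts p" for \<beta>
        using w that main[OF that] by (metis (no_types))
    qed
  qed
qed

lemma sharp_tangent: "skew_bilinear_on (Ts p) (P p) \<Longrightarrow> \<alpha> \<in> Ts p \<Longrightarrow> sharp M P p \<alpha> \<in> T p"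
  and sharp_apply: "skew_bilinear_on (Ts p) (P p) \<Longrightarrow> \<alpha> \<in> Ts p \<Longrightarrow> \<beta> \<in> Ts p \<Longrightarrow> \<beta> (sharp M P p \<alpha>) = P p \<alpha> \<beta>"
  using theI'[OF sharp_ex1, of p P \<alpha>] unfolding sharp_def[symmetric] by simp_all

lemma bivectorD: "bivector_field M P \<Longrightarrow> skew_bilinear_on (Ts p) (P p)"
  and bivector_sn: "bivector_field M P \<Longrightarrow> form \<alpha> \<Longrightarrow> form \<beta> \<Longrightarrow> sn p (\<lambda>x. P x (\<alpha> x) (\<beta> x))"
  by (simp_all add: bivector_field_def smooth_near_iff_on[OF open_UNIV])

lemma two_formD: "two_form M \<theta> \<Longrightarrow> skew_bilinear_on (T p) (\<theta> p)"
  and two_form_sn: "two_form M \<theta> \<Longrightarrow> vfield X \<Longrightarrow> vfield Y \<Longrightarrow> sn p (\<lambda>x. \<theta> x (X x) (Y x))"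
  by (simp_all add: two_form_def smooth_near_iff_on[OF open_UNIV])

lemma endoD:
  assumes "endomorphism_field M F"
  shows "v \<in> T p \<Longrightarrow> F p v \<in> T p" "v \<in> T p \<Longrightarrow> w \<in> T p \<Longrightarrow> F p (v + w) = F p v + F p w"
    "v \<in> T p \<Longrightarrow> F p (c *\<^sub>R v) = c *\<^sub>R F p v" "vfield X \<Longrightarrow> vfield (\<lambda>p. F p (X p))"
  using assms by (auto simp: endomorphism_field_def linear_on_subspace_def image_subset_iff)

lemma vfield_sharp [intro]:
  assumes P: "bivector_field M P" and a: "form \<alpha>"
  shows "vfield (\<lambda>p. sharp M P p (\<alpha> p))"
proof (rule vfieldI)
  show t: "sharp M P p (\<alpha> p) \<in> T p" for p using sharp_tangent[where P=P, OF bivectorD[OF P] form_Ts[OF a]] .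
  fix p and f :: "'m \<Rightarrow> real" assume f: "\<And>x. sn x f"
  have "sharp M P x (\<alpha> x) f = P x (\<alpha> x) (ext_d M f x)" for x
    using sharp_apply[where P=P and p=x, OF bivectorD[OF P] form_Ts[OF a] ext_d_cot] t by simp
  then show "sn p (\<lambda>x. sharp M P x (\<alpha> x) f)" using bivector_sn[OF P a form_ext_d[OF f]] by simp
qed

lemma flat_apply [simp]: "w \<in> T p \<Longrightarrow> flat M \<theta> p v w = \<theta> p v w"
  by (simp add: flat_def)

lemma flat_cot: "two_form M \<theta> \<Longrightarrow> v \<in> T p \<Longrightarrow> flat M \<theta> p v \<in> Ts p"
  unfolding flat_def by (rule on_tangent_cot) (simp_all add: skewD(2,3)[OF two_formD])

lemma form_flat [intro]: "two_form M \<theta> \<Longrightarrow> vfield X \<Longrightarrow> form (\<lambda>p. flat M \<theta> p (X p))"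
  by (simp add: form_iff flat_cot two_form_sn)

lemma cov_comp_apply [simp]: "v \<in> T p \<Longrightarrow> cov_comp M F p \<alpha> v = \<alpha> (F p v)"
  by (simp add: cov_comp_def)

lemma cov_comp_cot: "endomorphism_field M F \<Longrightarrow> \<alpha> \<in> Ts p \<Longrightarrow> cov_comp M F p \<alpha> \<in> Ts p"
  unfolding cov_comp_def by (rule on_tangent_cot) (simp_all only: o_apply endoD cot_add cot_scale)

lemma form_cov_comp [intro]: "endomorphism_field M F \<Longrightarrow> form \<alpha> \<Longrightarrow> form (\<lambda>p. cov_comp M F p (\<alpha> p))"
  by (simp add: form_iff cov_comp_cot endoD(4))

text \<open>Along a curve tangent to \<open>D\<close> the derivative of f is a velocity applied to
  f, hence 0, and the mean value theorem applies. Differentiability of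
  \<open>f \<circ> \<gamma>\<close> is obtained separately in a chart because
  \<open>velocity\<close> is defined through \<open>deriv\<close>, whose value alone does not give
  differentiability.\<close>

lemma constant_on_leaf:
  assumes f: "\<And>p. p \<in> U \<Longrightarrow> sn p f" and D: "\<And>p v. p \<in> U \<Longrightarrow> v \<in> D p \<Longrightarrow> v f = 0"
    and l: "same_leaf M D U x y"
  shows "f x = f y"
proof -
  obtain J \<gamma> where J: "open J" "{0..1} \<subseteq> J" "smooth_map_on line_atlas M J \<gamma>" "\<gamma> ` J \<subseteq> U" "\<gamma> 0 = x" "\<gamma> 1 = y"
    "\<forall>t\<in>J. velocity M \<gamma> t \<in> D (\<gamma> t)" using l unfolding same_leaf_def by blast
  have der: "((f \<circ> \<gamma>) has_real_derivative 0) (at t)" if t: "t \<in> J" for t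
  proof -
    have fs: "sn (\<gamma> t) f" using f J(4) t by blast
    obtain A \<phi> where c: "(A, \<phi>) \<in> M" "\<gamma> t \<in> A" by (rule ex_chart)
    have gc: "continuous_on J \<gamma>" using J(3) by (simp add: smooth_map_on_def)
    have o: "open (J \<inter> \<gamma> -` A)" using gc J(1) chart(1)[OF c(1)] continuous_open_preimage by blast
    have "cinf_on (id ` (UNIV \<inter> J \<inter> \<gamma> -` A)) (\<phi> \<circ> \<gamma> \<circ> inv_into UNIV id)"
      using J(3) c(1) unfolding smooth_map_on_def line_atlas_def by blast
    moreover have "inv_into UNIV id = (id :: real \<Rightarrow> real)" by (rule inv_id)
    ultimately have "cinf_on (J \<inter> \<gamma> -` A) (\<phi> \<circ> \<gamma>)" by simp
    then have "\<phi> \<circ> \<gamma> differentiable at t" using cinf_on_differentiable t c(2) by blast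
    then obtain g' where g': "(\<phi> \<circ> \<gamma> has_derivative g') (at t)" by (auto simp: differentiable_def)
    have "((f \<circ> inv_into A \<phi>) has_derivative frechet_derivative (f \<circ> inv_into A \<phi>) (at (\<phi> (\<gamma> t)))) (at ((\<phi> \<circ> \<gamma>) t))"
      using sn_chart_differentiable[OF fs c] by simp
    from diff_chain_at[OF g' this]
    have "(f \<circ> \<gamma> has_derivative frechet_derivative (f \<circ> inv_into A \<phi>) (at (\<phi> (\<gamma> t))) \<circ> g') (at t)"
      by (rule has_derivative_transform_within_open[OF _ o]) (use t c in auto)
    then have "f \<circ> \<gamma> differentiable at t" by (auto simp: differentiable_def)
    then have "((f \<circ> \<gamma>) has_real_derivative deriv (f \<circ> \<gamma>) t) (at t)"
      by (simp add: DERIV_deriv_iff_real_differentiable)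
    moreover have "deriv (f \<circ> \<gamma>) t = 0"
      using D[of "\<gamma> t" "velocity M \<gamma> t"] J(4,7) t fs by (auto simp: velocity_def)
    ultimately show ?thesis by simp
  qed
  have "\<exists>z>0::real. z < 1 \<and> (f \<circ> \<gamma>) 1 - (f \<circ> \<gamma>) 0 = (1 - 0) * (0::real)"
    by (rule MVT2[where f'="\<lambda>_. 0"]) (simp, rule der, use J(2) in auto)
  then show ?thesis using J(5,6) by auto
qed

end


section \<open>Consequences of normality\<close>

locale contact = manifold M
  for M :: "('m::{t2_space,second_countable_topology}, 'e::finite_dim_inner) atlas" +
  fixes h :: nat and P \<theta> F Z \<xi>
  assumes normal: "normal_gen_almost_contact M h P \<theta> F Z \<xi>"
begin

section \<open>Pointwise algebra of the structure\<close>

abbreviation S where "S p \<equiv> sharp M P p"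
abbreviation B where "B p \<equiv> flat M \<theta> p"
abbreviation C where "C p \<equiv> cov_comp M F p"
abbreviation I where "I \<equiv> {1..h}"

lemma
  shows bivector_P: "bivector_field M P" and two_form_theta: "two_form M \<theta>" and endo_F: "endomorphism_field M F"
    and vfield_Z: "a \<in> I \<Longrightarrow> vfield (Z a)" and form_xi: "a \<in> I \<Longrightarrow> form (\<xi> a)"
    and PF: "\<alpha> \<in> Ts p \<Longrightarrow> \<beta> \<in> Ts p \<Longrightarrow> P p (C p \<alpha>) \<beta> = P p \<alpha> (C p \<beta>)"
    and theta_F: "v \<in> T p \<Longrightarrow> w \<in> T p \<Longrightarrow> \<theta> p (F p v) w = \<theta> p v (F p w)"
    and FZ: "a \<in> I \<Longrightarrow> F p (Z a p) = 0"
    and xiF: "a \<in> I \<Longrightarrow> v \<in> T p \<Longrightarrow> \<xi> a p (F p v) = 0"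
    and theta_Z: "a \<in> I \<Longrightarrow> v \<in> T p \<Longrightarrow> \<theta> p (Z a p) v = 0"
    and Pxi: "a \<in> I \<Longrightarrow> \<beta> \<in> Ts p \<Longrightarrow> P p (\<xi> a p) \<beta> = 0"
    and xiZ: "a \<in> I \<Longrightarrow> b \<in> I \<Longrightarrow> \<xi> a p (Z b p) = (if a = b then 1 else 0)"
    and F2: "v \<in> T p \<Longrightarrow> F p (F p v) = - v - S p (B p v) + (\<Sum>a\<in>I. \<xi> a p v *\<^sub>R Z a p)"
    and closed: "eigenbundle_closed (big_sections M h) (big_Phi M h P \<theta> F Z \<xi>) (stable_courant_bracket M h)"
  using normal unfolding normal_gen_almost_contact_def gen_almost_contact_def by blast+

lemmas F_T = endoD(1)[OF endo_F] and F_add = endoD(2)[OF endo_F] and F_scale = endoD(3)[OF endo_F]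

lemma F_zero: "F p 0 = 0"
  using F_scale[of 0 p 0] by simp

lemma F_minus: "v \<in> T p \<Longrightarrow> F p (- v) = - F p v"
  using F_scale[of v p "-1"] by simp

lemma F_diff: "v \<in> T p \<Longrightarrow> w \<in> T p \<Longrightarrow> F p (v - w) = F p v - F p w"
  using F_add[of v p "- w"] F_minus[of w p] tangent_minus[of w p] by (simp only: diff_conv_add_uminus)

lemma S_T: "\<alpha> \<in> Ts p \<Longrightarrow> S p \<alpha> \<in> T p"
  by (rule sharp_tangent[where P=P, OF bivectorD[OF bivector_P]])

lemma S_apply: "\<alpha> \<in> Ts p \<Longrightarrow> \<beta> \<in> Ts p \<Longrightarrow> \<beta> (S p \<alpha>) = P p \<alpha> \<beta>"
  by (rule sharp_apply[where P=P, OF bivectorD[OF bivector_P]])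

lemmas P_skew = skewD(1)[where b="P p" for p, OF bivectorD[OF bivector_P]]
  and P_add = skewD(4)[where b="P p" for p, OF bivectorD[OF bivector_P]]
  and P_scale = skewD(5)[where b="P p" for p, OF bivectorD[OF bivector_P]]
  and theta_skew = skewD(1)[where b="\<theta> p" for p, OF two_formD[OF two_form_theta]]
  and theta_add = skewD(4)[where b="\<theta> p" for p, OF two_formD[OF two_form_theta]]
  and theta_scale = skewD(5)[where b="\<theta> p" for p, OF two_formD[OF two_form_theta]]

lemma S_add:
  assumes a: "\<alpha> \<in> Ts p" and b: "\<beta> \<in> Ts p"
  shows "S p (\<alpha> + \<beta>) = S p \<alpha> + S p \<beta>"
proof (rule cot_separates[of _ p])
  have ab: "\<alpha> + \<beta> \<in> Ts p" using a b by (rule cot_closed)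
  show "S p (\<alpha> + \<beta>) \<in> T p" "S p \<alpha> + S p \<beta> \<in> T p" using a b ab S_T by blast+
  fix \<gamma> assume g: "\<gamma> \<in> Ts p"
  show "\<gamma> (S p (\<alpha> + \<beta>)) = \<gamma> (S p \<alpha> + S p \<beta>)"
    unfolding cot_add[OF g S_T[OF a] S_T[OF b]] S_apply[OF ab g] S_apply[OF a g] S_apply[OF b g]
    by (rule P_add[OF a g b])
qed

lemma S_scale:
  assumes a: "\<alpha> \<in> Ts p"
  shows "S p (c *\<^sub>R \<alpha>) = c *\<^sub>R S p \<alpha>"
proof (rule cot_separates[of _ p])
  have ab: "c *\<^sub>R \<alpha> \<in> Ts p" using a by (rule cot_closed)
  show "S p (c *\<^sub>R \<alpha>) \<in> T p" "c *\<^sub>R S p \<alpha> \<in> T p" using a ab S_T by blast+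
  fix \<gamma> assume g: "\<gamma> \<in> Ts p"
  show "\<gamma> (S p (c *\<^sub>R \<alpha>)) = \<gamma> (c *\<^sub>R S p \<alpha>)"
    unfolding cot_scale[OF g S_T[OF a]] S_apply[OF ab g] S_apply[OF a g]
    by (rule P_scale[OF a g])
qed

lemma S_zero: "S p 0 = 0"
  using S_scale[of 0 p 0] by simp

lemma S_minus: "\<alpha> \<in> Ts p \<Longrightarrow> S p (- \<alpha>) = - S p \<alpha>"
  using S_scale[of \<alpha> p "-1"] by simp

lemma S_diff: "\<alpha> \<in> Ts p \<Longrightarrow> \<beta> \<in> Ts p \<Longrightarrow> S p (\<alpha> - \<beta>) = S p \<alpha> - S p \<beta>"
  using S_add[of \<alpha> p "- \<beta>"] S_minus[of \<beta> p] cot_closed_minus[of \<beta> p] by (simp only: diff_conv_add_uminus)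

text \<open>The compatibility of P with F says exactly that \<open>S\<close> intertwines F with its
  transpose \<open>C\<close>; \<open>B_F\<close> is the counterpart for \<theta>.\<close>

lemma S_C: assumes a: "\<alpha> \<in> Ts p" shows "S p (C p \<alpha>) = F p (S p \<alpha>)"
proof (rule cot_separates[of _ p])
  note ca = cov_comp_cot[OF endo_F a]
  show "S p (C p \<alpha>) \<in> T p" by (rule S_T[OF ca])
  show "F p (S p \<alpha>) \<in> T p" by (rule F_T[OF S_T[OF a]])
  fix \<beta> assume b: "\<beta> \<in> Ts p"
  have "\<beta> (S p (C p \<alpha>)) = P p \<alpha> (C p \<beta>)" unfolding S_apply[OF ca b] by (rule PF[OF a b])
  also have "\<dots> = C p \<beta> (S p \<alpha>)" by (rule S_apply[OF a cov_comp_cot[OF endo_F b], symmetric])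
  also have "\<dots> = \<beta> (F p (S p \<alpha>))" by (rule cov_comp_apply[OF S_T[OF a]])
  finally show "\<beta> (S p (C p \<alpha>)) = \<beta> (F p (S p \<alpha>))" .
qed

lemma xi_S: "a \<in> I \<Longrightarrow> \<alpha> \<in> Ts p \<Longrightarrow> \<xi> a p (S p \<alpha>) = 0"
  using S_apply[of \<alpha> p "\<xi> a p"] P_skew[of \<alpha> p "\<xi> a p"] Pxi[of a \<alpha> p] form_xi[of a] by simp

lemma B_cot: "v \<in> T p \<Longrightarrow> B p v \<in> Ts p"
  by (rule flat_cot[OF two_form_theta])

lemma B_add: assumes v: "v \<in> T p" "w \<in> T p" shows "B p (v + w) = B p v + B p w"
proof (rule cot_eqI[of _ p])
  show "B p (v + w) \<in> Ts p" "B p v + B p w \<in> Ts p" using v B_cot by blast+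
  fix x assume x: "x \<in> T p"
  show "B p (v + w) x = (B p v + B p w) x" using theta_add[OF v(1) x v(2)] x by simp
qed

lemma B_scale: assumes v: "v \<in> T p" shows "B p (c *\<^sub>R v) = c *\<^sub>R B p v"
proof (rule cot_eqI[of _ p])
  show "B p (c *\<^sub>R v) \<in> Ts p" "c *\<^sub>R B p v \<in> Ts p" using v B_cot by blast+
  fix x assume x: "x \<in> T p"
  show "B p (c *\<^sub>R v) x = (c *\<^sub>R B p v) x" using theta_scale[OF v x] x by (simp add: scaleR_fun_apply)
qed

lemma B_zero: "B p 0 = 0"
  using B_scale[of 0 p 0] by simp

lemma B_minus: "v \<in> T p \<Longrightarrow> B p (- v) = - B p v"
  using B_scale[of v p "-1"] by simp

lemma B_F: assumes v: "v \<in> T p" shows "B p (F p v) = C p (B p v)"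
proof (rule cot_eqI[of _ p])
  show "B p (F p v) \<in> Ts p" by (rule B_cot[OF F_T[OF v]])
  show "C p (B p v) \<in> Ts p" by (rule cov_comp_cot[OF endo_F B_cot[OF v]])
  fix w assume w: "w \<in> T p"
  show "B p (F p v) w = C p (B p v) w" using theta_F[OF v w] w F_T by simp
qed

lemma B_Z: "a \<in> I \<Longrightarrow> B p (Z a p) = 0"
  by (rule cot_eqI[of _ p]) (simp_all add: B_cot vfield_Z theta_Z)

lemma B_at_Z: "a \<in> I \<Longrightarrow> v \<in> T p \<Longrightarrow> B p v (Z a p) = 0"
  using theta_skew[of v p "Z a p"] theta_Z[of a v p] vfield_Z[of a] by simp

lemma C_zero: "C p 0 = 0"
  by (rule cot_eqI[of _ p]) (simp_all add: cov_comp_cot[OF endo_F])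

lemma C_diff: "\<alpha> \<in> Ts p \<Longrightarrow> \<beta> \<in> Ts p \<Longrightarrow> C p (\<alpha> - \<beta>) = C p \<alpha> - C p \<beta>"
  by (rule cot_eqI[of _ p]) (simp_all add: cov_comp_cot[OF endo_F] cot_closed_diff)

lemma C_at_Z: "a \<in> I \<Longrightarrow> \<alpha> \<in> Ts p \<Longrightarrow> C p \<alpha> (Z a p) = 0"
  by (simp add: vfield_Z FZ cot_zero)

text \<open>The transpose of the axiom for F^2. Transposition reverses the order of \<open>S\<close>
  and \<open>B\<close>, and the two sign changes from the skewness of P and \<theta> cancel.\<close>

lemma CC:
  assumes a: "\<alpha> \<in> Ts p"
  shows "C p (C p \<alpha>) = - \<alpha> - B p (S p \<alpha>) + (\<Sum>a\<in>I. \<alpha> (Z a p) *\<^sub>R \<xi> a p)"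
proof (rule cot_eqI[of _ p])
  note s = S_T[OF a]
  show "C p (C p \<alpha>) \<in> Ts p" by (intro cov_comp_cot endo_F a)
  have "(\<Sum>a\<in>I. \<alpha> (Z a p) *\<^sub>R \<xi> a p) \<in> Ts p" using form_xi by (intro cot_closed_sum cot_closed form_Ts)
  then show "- \<alpha> - B p (S p \<alpha>) + (\<Sum>a\<in>I. \<alpha> (Z a p) *\<^sub>R \<xi> a p) \<in> Ts p"
    by (intro cot_closed cot_closed_diff cot_closed_minus a B_cot s)
  fix w assume w: "w \<in> T p"
  note b = B_cot[OF w]
  have sm: "(\<Sum>a\<in>I. \<xi> a p w *\<^sub>R Z a p) \<in> T p" using vfield_Z by (intro tangent_sum tangent_scale vfield_T)
  have "C p (C p \<alpha>) w = \<alpha> (F p (F p w))" using w F_T by simp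
  also have "\<dots> = \<alpha> ((- w - S p (B p w)) + (\<Sum>a\<in>I. \<xi> a p w *\<^sub>R Z a p))" by (simp only: F2[OF w])
  also have "\<dots> = \<alpha> (- w - S p (B p w)) + \<alpha> (\<Sum>a\<in>I. \<xi> a p w *\<^sub>R Z a p)"
    using w S_T[OF b] sm by (intro cot_add[OF a] tangent_diff tangent_minus)
  also have "\<alpha> (- w - S p (B p w)) = - \<alpha> w - \<alpha> (S p (B p w))"
    using cot_diff[OF a tangent_minus[OF w] S_T[OF b]] cot_minus[OF a w] by simp
  also have "\<alpha> (\<Sum>a\<in>I. \<xi> a p w *\<^sub>R Z a p) = (\<Sum>a\<in>I. \<xi> a p w * \<alpha> (Z a p))"
    using vfield_Z by (subst cot_sum[OF a]) (auto intro!: tangent_scale sum.cong simp: cot_scale[OF a])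
  also have "\<alpha> (S p (B p w)) = B p (S p \<alpha>) w"
  proof -
    have "\<alpha> (S p (B p w)) = P p (B p w) \<alpha>" by (rule S_apply[OF b a])
    also have "\<dots> = - P p \<alpha> (B p w)" by (rule P_skew[OF b a])
    also have "P p \<alpha> (B p w) = B p w (S p \<alpha>)" by (rule S_apply[OF a b, symmetric])
    also have "- \<dots> = B p (S p \<alpha>) w" using theta_skew[OF w s] w s by simp
    finally show ?thesis .
  qed
  finally show "C p (C p \<alpha>) w = (- \<alpha> - B p (S p \<alpha>) + (\<Sum>a\<in>I. \<alpha> (Z a p) *\<^sub>R \<xi> a p)) w"
    by (simp add: sum_fun_apply scaleR_fun_apply mult.commute)
qed

section \<open>Real sections and the torsion identity\<close>

definition sec where
  "sec X u \<alpha> v = (\<lambda>p. ((X p, \<lambda>a::nat. u a p), (\<alpha> p, \<lambda>a::nat. v a p)))"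
  for X :: "'m \<Rightarrow> 'm tvec" and \<alpha> :: "'m \<Rightarrow> 'm covec" and u v :: "nat \<Rightarrow> 'm \<Rightarrow> real"

abbreviation zeros :: "nat \<Rightarrow> 'm \<Rightarrow> real" where "zeros \<equiv> (\<lambda>a p. 0)"

text \<open>Tangent and cotangent components of \<open>Phi\<close> on sections whose R^h parts are
  0. For these the sums over Z and \<xi> drop out, so \<open>Phi_vec\<close> and
  \<open>Phi_cov\<close> already have the shape of the endomorphism expected on N.\<close>

definition Phi_vec :: "('m \<Rightarrow> 'm tvec) \<Rightarrow> ('m \<Rightarrow> 'm covec) \<Rightarrow> 'm \<Rightarrow> 'm tvec" where
  "Phi_vec X \<alpha> p = F p (X p) + S p (\<alpha> p)"
definition Phi_cov :: "('m \<Rightarrow> 'm tvec) \<Rightarrow> ('m \<Rightarrow> 'm covec) \<Rightarrow> 'm \<Rightarrow> 'm covec" where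
  "Phi_cov X \<alpha> p = B p (X p) - C p (\<alpha> p)"
definition at_Z :: "('m \<Rightarrow> 'm covec) \<Rightarrow> nat \<Rightarrow> 'm \<Rightarrow> real" where
  "at_Z \<alpha> a p = (if a \<in> I then \<alpha> p (Z a p) else 0)"
definition at_xi :: "('m \<Rightarrow> 'm tvec) \<Rightarrow> nat \<Rightarrow> 'm \<Rightarrow> real" where
  "at_xi X a p = (if a \<in> I then \<xi> a p (X p) else 0)"

abbreviation Phi where "Phi \<equiv> big_Phi M h P \<theta> F Z \<xi>"
abbreviation SB where "SB \<equiv> stable_courant_bracket M h"

lemma Phi_sec0: "Phi p (sec X zeros \<alpha> zeros p) = sec (Phi_vec X \<alpha>) (at_Z \<alpha>) (Phi_cov X \<alpha>) (at_xi X) p"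
  by (simp add: big_Phi_def sec_def Phi_vec_def Phi_cov_def at_Z_def at_xi_def)

lemma vfield_Phi_vec [intro]: "vfield X \<Longrightarrow> form \<alpha> \<Longrightarrow> vfield (Phi_vec X \<alpha>)"
  unfolding Phi_vec_def[abs_def] by (intro vfield_add endoD(4)[OF endo_F] vfield_sharp bivector_P)

lemma form_Phi_cov [intro]: "vfield X \<Longrightarrow> form \<alpha> \<Longrightarrow> form (Phi_cov X \<alpha>)"
  unfolding Phi_cov_def[abs_def] by (intro form_diff form_cov_comp endo_F form_flat two_form_theta)

lemma smooth_at_Z: "form \<alpha> \<Longrightarrow> sn p (at_Z \<alpha> a)"
  unfolding at_Z_def[abs_def] by (cases "a \<in> I") (simp_all add: form_sn vfield_Z del: atLeastAtMost_iff)

lemma smooth_at_xi: "vfield X \<Longrightarrow> sn p (at_xi X a)"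
  unfolding at_xi_def[abs_def] by (cases "a \<in> I") (simp_all add: form_sn form_xi del: atLeastAtMost_iff)

lemma sec_sections:
  assumes "vfield X" "form \<alpha>" "\<And>a p. sn p (u a)" "\<And>a p. sn p (v a)"
    "\<And>a p. a \<notin> I \<Longrightarrow> u a p = 0" "\<And>a p. a \<notin> I \<Longrightarrow> v a p = 0"
  shows "sec X u \<alpha> v \<in> big_sections M h"
proof -
  have "\<forall>a. a \<notin> I \<longrightarrow> u a = 0 \<and> v a = 0" using assms(5,6) by (simp add: fun_eq_iff)
  moreover have "\<forall>a\<in>I. smooth_fun_on M UNIV (u a) \<and> smooth_fun_on M UNIV (v a)"
    using assms(3,4) by (simp add: smooth_near_iff_on[OF open_UNIV])
  ultimately show ?thesis
    unfolding big_sections_def sec_def using assms(1,2) by blast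
qed

text \<open>That \<open>Phi\<close> squares to -Id is not among the axioms. On these sections it
  follows from the axiom for F^2 and its transpose \<open>CC\<close>; the mixed terms cancel by
  \<open>S_C\<close> and \<open>B_F\<close>, and the R^h slots vanish by the contraction
  axioms.\<close>

lemma Phi_Phi:
  assumes X: "vfield X" and a: "form \<alpha>"
  shows "Phi p (sec (Phi_vec X \<alpha>) (at_Z \<alpha>) (Phi_cov X \<alpha>) (at_xi X) p) = - sec X zeros \<alpha> zeros p"
proof -
  note XT = vfield_T[OF X, of p] and aT = form_Ts[OF a, of p]
  have sumZ: "(\<Sum>a\<in>I. at_xi X a p *\<^sub>R Z a p) = (\<Sum>a\<in>I. \<xi> a p (X p) *\<^sub>R Z a p)"
    by (rule sum.cong) (simp_all add: at_xi_def)
  have sumxi: "(\<Sum>b\<in>I. at_Z \<alpha> b p *\<^sub>R \<xi> b p) = (\<Sum>b\<in>I. \<alpha> p (Z b p) *\<^sub>R \<xi> b p)"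
    by (rule sum.cong) (simp_all add: at_Z_def)
  have "F p (Phi_vec X \<alpha> p) = F p (F p (X p)) + F p (S p (\<alpha> p))"
    unfolding Phi_vec_def by (rule F_add[OF F_T[OF XT] S_T[OF aT]])
  moreover have "S p (Phi_cov X \<alpha> p) = S p (B p (X p)) - S p (C p (\<alpha> p))"
    unfolding Phi_cov_def by (rule S_diff[OF B_cot[OF XT] cov_comp_cot[OF endo_F aT]])
  ultimately have 1: "F p (Phi_vec X \<alpha> p) + S p (Phi_cov X \<alpha> p) - (\<Sum>a\<in>I. at_xi X a p *\<^sub>R Z a p) = - X p"
    unfolding sumZ F2[OF XT] S_C[OF aT] by simp
  have 2: "Phi_cov X \<alpha> p (Z a p) = 0" if "a \<in> I" for a
    using B_at_Z[OF that XT] C_at_Z[OF that aT] by (simp add: Phi_cov_def)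
  have "B p (Phi_vec X \<alpha> p) = B p (F p (X p)) + B p (S p (\<alpha> p))"
    unfolding Phi_vec_def by (rule B_add[OF F_T[OF XT] S_T[OF aT]])
  moreover have "C p (Phi_cov X \<alpha> p) = C p (B p (X p)) - C p (C p (\<alpha> p))"
    unfolding Phi_cov_def by (rule C_diff[OF B_cot[OF XT] cov_comp_cot[OF endo_F aT]])
  ultimately have 3: "B p (Phi_vec X \<alpha> p) - (\<Sum>b\<in>I. at_Z \<alpha> b p *\<^sub>R \<xi> b p) - C p (Phi_cov X \<alpha> p) = - \<alpha> p"
    unfolding sumxi B_F[OF XT] CC[OF aT] by simp
  have 4: "\<xi> a p (Phi_vec X \<alpha> p) = 0" if "a \<in> I" for a
    unfolding Phi_vec_def cot_add[OF form_Ts[OF form_xi[OF that]] F_T[OF XT] S_T[OF aT]]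
    using xiF[OF that XT] xi_S[OF that aT] by simp
  have z: "(\<lambda>a. if a \<in> I then Phi_cov X \<alpha> p (Z a p) else 0) = - (\<lambda>a. 0)"
    "(\<lambda>a. if a \<in> I then \<xi> a p (Phi_vec X \<alpha> p) else 0) = - (\<lambda>a. 0)"
    using 2 4 by (auto simp: fun_eq_iff)
  show ?thesis
    unfolding sec_def big_Phi_def prod.case 1 3 z uminus_prod_def by simp
qed

text \<open>Real and imaginary parts of the eigenvalue equation for the bracket of two
  eigensections. The second equation is the vanishing of the torsion, the first its image under
  \<open>Phi\<close>. The first will yield the invariance along Z, the second the torsion identity
  on N.\<close>

lemma star:
  assumes X1: "vfield X1" and a1: "form \<alpha>1" and X2: "vfield X2" and a2: "form \<alpha>2"
  defines "s \<equiv> sec X1 zeros \<alpha>1 zeros" and "t \<equiv> sec X2 zeros \<alpha>2 zeros"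
    and "s' \<equiv> sec (Phi_vec X1 \<alpha>1) (at_Z \<alpha>1) (Phi_cov X1 \<alpha>1) (at_xi X1)"
    and "t' \<equiv> sec (Phi_vec X2 \<alpha>2) (at_Z \<alpha>2) (Phi_cov X2 \<alpha>2) (at_xi X2)"
  shows "Phi p (SB s' t' p - SB s t p) = - (SB s' t p + SB s t' p)"
    and "Phi p (SB s' t p + SB s t' p) = SB s' t' p - SB s t p"
proof -
  have mem: "(sec (Phi_vec X \<alpha>) (at_Z \<alpha>) (Phi_cov X \<alpha>) (at_xi X), sec X zeros \<alpha> zeros) \<in> eigen_sections (big_sections M h) Phi"
    if "vfield X" "form \<alpha>" for X \<alpha>
  proof -
    have "sec (Phi_vec X \<alpha>) (at_Z \<alpha>) (Phi_cov X \<alpha>) (at_xi X) \<in> big_sections M h"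
      using that by (intro sec_sections smooth_at_Z smooth_at_xi vfield_Phi_vec form_Phi_cov) (auto simp: at_Z_def at_xi_def)
    moreover have "sec X zeros \<alpha> zeros \<in> big_sections M h"
      using that by (intro sec_sections) auto
    ultimately show ?thesis
      using Phi_Phi[OF that] Phi_sec0 unfolding eigen_sections_def by simp
  qed
  have "complex_bracket SB (s', s) (t', t) \<in> eigen_sections (big_sections M h) Phi"
    using closed mem[OF X1 a1] mem[OF X2 a2] unfolding eigenbundle_closed_def s_def t_def s'_def t'_def by blast
  then show "Phi p (SB s' t' p - SB s t p) = - (SB s' t p + SB s t' p)"
    "Phi p (SB s' t p + SB s t' p) = SB s' t' p - SB s t p"
    unfolding eigen_sections_def complex_bracket_def by (simp_all add: add.commute)
qed

definition stable_cov where
  "stable_cov X1 u1 \<alpha>1 v1 X2 u2 \<alpha>2 v2 p =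
     lie_form M X1 \<alpha>2 p - lie_form M X2 \<alpha>1 p
            + (1/2) *\<^sub>R ext_d M (\<lambda>x. \<alpha>1 x (X2 x) - \<alpha>2 x (X1 x)) p
            + (1/2) *\<^sub>R (\<Sum>a\<in>I. u2 a p *\<^sub>R ext_d M (v1 a) p + v2 a p *\<^sub>R ext_d M (u1 a) p
                                   - u1 a p *\<^sub>R ext_d M (v2 a) p - v1 a p *\<^sub>R ext_d M (u2 a) p)"
  for X1 X2 :: "'m \<Rightarrow> 'm tvec" and \<alpha>1 \<alpha>2 :: "'m \<Rightarrow> 'm covec" and u1 v1 u2 v2 :: "nat \<Rightarrow> 'm \<Rightarrow> real"

lemma SB_sec: "SB (sec X1 u1 \<alpha>1 v1) (sec X2 u2 \<alpha>2 v2) p =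
   ((bracket X1 X2 p, \<lambda>a. X1 p (u2 a) - X2 p (u1 a)),
    (stable_cov X1 u1 \<alpha>1 v1 X2 u2 \<alpha>2 v2 p, \<lambda>a. X1 p (v2 a) - X2 p (v1 a)))"
  unfolding stable_courant_bracket_def sec_def stable_cov_def by (simp add: Let_def)

lemma Phi_tuple: "Phi p ((X, u), (\<alpha>, v)) =
     ((F p X + S p \<alpha> - (\<Sum>a\<in>I. v a *\<^sub>R Z a p),
       \<lambda>a. if a \<in> I then \<alpha> (Z a p) else 0),
      (B p X - (\<Sum>a\<in>I. u a *\<^sub>R \<xi> a p) - C p \<alpha>,
       \<lambda>a. if a \<in> I then \<xi> a p X else 0))"
  by (simp add: big_Phi_def)

text \<open>Slotwise reading of \<open>star\<close>: tangent, cotangent and \<xi> slot of the first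
  equation, then tangent and cotangent slot of the second. \<open>R3\<close> and \<open>I3\<close>
  are the cotangent parts of the real and the imaginary part of the bracket.\<close>

lemma star_R:
  assumes X1: "vfield X1" and a1: "form \<alpha>1" and X2: "vfield X2" and a2: "form \<alpha>2"
  defines "X1' \<equiv> Phi_vec X1 \<alpha>1" and "X2' \<equiv> Phi_vec X2 \<alpha>2"
    and "R3 \<equiv> (\<lambda>p. stable_cov (Phi_vec X1 \<alpha>1) (at_Z \<alpha>1) (Phi_cov X1 \<alpha>1) (at_xi X1) (Phi_vec X2 \<alpha>2) (at_Z \<alpha>2) (Phi_cov X2 \<alpha>2) (at_xi X2) p
        - stable_cov X1 zeros \<alpha>1 zeros X2 zeros \<alpha>2 zeros p)"
    and "I3 \<equiv> (\<lambda>p. stable_cov (Phi_vec X1 \<alpha>1) (at_Z \<alpha>1) (Phi_cov X1 \<alpha>1) (at_xi X1) X2 zeros \<alpha>2 zeros p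
        + stable_cov X1 zeros \<alpha>1 zeros (Phi_vec X2 \<alpha>2) (at_Z \<alpha>2) (Phi_cov X2 \<alpha>2) (at_xi X2) p)"
  shows "F p (bracket X1' X2' p - bracket X1 X2 p) + S p (R3 p)
      - (\<Sum>a\<in>I. (X1' p (at_xi X2 a) - X2' p (at_xi X1 a)) *\<^sub>R Z a p) = - (bracket X1' X2 p + bracket X1 X2' p)" (is ?R1)
    and "B p (bracket X1' X2' p - bracket X1 X2 p)
      - (\<Sum>a\<in>I. (X1' p (at_Z \<alpha>2 a) - X2' p (at_Z \<alpha>1 a)) *\<^sub>R \<xi> a p) - C p (R3 p) = - I3 p" (is ?R3)
    and "a \<in> I \<Longrightarrow> \<xi> a p (bracket X1' X2' p - bracket X1 X2 p) = X2 p (at_xi X1 a) - X1 p (at_xi X2 a)"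
    and "F p (bracket X1' X2 p + bracket X1 X2' p) + S p (I3 p)
      - (\<Sum>a\<in>I. (X1 p (at_xi X2 a) - X2 p (at_xi X1 a)) *\<^sub>R Z a p) = bracket X1' X2' p - bracket X1 X2 p" (is ?I1)
    and "B p (bracket X1' X2 p + bracket X1 X2' p)
      - (\<Sum>a\<in>I. (X1 p (at_Z \<alpha>2 a) - X2 p (at_Z \<alpha>1 a)) *\<^sub>R \<xi> a p) - C p (I3 p) = R3 p" (is ?I3)
proof -
  note X1' = vfield_Phi_vec[OF X1 a1] and X2' = vfield_Phi_vec[OF X2 a2]
  note st = star[OF assms(1-4), of p, unfolded SB_sec]
  have z: "(\<lambda>a::nat. X1 p (\<lambda>p. 0) - X2 p (\<lambda>p. 0)) = (\<lambda>a. 0)"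
     "(\<lambda>a::nat. X1' p (\<lambda>p. 0) - X2 p (at_Z \<alpha>1 a)) = (\<lambda>a. - X2 p (at_Z \<alpha>1 a))"
     "(\<lambda>a::nat. X1 p (at_Z \<alpha>2 a) - X2' p (\<lambda>p. 0)) = (\<lambda>a. X1 p (at_Z \<alpha>2 a))"
     "(\<lambda>a::nat. X1' p (\<lambda>p. 0) - X2 p (at_xi X1 a)) = (\<lambda>a. - X2 p (at_xi X1 a))"
     "(\<lambda>a::nat. X1 p (at_xi X2 a) - X2' p (\<lambda>p. 0)) = (\<lambda>a. X1 p (at_xi X2 a))"
    using X1 X2 X1' X2' by (simp_all add: X1'_def X2'_def)
  note st' = st[folded X1'_def X2'_def, unfolded z diff_Pair add_Pair uminus_Pair Phi_tuple prod.inject, folded R3_def I3_def]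
  show ?R1 ?R3 ?I1 ?I3 using st' by (simp_all add: R3_def I3_def X1'_def X2'_def)
  show "a \<in> I \<Longrightarrow> \<xi> a p (bracket X1' X2' p - bracket X1 X2 p) = X2 p (at_xi X1 a) - X1 p (at_xi X2 a)"
    using fun_cong[OF conjunct2[OF conjunct2[OF st'(1)]], of a] by simp
qed

section \<open>The torsion identity evaluated on Z\<close>

lemma at_Z_zero: "at_Z (\<lambda>p. 0) = zeros"
  by (simp add: at_Z_def fun_eq_iff)

lemma at_xi_zero: "at_xi (\<lambda>p. 0) = zeros"
  by (simp add: at_xi_def fun_eq_iff cot_zero[OF form_Ts[OF form_xi]] del: atLeastAtMost_iff)

lemma at_xi_Z: "a \<in> I \<Longrightarrow> at_xi (Z a) = (\<lambda>b p. if b = a then 1 else 0)"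
  by (auto simp: at_xi_def fun_eq_iff xiZ simp del: atLeastAtMost_iff)

lemma Phi_vec_Z: "a \<in> I \<Longrightarrow> Phi_vec (Z a) (\<lambda>p. 0) = (\<lambda>p. 0)"
  by (simp add: Phi_vec_def fun_eq_iff FZ S_zero)

lemma Phi_cov_Z: "a \<in> I \<Longrightarrow> Phi_cov (Z a) (\<lambda>p. 0) = (\<lambda>p. 0)"
  by (simp add: Phi_cov_def fun_eq_iff B_Z C_zero)

lemma Phi_vec_zero: "Phi_vec X (\<lambda>p. 0) = (\<lambda>p. F p (X p))" "Phi_vec (\<lambda>p. 0) \<alpha> = (\<lambda>p. S p (\<alpha> p))"
  by (simp_all add: Phi_vec_def fun_eq_iff F_zero S_zero)

lemma Phi_cov_zero: "Phi_cov X (\<lambda>p. 0) = (\<lambda>p. B p (X p))" "Phi_cov (\<lambda>p. 0) \<alpha> = (\<lambda>p. - C p (\<alpha> p))"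
  by (simp_all add: Phi_cov_def fun_eq_iff B_zero C_zero)

lemma vfield_F: "vfield X \<Longrightarrow> vfield (\<lambda>p. F p (X p))"
  by (rule endoD(4)[OF endo_F])

text \<open>The second section is \<open>(X, 0; 0, 0)\<close>. The \<open>Phi\<close>-image of the
  first has tangent part 0 and constant R^h part, so all terms that differentiate along it or
  differentiate its coefficients vanish, and each slot leaves one Lie derivative along Z.
  \<open>Z_xi\<close> says that the forms \<xi> are invariant too.\<close>

lemma
  assumes a: "a \<in> I" and X: "vfield X"
  shows Z_F: "bracket (Z a) (\<lambda>p. F p (X p)) p = F p (bracket (Z a) X p)"
    and Z_B: "lie_form M (Z a) (\<lambda>p. B p (X p)) p = B p (bracket (Z a) X p)"
    and Z_xi: "b \<in> I \<Longrightarrow> \<xi> b p (bracket (Z a) X p) = Z a p (at_xi X b)"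
proof -
  note Za = vfield_Z[OF a] and FX = vfield_F[OF X] and BX = form_flat[OF two_form_theta X]
  have R: "stable_cov (\<lambda>p. 0) zeros (\<lambda>p. 0) (\<lambda>b p. if b = a then 1 else 0) (\<lambda>p. F p (X p)) zeros (\<lambda>p. B p (X p)) (at_xi X) p
        - stable_cov (Z a) zeros (\<lambda>p. 0) zeros X zeros (\<lambda>p. 0) zeros p = 0"
    unfolding stable_cov_def by (simp add: Za FX BX X cot_zero[OF form_Ts[OF BX]])
  \<comment> \<open>The only contraction term is the differential of
    \<open>B p (X p) (Z a p)\<close>, which is 0 because \<theta> annihilates Z.\<close>
  have J: "stable_cov (\<lambda>p. 0) zeros (\<lambda>p. 0) (\<lambda>b p. if b = a then 1 else 0) X zeros (\<lambda>p. 0) zeros p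
        + stable_cov (Z a) zeros (\<lambda>p. 0) zeros (\<lambda>p. F p (X p)) zeros (\<lambda>p. B p (X p)) (at_xi X) p
       = lie_form M (Z a) (\<lambda>p. B p (X p)) p"
    unfolding stable_cov_def using B_at_Z[OF a vfield_T[OF X]] by (simp add: Za FX BX X)
  have wT: "bracket (Z a) X p \<in> T p" using Za X by blast
  note st = star_R[where p=p, OF Za form_zero X form_zero, unfolded Phi_vec_Z[OF a] Phi_cov_Z[OF a] at_xi_Z[OF a], unfolded at_Z_zero Phi_vec_zero Phi_cov_zero, unfolded R J]
  show "bracket (Z a) (\<lambda>p. F p (X p)) p = F p (bracket (Z a) X p)"
    using st(1) X Za FX wT by (simp add: S_zero F_minus tv_const[OF vfield_T[OF FX]])
  show "lie_form M (Z a) (\<lambda>p. B p (X p)) p = B p (bracket (Z a) X p)"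
    using st(2) X Za FX wT by (simp add: C_zero B_minus tv_const[OF vfield_T[OF FX]])
  show "b \<in> I \<Longrightarrow> \<xi> b p (bracket (Z a) X p) = Z a p (at_xi X b)"
    using st(3)[of b] X Za FX wT cot_minus[OF form_Ts[OF form_xi] wT, of b] by (simp del: atLeastAtMost_iff)
qed

text \<open>The second section is \<open>(0, 0; \<alpha>, 0)\<close>, and the R^h terms of the
  stable bracket become essential: \<open>- (1/2) d(\<alpha>(Z a))\<close> arises twice, from the
  R^h part of the bracket of the images and from the contraction in the bracket of the original
  sections. The difference leaves only the Lie derivative.\<close>

lemma Z_S:
  assumes a: "a \<in> I" and al: "form \<alpha>"
  shows "bracket (Z a) (\<lambda>p. S p (\<alpha> p)) p = S p (lie_form M (Z a) \<alpha> p)"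
proof -
  note Za = vfield_Z[OF a] and SX = vfield_sharp[OF bivector_P al] and CX = form_minus[OF form_cov_comp[OF endo_F al]]
  have s: "(\<Sum>b\<in>I. at_Z \<alpha> b p *\<^sub>R ext_d M (\<lambda>p. if b = a then 1 else 0) p + at_xi (\<lambda>p. 0) b p *\<^sub>R ext_d M (\<lambda>p. 0) p
     - 0 *\<^sub>R ext_d M (at_xi (\<lambda>p. 0) b) p - (if b = a then 1 else 0) *\<^sub>R ext_d M (at_Z \<alpha> b) p) = - ext_d M (at_Z \<alpha> a) p"
  proof -
    have "(\<Sum>b\<in>I. at_Z \<alpha> b p *\<^sub>R ext_d M (\<lambda>p. if b = a then 1 else 0) p + at_xi (\<lambda>p. 0) b p *\<^sub>R ext_d M (\<lambda>p. 0) p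
     - 0 *\<^sub>R ext_d M (at_xi (\<lambda>p. 0) b) p - (if b = a then 1 else 0) *\<^sub>R ext_d M (at_Z \<alpha> b) p) =
      (\<Sum>b\<in>I. if b = a then - ext_d M (at_Z \<alpha> b) p else 0)"
      by (rule sum.cong[OF refl]) (simp add: at_xi_zero)
    then show ?thesis using a by simp
  qed
  have R1: "stable_cov (\<lambda>p. 0) zeros (\<lambda>p. 0) (\<lambda>b p. if b = a then 1 else 0) (\<lambda>p. S p (\<alpha> p)) (at_Z \<alpha>) (\<lambda>p. - C p (\<alpha> p)) (at_xi (\<lambda>p. 0)) p
      = - ((1/2) *\<^sub>R ext_d M (at_Z \<alpha> a) p)"
    unfolding stable_cov_def s by (simp add: SX CX cot_zero[OF cov_comp_cot[OF endo_F form_Ts[OF al]]])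
  have "ext_d M (\<lambda>x. - \<alpha> x (Z a x)) p = - ext_d M (at_Z \<alpha> a) p"
    using al a by (intro cot_eqI[of _ p] cot_closed_minus ext_d_cot)
      (use a in \<open>simp add: at_Z_def[abs_def] tv_minus[OF _ form_sn[OF al Za]] del: atLeastAtMost_iff\<close>)
  then have R2: "stable_cov (Z a) zeros (\<lambda>p. 0) zeros (\<lambda>p. 0) zeros \<alpha> zeros p = lie_form M (Z a) \<alpha> p - (1/2) *\<^sub>R ext_d M (at_Z \<alpha> a) p"
    unfolding stable_cov_def by (simp add: Za al)
  have lT: "lie_form M (Z a) \<alpha> p \<in> Ts p" using Za al by (intro form_Ts form_lie_form)
  have R: "stable_cov (\<lambda>p. 0) zeros (\<lambda>p. 0) (\<lambda>b p. if b = a then 1 else 0) (\<lambda>p. S p (\<alpha> p)) (at_Z \<alpha>) (\<lambda>p. - C p (\<alpha> p)) (at_xi (\<lambda>p. 0)) p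
    - stable_cov (Z a) zeros (\<lambda>p. 0) zeros (\<lambda>p. 0) zeros \<alpha> zeros p = - lie_form M (Z a) \<alpha> p"
    unfolding R1 R2 by simp
  note st = star_R[where p=p, OF Za form_zero vfield_zero al, unfolded Phi_vec_Z[OF a] Phi_cov_Z[OF a] at_xi_Z[OF a], unfolded at_Z_zero Phi_vec_zero Phi_cov_zero, unfolded R]
  show ?thesis
    using st(1) Za SX by (simp add: S_minus[OF lT] F_zero at_xi_zero tv_const[OF vfield_T[OF SX]])
qed

text \<open>By invariance, F, \<open>B\<close> and all \<xi> annihilate the bracket, since their
  values on Z are constant; the axiom for F^2 then reads \<open>0 = - ?w\<close>.\<close>

lemma Z_commute:
  assumes a: "a \<in> I" and b: "b \<in> I"
  shows "bracket (Z a) (Z b) p = 0"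
proof -
  let ?w = "bracket (Z a) (Z b) p"
  have w: "?w \<in> T p" using vfield_Z a b by blast
  have "F p ?w = 0" using Z_F[OF a vfield_Z[OF b], of p] FZ[OF b] vfield_Z[OF a] by simp
  moreover have "B p ?w = 0" using Z_B[OF a vfield_Z[OF b], of p] B_Z[OF b] vfield_Z[OF a] by simp
  moreover have "\<xi> c p ?w = 0" if "c \<in> I" for c
    using Z_xi[OF a vfield_Z[OF b] that, of p] vfield_Z[OF a] by (simp add: at_xi_Z[OF b])
  ultimately show ?thesis using F2[OF w] by (simp add: F_zero S_zero del: atLeastAtMost_iff)
qed

text \<open>Pairing with the dual forms \<xi> extracts each coefficient. Injectivity is a separate
  claim because independence of the image set would not notice repeated members.\<close>

lemma Z_independent: "inj_on (\<lambda>a. Z a p) I \<and> independent ((\<lambda>a. Z a p) ` I)"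
proof -
  have inj: "inj_on (\<lambda>a. Z a p) I"
  proof (rule inj_onI)
    fix a b assume "a \<in> I" "b \<in> I" "Z a p = Z b p"
    then show "a = b" using xiZ[of a a p] xiZ[of a b p] by (auto split: if_splits)
  qed
  have "\<forall>v\<in>(\<lambda>a. Z a p) ` I. u v = 0" if u: "(\<Sum>v\<in>(\<lambda>a. Z a p) ` I. u v *\<^sub>R v) = 0" for u
  proof clarify
    fix b assume b: "b \<in> I"
    have "0 = \<xi> b p (\<Sum>a\<in>I. u (Z a p) *\<^sub>R Z a p)"
      unfolding u[unfolded sum.reindex[OF inj] o_def] by (rule cot_zero[OF form_Ts[OF form_xi[OF b]], symmetric])
    also have "\<dots> = (\<Sum>a\<in>I. u (Z a p) * \<xi> b p (Z a p))"
      using vfield_Z by (subst cot_sum[OF form_Ts[OF form_xi[OF b]]])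
        (auto intro!: tangent_scale sum.cong simp: cot_scale[OF form_Ts[OF form_xi[OF b]]])
    also have "\<dots> = (\<Sum>a\<in>I. if a = b then u (Z a p) else 0)"
      by (rule sum.cong[OF refl]) (use xiZ b in auto)
    also have "\<dots> = u (Z b p)" using b by simp
    finally show "u (Z b p) = 0" by simp
  qed
  note u0 = this
  have "independent ((\<lambda>a. Z a p) ` I)"
    unfolding dependent_finite[OF finite_imageI[OF finite_atLeastAtMost]]
  proof
    assume "\<exists>u. (\<exists>v\<in>(\<lambda>a. Z a p) ` I. u v \<noteq> 0) \<and> (\<Sum>v\<in>(\<lambda>a. Z a p) ` I. u v *\<^sub>R v) = 0"
    then obtain u v where "v \<in> (\<lambda>a. Z a p) ` I" "u v \<noteq> 0" "(\<Sum>v\<in>(\<lambda>a. Z a p) ` I. u v *\<^sub>R v) = 0" by blast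
    then show False using u0[of u] by blast
  qed
  then show ?thesis using inj by blast
qed

lemma F_span_Z:
  assumes "v \<in> span ((\<lambda>a. Z a p) ` I)"
  shows "v \<in> T p" "F p v = 0" "B p v = 0" "(\<And>a. a \<in> I \<Longrightarrow> Z a p f = 0) \<Longrightarrow> v f = 0"
proof -
  have "v \<in> T p \<and> F p v = 0 \<and> B p v = 0"
    using assms
  proof (induct rule: span_induct_alt)
    case base
    show ?case by (simp only: tangent_zero F_zero B_zero)
  next
    case (step c x y)
    then obtain a where a: "a \<in> I" "x = Z a p" by blast
    have x: "x \<in> T p" using vfield_Z[OF a(1)] a(2) by simp
    have "F p x = 0" "B p x = 0" using FZ[OF a(1)] B_Z[OF a(1)] a(2) by auto
    then show ?case
      using step(2) x tangent_scale[OF x, of c]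
      by (simp only: F_add[of "c *\<^sub>R x" p y] B_add[of "c *\<^sub>R x" p y] F_scale B_scale scaleR_zero_right
          add_0 tangent_add)
  qed
  then show "v \<in> T p" "F p v = 0" "B p v = 0" by auto
  show "v f = 0" if "\<And>a. a \<in> I \<Longrightarrow> Z a p f = 0"
    using assms by (induct rule: span_induct_alt) (use that in \<open>auto simp: scaleR_fun_apply\<close>)
qed

lemma Phi_Phi_components:
  assumes X: "vfield X" and a: "form \<alpha>"
  shows "F p (Phi_vec X \<alpha> p) + S p (Phi_cov X \<alpha> p) - (\<Sum>a\<in>I. at_xi X a p *\<^sub>R Z a p) = - X p"
    and "B p (Phi_vec X \<alpha> p) - (\<Sum>a\<in>I. at_Z \<alpha> a p *\<^sub>R \<xi> a p) - C p (Phi_cov X \<alpha> p) = - \<alpha> p"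
  using Phi_Phi[OF X a, of p] unfolding sec_def Phi_tuple uminus_Pair prod.inject by blast+

end


section \<open>Submersions\<close>

locale submersion = M: manifold M + N: manifold N
  for M :: "('m::{t2_space,second_countable_topology}, 'e::finite_dim_inner) atlas"
    and N :: "('n::{t2_space,second_countable_topology}, 'f::finite_dim_inner) atlas" +
  fixes U :: "'m set" and q :: "'m \<Rightarrow> 'n"
  assumes open_U: "open U" and q_smooth: "smooth_map_on M N U q" and q_surj: "q ` U = UNIV"
    and push_image: "p \<in> U \<Longrightarrow> push_vec N q p ` tangent_space M p = tangent_space N (q p)"
begin

abbreviation push where "push \<equiv> push_vec N q"
abbreviation pull where "pull \<equiv> pull_covec M N q"

section \<open>Push-forward and pull-back along q\<close>

lemma near_U: "p \<in> U \<Longrightarrow> \<forall>\<^sub>F r in nhds p. r \<in> U"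
  using open_U eventually_nhds_in_open by blast

lemma q_eventually:
  assumes "p \<in> U" "\<forall>\<^sub>F y in nhds (q p). Q y"
  shows "\<forall>\<^sub>F r in nhds p. Q (q r)"
proof -
  have "isCont q p" using q_smooth open_U assms(1) continuous_on_eq_continuous_at
    unfolding smooth_map_on_def by blast
  then have "filterlim q (nhds (q p)) (nhds p)"
    by (simp add: isCont_def tendsto_at_iff_tendsto_nhds)
  then show ?thesis using assms(2) by (auto simp: filterlim_iff)
qed

lemma q_chart:
  assumes c: "(A, \<phi>) \<in> M" and d: "(V, \<psi>) \<in> N"
  shows "open (A \<inter> U \<inter> q -` V)" "open (\<phi> ` (A \<inter> U \<inter> q -` V))"
    "cinf_on (\<phi> ` (A \<inter> U \<inter> q -` V)) (\<psi> \<circ> q \<circ> inv_into A \<phi>)"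
proof -
  have "open (U \<inter> q -` V)"
    using q_smooth open_U N.chart(1)[OF d] continuous_open_preimage unfolding smooth_map_on_def by blast
  then show "open (A \<inter> U \<inter> q -` V)" using M.chart(1)[OF c] by (auto simp: Int_assoc)
  then show "open (\<phi> ` (A \<inter> U \<inter> q -` V))"
    using M.open_chart_image[OF c, of "A \<inter> U \<inter> q -` V"] by (simp add: Int_assoc[symmetric])
  show "cinf_on (\<phi> ` (A \<inter> U \<inter> q -` V)) (\<psi> \<circ> q \<circ> inv_into A \<phi>)"
    using q_smooth c d unfolding smooth_map_on_def by fastforce
qed

lemma sn_pull:
  assumes p: "p \<in> U" and g: "N.sn (q p) g"
  shows "M.sn p (g \<circ> q)"
proof -
  obtain A \<phi> where c: "(A, \<phi>) \<in> M" "p \<in> A" by (rule M.ex_chart)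
  obtain V \<psi> where d: "(V, \<psi>) \<in> N" "q p \<in> V" by (rule N.ex_chart)
  obtain W where W: "open W" "q p \<in> W" "W \<subseteq> V" "cinf_on (\<psi> ` W) (g \<circ> inv_into V \<psi>)"
    by (rule N.sn_chartD[OF g d]) blast
  let ?A = "A \<inter> U \<inter> q -` W"
  have "open (U \<inter> q -` W)"
    using q_smooth open_U W(1) continuous_open_preimage unfolding smooth_map_on_def by blast
  then have oA: "open ?A" using M.chart(1)[OF c(1)] by (auto simp: Int_assoc)
  then have o: "open (\<phi> ` ?A)"
    using M.open_chart_image[OF c(1), of ?A] by (simp add: Int_assoc[symmetric])
  have "cinf_on (\<phi> ` ?A) ((g \<circ> inv_into V \<psi>) \<circ> (\<psi> \<circ> q \<circ> inv_into A \<phi>))"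
  proof (rule cinf_on_compose[OF o W(4)])
    show "cinf_on (\<phi> ` ?A) (\<psi> \<circ> q \<circ> inv_into A \<phi>)"
      by (rule cinf_on_subset[OF q_chart(3)[OF c(1) d(1)]]) (use W(3) in blast)
    show "(\<psi> \<circ> q \<circ> inv_into A \<phi>) ` \<phi> ` ?A \<subseteq> \<psi> ` W" using c by auto
  qed
  then have s: "cinf_on (\<phi> ` ?A) ((g \<circ> q) \<circ> inv_into A \<phi>)"
    by (rule cinf_on_cong[OF o, rotated]) (use c d W(3) in auto)
  show ?thesis by (rule M.sn_chartI[OF c(1) oA _ _ s]) (use p c W in auto)
qed

lemma push_T: "p \<in> U \<Longrightarrow> v \<in> M.T p \<Longrightarrow> push p v \<in> N.T (q p)"
  using push_image by blast

lemma push_lift: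
  assumes "p \<in> U" "w \<in> N.T (q p)"
  obtains v where "v \<in> M.T p" "push p v = w"
proof -
  have "w \<in> push p ` M.T p" using push_image[OF assms(1)] assms(2) by simp
  then show ?thesis by (rule imageE) (rule that, simp_all)
qed

lemma push_add: "push p (v + w) = push p v + push p w"
  by (simp add: push_vec_def fun_eq_iff)

lemma push_scale: "push p (c *\<^sub>R v) = c *\<^sub>R push p v"
  by (simp add: push_vec_def fun_eq_iff scaleR_fun_apply)

lemma push_minus: "push p (- v) = - push p v"
  by (simp add: push_vec_def fun_eq_iff)

lemma push_diff: "push p (v - w) = push p v - push p w"
  by (simp add: push_vec_def fun_eq_iff)

lemma push_apply: "N.sn (q p) g \<Longrightarrow> push p v g = v (g \<circ> q)"
  by (simp add: push_vec_def)

lemma pull_apply: "v \<in> M.T p \<Longrightarrow> pull p \<beta> v = \<beta> (push p v)"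
  by (simp add: pull_covec_def)

lemma pull_cot: "p \<in> U \<Longrightarrow> \<beta> \<in> N.Ts (q p) \<Longrightarrow> pull p \<beta> \<in> M.Ts p"
  unfolding pull_covec_def
  by (rule M.on_tangent_cot) (simp_all only: push_add push_scale N.cot_add N.cot_scale push_T)

text \<open>All tangent vectors of N at \<open>q p\<close> are push-forwards. Identities between
  covectors on N can therefore be tested after pulling back to M.\<close>

lemma pull_inj:
  assumes p: "p \<in> U" and b: "\<beta> \<in> N.Ts (q p)" "\<beta>' \<in> N.Ts (q p)" and e: "pull p \<beta> = pull p \<beta>'"
  shows "\<beta> = \<beta>'"
proof (rule N.cot_eqI[OF b])
  fix w assume "w \<in> N.T (q p)"
  then obtain v where v: "v \<in> M.T p" "push p v = w" by (rule push_lift[OF p])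
  then show "\<beta> w = \<beta>' w" using fun_cong[OF e, of v] by (simp add: pull_apply)
qed

lemma pull_add: "pull p (\<beta> + \<beta>') = pull p \<beta> + pull p \<beta>'"
  by (simp add: pull_covec_def on_tangent_def fun_eq_iff)

lemma pull_scale: "pull p (c *\<^sub>R \<beta>) = c *\<^sub>R pull p \<beta>"
  by (simp add: pull_covec_def on_tangent_def fun_eq_iff scaleR_fun_apply)

lemma pull_zero: "pull p 0 = 0"
  by (simp add: pull_covec_def on_tangent_def fun_eq_iff)

lemma pull_minus: "pull p (- \<beta>) = - pull p \<beta>"
  by (simp add: pull_covec_def on_tangent_def fun_eq_iff)

lemma pull_diff: "pull p (\<beta> - \<beta>') = pull p \<beta> - pull p \<beta>'"
  by (simp add: pull_covec_def on_tangent_def fun_eq_iff)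

lemma ext_d_pull:
  assumes "p \<in> U" "N.sn (q p) f"
  shows "ext_d M (f \<circ> q) p = pull p (ext_d N f (q p))"
proof (rule M.cot_eqI[of _ p])
  show "pull p (ext_d N f (q p)) \<in> M.Ts p" using pull_cot assms(1) by blast
  fix v assume v: "v \<in> M.T p"
  then show "ext_d M (f \<circ> q) p v = pull p (ext_d N f (q p)) v"
    using push_T[OF assms(1) v] assms(2) by (simp add: pull_apply push_apply)
qed simp

text \<open>Gaussian elimination over the ring of functions smooth near \<open>p\<close>.\<close>

lemma ex_lifted_frame_partial:
  assumes p: "p \<in> U" and G: "\<And>b. N.vfield (G b)" and ys: "\<And>b y. N.sn y (ys b)" and fr: "N.frame (q p) G ys"
    and S: "finite S" "S \<subseteq> onb"
  shows "\<exists>H. (\<forall>i. M.vfield (H i)) \<and>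
    (\<forall>\<^sub>F r in nhds p. \<forall>i\<in>S. \<forall>j\<in>S. H i r (ys j \<circ> q) = (if i = j then 1 else 0))"
  using S
proof (induct S rule: finite_induct)
  case empty
  show ?case by (intro exI[of _ "\<lambda>i r. 0"] conjI allI M.vfield_zero) simp
next
  case (insert k S)
  then obtain H where H: "\<And>i. M.vfield (H i)"
    and He: "\<forall>\<^sub>F r in nhds p. \<forall>i\<in>S. \<forall>j\<in>S. H i r (ys j \<circ> q) = (if i = j then 1 else 0)" by blast
  have k: "k \<in> onb" "k \<notin> S" "finite S" "S \<subseteq> onb" using insert by auto
  have yq: "M.sn p (ys j \<circ> q)" for j using sn_pull[OF p ys] .
  \<comment> \<open>A lift of \<open>G k\<close> at p takes the value 1 on
    \<open>ys k \<circ> q\<close> and 0 on the other coordinates. Subtracting multiples of the old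
    fields makes it 0 on the coordinates in S near p, and keeps the value 1 at p for k, hence an
    invertible function near p.\<close>
  obtain v where v: "v \<in> M.T p" "push p v = G k (q p)" by (rule push_lift[OF p N.vfield_T[OF G]])
  obtain X0 where X0: "M.vfield X0" "X0 p = v" by (rule M.ex_vf_through[OF v(1)]) blast
  have "\<exists>f. (\<forall>x. M.sn x f) \<and> (\<forall>\<^sub>F x in nhds p. f x = X0 x (ys j \<circ> q))" for j
    using M.ex_global_extension[OF M.vfield_sn[OF X0(1) yq[of j]]] by metis
  then obtain f where f: "\<And>j x. M.sn x (f j)" "\<And>j. \<forall>\<^sub>F x in nhds p. f j x = X0 x (ys j \<circ> q)" by metis
  define X1 where "X1 r = X0 r - (\<Sum>j\<in>S. f j r *\<^sub>R H j r)" for r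
  have X1: "M.vfield X1" unfolding X1_def[abs_def]
    by (intro M.vfield_diff X0(1) M.vfield_sum M.vfield_smult f H)
  have X1a: "X1 r g = X0 r g - (\<Sum>j\<in>S. f j r * H j r g)" for r g
    by (simp add: X1_def sum_fun_apply scaleR_fun_apply)
  have fe: "\<forall>\<^sub>F x in nhds p. \<forall>j\<in>S. f j x = X0 x (ys j \<circ> q)"
    using k(3) f(2) by (simp add: eventually_ball_finite)
  have X1S: "\<forall>\<^sub>F r in nhds p. \<forall>i\<in>S. X1 r (ys i \<circ> q) = 0"
    using fe He
  proof eventually_elim
    case (elim r)
    show ?case
    proof
      fix i assume i: "i \<in> S"
      have "(\<Sum>j\<in>S. f j r * H j r (ys i \<circ> q)) = (\<Sum>j\<in>S. if j = i then f j r else 0)"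
        by (rule sum.cong[OF refl]) (use elim i in auto)
      also have "\<dots> = f i r" using i k(3) by simp
      finally show "X1 r (ys i \<circ> q) = 0" using elim i by (simp add: X1a)
    qed
  qed
  have vy: "v (ys j \<circ> q) = (if k = j then 1 else 0)" if "j \<in> onb" for j
    using N.frame_dual[OF fr k(1) that] push_apply[OF ys, of p v j] v(2) by simp
  have d1: "X1 p (ys k \<circ> q) = 1"
  proof -
    have "f j p = 0" if j: "j \<in> S" for j
    proof -
      have "f j p = v (ys j \<circ> q)" using eventually_nhds_x_imp_x[OF f(2)] X0(2) by simp
      moreover have "k \<noteq> j" using j k by blast
      ultimately show ?thesis using vy[of j] j k(4) by auto
    qed
    then show ?thesis using vy[OF k(1)] X0(2) by (simp add: X1a)
  qed
  have dsn: "M.sn p (\<lambda>r. X1 r (ys k \<circ> q))" by (rule M.vfield_sn[OF X1 yq])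
  obtain e where e: "\<And>x. M.sn x e" "\<forall>\<^sub>F x in nhds p. e x = inverse (X1 x (ys k \<circ> q))"
    by (rule M.ex_global_extension[OF M.sn_inverse[OF dsn]]) (use d1 in auto)
  have dne: "\<forall>\<^sub>F x in nhds p. X1 x (ys k \<circ> q) \<noteq> 0"
    using M.sn_isCont[OF dsn] d1
    by (simp add: isCont_def tendsto_imp_eventually_ne eventually_nhds_conv_at)
  define X2 where "X2 r = e r *\<^sub>R X1 r" for r
  have X2: "M.vfield X2" unfolding X2_def[abs_def] by (intro M.vfield_smult e X1)
  have X2a: "X2 r g = e r * X1 r g" for r g by (simp add: X2_def scaleR_fun_apply)
  have X2e: "\<forall>\<^sub>F r in nhds p. X2 r (ys k \<circ> q) = 1 \<and> (\<forall>i\<in>S. X2 r (ys i \<circ> q) = 0)"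
    using e(2) dne X1S by eventually_elim (simp add: X2a)
  have "\<exists>g. (\<forall>x. M.sn x g) \<and> (\<forall>\<^sub>F x in nhds p. g x = H i x (ys k \<circ> q))" for i
    using M.ex_global_extension[OF M.vfield_sn[OF H yq[of k]]] by metis
  then obtain g where g: "\<And>i x. M.sn x (g i)" "\<And>i. \<forall>\<^sub>F x in nhds p. g i x = H i x (ys k \<circ> q)" by metis
  have ge: "\<forall>\<^sub>F x in nhds p. \<forall>i\<in>S. g i x = H i x (ys k \<circ> q)"
    using k(3) g(2) by (simp add: eventually_ball_finite)
  \<comment> \<open>Back substitution: removing the k-component from the old fields preserves their
    values on the coordinates in S, since \<open>X2\<close> vanishes on these near p.\<close>
  define H' where "H' i = (if i = k then X2 else (\<lambda>r. H i r - g i r *\<^sub>R X2 r))" for i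
  have "M.vfield (H' i)" for i
    unfolding H'_def using X2 H g by (auto intro!: M.vfield_diff M.vfield_smult)
  moreover have "\<forall>\<^sub>F r in nhds p. \<forall>i\<in>insert k S. \<forall>j\<in>insert k S. H' i r (ys j \<circ> q) = (if i = j then 1 else 0)"
    using ge X2e He
  proof eventually_elim
    case (elim r)
    then show ?case using k(2) by (auto simp: H'_def scaleR_fun_apply)
  qed
  ultimately show ?case by blast
qed

section \<open>Lifts of fields and forms\<close>

definition related where
  "related p X' X \<longleftrightarrow> M.vfield X' \<and> N.vfield X \<and> (\<forall>\<^sub>F r in nhds p. push r (X' r) = X (q r))"

definition related_form where
  "related_form p \<alpha>' \<alpha> \<longleftrightarrow> M.form \<alpha>' \<and> N.form \<alpha> \<and> (\<forall>\<^sub>F r in nhds p. \<alpha>' r = pull r (\<alpha> (q r)))"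

text \<open>Any global field through v is corrected by the lifted coordinate fields, with the
  coordinate defects as coefficients. The defects vanish at p, so the prescribed value v
  survives.\<close>

lemma ex_related:
  assumes p: "p \<in> U" and X: "N.vfield X" and v: "v \<in> M.T p" "push p v = X (q p)"
  obtains X' where "related p X' X" "X' p = v"
proof -
  obtain G ys where G: "\<And>b. N.vfield (G b)" and ys: "\<And>b y. N.sn y (ys b)"
    and fr: "\<forall>\<^sub>F y in nhds (q p). N.frame y G ys" by (rule N.ex_frame[of "q p"]) blast
  have frq: "\<forall>\<^sub>F r in nhds p. N.frame (q r) G ys" by (rule q_eventually[OF p fr])
  obtain H where H: "\<And>i. M.vfield (H i)"
    and He: "\<forall>\<^sub>F r in nhds p. \<forall>i\<in>onb. \<forall>j\<in>onb. H i r (ys j \<circ> q) = (if i = j then 1 else 0)"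
    using ex_lifted_frame_partial[OF p G ys eventually_nhds_x_imp_x[OF fr] finite_onb order_refl] by blast
  have yq: "M.sn p (ys j \<circ> q)" for j using sn_pull[OF p ys] .
  obtain V where V: "M.vfield V" "V p = v" by (rule M.ex_vf_through[OF v(1)]) blast
  have "\<exists>c. (\<forall>x. M.sn x c) \<and> (\<forall>\<^sub>F x in nhds p. c x = V x (ys i \<circ> q) - X (q x) (ys i))" for i
  proof -
    have "M.sn p ((\<lambda>y. X y (ys i)) \<circ> q)" by (rule sn_pull[OF p N.vfield_sn[OF X ys]])
    then have "M.sn p (\<lambda>x. V x (ys i \<circ> q) - X (q x) (ys i))"
      using M.sn_diff[OF M.vfield_sn[OF V(1) yq[of i]]] by (simp add: o_def)
    from M.ex_global_extension[OF this] show ?thesis by metis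
  qed
  then obtain c where c: "\<And>i x. M.sn x (c i)"
    "\<And>i. \<forall>\<^sub>F x in nhds p. c i x = V x (ys i \<circ> q) - X (q x) (ys i)" by metis
  define X' where "X' r = V r - (\<Sum>i\<in>onb. c i r *\<^sub>R H i r)" for r
  have vfield: "M.vfield X'" unfolding X'_def[abs_def] by (intro M.vfield_diff V M.vfield_sum M.vfield_smult c H)
  have X'a: "X' r g = V r g - (\<Sum>i\<in>onb. c i r * H i r g)" for r g
    by (simp add: X'_def sum_fun_apply scaleR_fun_apply)
  have ce: "\<forall>\<^sub>F x in nhds p. \<forall>i\<in>onb. c i x = V x (ys i \<circ> q) - X (q x) (ys i)"
    using c(2) by (simp add: eventually_ball_finite)
  have "\<forall>\<^sub>F r in nhds p. push r (X' r) = X (q r)"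
    using ce He frq near_U[OF p]
  proof eventually_elim
    case (elim r)
    have e: "push r (X' r) (ys j) = X (q r) (ys j)" if j: "j \<in> onb" for j
    proof -
      have "(\<Sum>i\<in>onb. c i r * H i r (ys j \<circ> q)) = (\<Sum>i\<in>onb. if i = j then c i r else 0)"
        by (rule sum.cong[OF refl]) (use elim j in auto)
      also have "\<dots> = c j r" using j by simp
      finally show ?thesis using elim(1) j push_apply[OF ys] by (simp add: X'a)
    qed
    have "push r (X' r) = (\<Sum>b\<in>onb. push r (X' r) (ys b) *\<^sub>R G b (q r))"
      by (rule N.frame_tv[OF elim(3) push_T[OF elim(4) M.vfield_T[OF vfield]]])
    also have "\<dots> = (\<Sum>b\<in>onb. X (q r) (ys b) *\<^sub>R G b (q r))"
      by (rule sum.cong[OF refl]) (simp only: e)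
    also have "\<dots> = X (q r)" by (rule N.frame_tv[OF elim(3) N.vfield_T[OF X], symmetric])
    finally show ?case .
  qed
  moreover have "X' p = v"
  proof -
    have "c i p = 0" for i
      using eventually_nhds_x_imp_x[OF c(2)[of i]] V(2) push_apply[OF ys, of p v i] v(2) by simp
    then show ?thesis by (simp add: X'_def V(2))
  qed
  ultimately show ?thesis using that vfield X by (simp add: related_def)
qed

lemma ex_related_any:
  assumes p: "p \<in> U" and X: "N.vfield X"
  obtains X' where "related p X' X"
proof -
  obtain v where "v \<in> M.T p" "push p v = X (q p)" by (rule push_lift[OF p N.vfield_T[OF X]])
  then show ?thesis using ex_related[OF p X] that by metis
qed

text \<open>The pulled back form makes sense only on U. Near p it is a sum of coefficients times
  coordinate differentials, and each coefficient and each coordinate function is extended globally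
  before the sum is formed.\<close>

lemma ex_related_form:
  assumes p: "p \<in> U" and a: "N.form \<alpha>"
  obtains \<alpha>' where "related_form p \<alpha>' \<alpha>"
proof -
  obtain G ys where G: "\<And>b. N.vfield (G b)" and ys: "\<And>b y. N.sn y (ys b)"
    and fr: "\<forall>\<^sub>F y in nhds (q p). N.frame y G ys" by (rule N.ex_frame[of "q p"]) blast
  have frq: "\<forall>\<^sub>F r in nhds p. N.frame (q r) G ys" by (rule q_eventually[OF p fr])
  have "\<exists>c. (\<forall>x. M.sn x c) \<and> (\<forall>\<^sub>F x in nhds p. c x = \<alpha> (q x) (G i (q x)))" for i
  proof -
    have "M.sn p ((\<lambda>y. \<alpha> y (G i y)) \<circ> q)" by (rule sn_pull[OF p N.form_sn[OF a G]])
    from M.ex_global_extension[OF this] show ?thesis by (simp add: o_def) metis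
  qed
  then obtain c where c: "\<And>i x. M.sn x (c i)" "\<And>i. \<forall>\<^sub>F x in nhds p. c i x = \<alpha> (q x) (G i (q x))" by metis
  have "\<exists>z. (\<forall>x. M.sn x z) \<and> (\<forall>\<^sub>F x in nhds p. z x = (ys i \<circ> q) x)" for i
    using M.ex_global_extension[OF sn_pull[OF p ys[of "q p" i]]] by metis
  then obtain z where z: "\<And>i x. M.sn x (z i)" "\<And>i. \<forall>\<^sub>F x in nhds p. z i x = (ys i \<circ> q) x" by metis
  let ?a = "\<lambda>r. \<Sum>i\<in>onb. c i r *\<^sub>R ext_d M (z i) r"
  have form: "M.form ?a" by (intro M.form_sum M.form_smult c M.form_ext_d z)
  have ce: "\<forall>\<^sub>F x in nhds p. \<forall>i\<in>onb. c i x = \<alpha> (q x) (G i (q x))"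
    using c(2) by (simp add: eventually_ball_finite)
  have "\<forall>\<^sub>F x in nhds p. \<forall>\<^sub>F y in nhds x. z i y = (ys i \<circ> q) y" for i
    using z(2)[of i] unfolding eventually_eventually .
  then have ze: "\<forall>\<^sub>F x in nhds p. \<forall>i\<in>onb. \<forall>\<^sub>F y in nhds x. z i y = (ys i \<circ> q) y"
    by (simp add: eventually_ball_finite)
  have "\<forall>\<^sub>F r in nhds p. ?a r = pull r (\<alpha> (q r))"
    using ce ze frq near_U[OF p]
  proof eventually_elim
    case (elim r)
    show ?case
    proof (rule M.cot_eqI[of _ r])
      show "?a r \<in> M.Ts r" by (rule M.form_Ts[OF form])
      show "pull r (\<alpha> (q r)) \<in> M.Ts r" by (rule pull_cot[OF elim(4) N.form_Ts[OF a]])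
      fix v assume v: "v \<in> M.T r"
      have "?a r v = (\<Sum>i\<in>onb. c i r * v (z i))" using v by (simp add: sum_fun_apply scaleR_fun_apply)
      also have "\<dots> = (\<Sum>i\<in>onb. push r v (ys i) * \<alpha> (q r) (G i (q r)))"
      proof (rule sum.cong[OF refl])
        fix i :: 'f assume i: "i \<in> onb"
        have "v (z i) = v (ys i \<circ> q)" by (rule M.tv_cong[OF v]) (use elim(2) i in blast)
        then show "c i r * v (z i) = push r v (ys i) * \<alpha> (q r) (G i (q r))"
          using elim(1) i push_apply[OF ys] by simp
      qed
      also have "\<dots> = \<alpha> (q r) (push r v)"
        by (rule N.frame_cot[OF elim(3) G N.form_Ts[OF a] push_T[OF elim(4) v], symmetric])
      finally show "?a r v = pull r (\<alpha> (q r)) v" using v by (simp add: pull_apply)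
    qed
  qed
  then show ?thesis using that form a by (simp add: related_form_def)
qed

lemma related_apply:
  assumes p: "p \<in> U" and r: "related p X' X" and g: "N.sn (q p) g"
  shows "\<forall>\<^sub>F r in nhds p. X' r (g \<circ> q) = X (q r) g"
  using r[unfolded related_def, THEN conjunct2, THEN conjunct2] q_eventually[OF p N.sn_open[OF g]]
  by eventually_elim (metis push_apply)

lemma related_at:
  assumes p: "p \<in> U" and r: "related p X' X" and g: "N.sn (q p) g"
  shows "X' p (g \<circ> q) = X (q p) g"
  by (rule eventually_nhds_x_imp_x[OF related_apply[OF p r g]])

lemma related_bracket_at:
  assumes p: "p \<in> U" and X: "related p X' X" and Y: "related p Y' Y"
  shows "push p (M.bracket X' Y' p) = N.bracket X Y (q p)"
proof -
  have v: "M.vfield X'" "N.vfield X" "M.vfield Y'" "N.vfield Y" using X Y by (auto simp: related_def)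
  show ?thesis
  proof (rule N.tv_eqI[of _ "q p"])
    show "push p (M.bracket X' Y' p) \<in> N.T (q p)" using v by (intro push_T p M.lie_bracket_tangent)
    show "N.bracket X Y (q p) \<in> N.T (q p)" using v by blast
    fix g assume g: "N.sn (q p) g"
    have H: "X' p (\<lambda>x. Y' x (g \<circ> q)) = X (q p) (\<lambda>y. Y y g)"
      if "related p X' X" "related p Y' Y" for X' X Y' Y
    proof -
      have v: "M.vfield X'" "N.vfield Y" using that by (auto simp: related_def)
      have "X' p (\<lambda>x. Y' x (g \<circ> q)) = X' p ((\<lambda>y. Y y g) \<circ> q)"
        by (rule M.tv_cong[OF M.vfield_T[OF v(1)]]) (use related_apply[OF p that(2) g] in simp)
      also have "\<dots> = X (q p) (\<lambda>y. Y y g)"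
        by (rule related_at[OF p that(1) N.vfield_sn[OF v(2) g]])
      finally show ?thesis .
    qed
    show "push p (M.bracket X' Y' p) g = N.bracket X Y (q p) g"
      unfolding push_apply[OF g] M.lie_bracket_apply[OF sn_pull[OF p g]] N.lie_bracket_apply[OF g]
        H[OF X Y] H[OF Y X] ..
  qed
qed

text \<open>Lets identities that are shown at one point for related objects be upgraded to
  identities near that point.\<close>

lemma related_open: "p \<in> U \<Longrightarrow> related p X' X \<Longrightarrow> \<forall>\<^sub>F r in nhds p. r \<in> U \<and> related r X' X"
  using near_U[of p] unfolding related_def
  by (auto simp: eventually_eventually eventually_conj_iff)

lemma related_form_open: "p \<in> U \<Longrightarrow> related_form p \<alpha>' \<alpha> \<Longrightarrow> \<forall>\<^sub>F r in nhds p. r \<in> U \<and> related_form r \<alpha>' \<alpha>"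
  using near_U[of p] unfolding related_form_def
  by (auto simp: eventually_eventually eventually_conj_iff)

lemma related_push: "related p X' X \<Longrightarrow> push p (X' p) = X (q p)"
  unfolding related_def using eventually_nhds_x_imp_x by fast

lemma related_form_pull: "related_form p \<alpha>' \<alpha> \<Longrightarrow> \<alpha>' p = pull p (\<alpha> (q p))"
  unfolding related_form_def using eventually_nhds_x_imp_x by fast

lemma related_bracket:
  assumes p: "p \<in> U" and X: "related p X' X" and Y: "related p Y' Y"
  shows "related p (M.bracket X' Y') (N.bracket X Y)"
proof -
  have "\<forall>\<^sub>F r in nhds p. push r (M.bracket X' Y' r) = N.bracket X Y (q r)"
    using related_open[OF p X] related_open[OF p Y] by eventually_elim (blast intro: related_bracket_at)
  then show ?thesis using X Y by (auto simp: related_def)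
qed

lemma related_form_eval:
  assumes p: "p \<in> U" and a: "related_form p \<alpha>' \<alpha>" and Y: "related p Y' Y"
  shows "\<forall>\<^sub>F r in nhds p. \<alpha>' r (Y' r) = \<alpha> (q r) (Y (q r))"
  using related_form_open[OF p a] related_open[OF p Y]
proof eventually_elim
  case (elim r)
  then have r: "related_form r \<alpha>' \<alpha>" "related r Y' Y" by auto
  then have "Y' r \<in> M.T r" by (simp add: related_def)
  then show ?case unfolding related_form_pull[OF r(1)] related_push[OF r(2), symmetric] by (rule pull_apply)
qed

text \<open>Tested on a vector w at p: its push-forward extends to a field on N, and this field is
  lifted so as to pass through w itself. The two defining formulas then agree term by term.\<close>

lemma related_form_lie_at:
  assumes p: "p \<in> U" and X: "related p X' X" and a: "related_form p \<alpha>' \<alpha>"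
  shows "lie_form M X' \<alpha>' p = pull p (lie_form N X \<alpha> (q p))"
proof (rule M.cot_eqI[of _ p])
  have v: "M.vfield X'" "N.vfield X" "M.form \<alpha>'" "N.form \<alpha>" using X a by (auto simp: related_def related_form_def)
  show "lie_form M X' \<alpha>' p \<in> M.Ts p" using v by (intro M.form_Ts M.form_lie_form)
  show "pull p (lie_form N X \<alpha> (q p)) \<in> M.Ts p" using v by (intro pull_cot p N.form_Ts N.form_lie_form)
  fix w assume w: "w \<in> M.T p"
  obtain Y where Y: "N.vfield Y" "Y (q p) = push p w" by (rule N.ex_vf_through[OF push_T[OF p w]]) blast
  obtain Y' where Y': "related p Y' Y" "Y' p = w" by (rule ex_related[OF p Y(1) w]) (use Y in auto)
  have Yv: "M.vfield Y'" using Y' by (simp add: related_def)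
  have "X' p (\<lambda>x. \<alpha>' x (Y' x)) = X' p ((\<lambda>y. \<alpha> y (Y y)) \<circ> q)"
    by (rule M.tv_cong[OF M.vfield_T[OF v(1)]]) (use related_form_eval[OF p a Y'(1)] in simp)
  also have "\<dots> = X (q p) (\<lambda>y. \<alpha> y (Y y))"
    by (rule related_at[OF p X N.form_sn[OF v(4) Y(1)]])
  finally have 1: "X' p (\<lambda>x. \<alpha>' x (Y' x)) = X (q p) (\<lambda>y. \<alpha> y (Y y))" .
  have 2: "\<alpha>' p (M.bracket X' Y' p) = \<alpha> (q p) (N.bracket X Y (q p))"
    using eventually_nhds_x_imp_x[OF related_form_eval[OF p a related_bracket[OF p X Y'(1)]]] .
  have "lie_form M X' \<alpha>' p w = lie_form N X \<alpha> (q p) (Y (q p))"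
    using M.lie_form_apply[OF v(1,3) Yv, of p] N.lie_form_apply[OF v(2,4) Y(1), of "q p"] 1 2 Y'(2) by simp
  then show "lie_form M X' \<alpha>' p w = pull p (lie_form N X \<alpha> (q p)) w" using w Y(2) by (simp add: pull_apply)
qed

section \<open>Descent of smoothness\<close>

lemma push_partial_vec_apply:
  assumes c: "(A, \<phi>) \<in> M" "p \<in> A" and d: "(V, \<psi>) \<in> N" "q p \<in> V" and p: "p \<in> U"
    and g: "g \<circ> inv_into V \<psi> differentiable at (\<psi> (q p))" and gq: "M.sn p (g \<circ> q)"
  shows "M.partial_vec A \<phi> p e (g \<circ> q) = frechet_derivative (g \<circ> inv_into V \<psi>) (at (\<psi> (q p)))
     (frechet_derivative (\<psi> \<circ> q \<circ> inv_into A \<phi>) (at (\<phi> p)) e)"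
proof -
  let ?k = "\<psi> \<circ> q \<circ> inv_into A \<phi>"
  note o = q_chart[OF c(1) d(1)]
  have mem: "\<phi> p \<in> \<phi> ` (A \<inter> U \<inter> q -` V)" using c d p by blast
  have k: "(?k has_derivative frechet_derivative ?k (at (\<phi> p))) (at (\<phi> p))"
    using cinf_on_differentiable[OF o(3) mem] frechet_derivative_works by blast
  have kp: "?k (\<phi> p) = \<psi> (q p)" using c by simp
  have "((g \<circ> inv_into V \<psi>) has_derivative frechet_derivative (g \<circ> inv_into V \<psi>) (at (\<psi> (q p)))) (at (?k (\<phi> p)))"
    unfolding kp using g frechet_derivative_works by blast
  from diff_chain_at[OF k this]
  have "((g \<circ> q) \<circ> inv_into A \<phi> has_derivative
     frechet_derivative (g \<circ> inv_into V \<psi>) (at (\<psi> (q p))) \<circ> frechet_derivative ?k (at (\<phi> p))) (at (\<phi> p))"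
    by (rule has_derivative_transform_within_open[OF _ o(2) mem]) (use c d in auto)
  then show ?thesis using gq by (simp add: M.partial_vec_def frechet_at_eq)
qed

lemma push_partial_vec:
  assumes c: "(A, \<phi>) \<in> M" "p \<in> A" and d: "(V, \<psi>) \<in> N" "q p \<in> V" and p: "p \<in> U"
  shows "push p (M.partial_vec A \<phi> p e) = N.partial_vec V \<psi> (q p) (frechet_derivative (\<psi> \<circ> q \<circ> inv_into A \<phi>) (at (\<phi> p)) e)"
proof (rule N.tv_eqI[of _ "q p"])
  show "push p (M.partial_vec A \<phi> p e) \<in> N.T (q p)" by (rule push_T[OF p M.partial_vec_tangent[OF c]])
  show "N.partial_vec V \<psi> (q p) (frechet_derivative (\<psi> \<circ> q \<circ> inv_into A \<phi>) (at (\<phi> p)) e) \<in> N.T (q p)"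
    by (rule N.partial_vec_tangent[OF d])
  fix g assume g: "N.sn (q p) g"
  have "g \<circ> inv_into V \<psi> differentiable at (\<psi> (q p))"
    using N.sn_chart_differentiable[OF g d] differentiable_def by blast
  from push_partial_vec_apply[OF c d p this sn_pull[OF p g]]
  show "push p (M.partial_vec A \<phi> p e) g = N.partial_vec V \<psi> (q p) (frechet_derivative (\<psi> \<circ> q \<circ> inv_into A \<phi>) (at (\<phi> p)) e) g"
    using g by (simp add: push_apply N.partial_vec_def)
qed

lemma partial_vec_inj:
  assumes d: "(V, \<psi>) \<in> N" "y \<in> V" and e: "N.partial_vec V \<psi> y e = N.partial_vec V \<psi> y e'"
  shows "e = e'"
proof -
  have "e \<bullet> b = e' \<bullet> b" for b
    using N.partial_vec_coord[OF d, of e b] N.partial_vec_coord[OF d, of e' b] e by simp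
  then have "(\<Sum>b\<in>onb. (e \<bullet> b) *\<^sub>R b) = (\<Sum>b\<in>onb. (e' \<bullet> b) *\<^sub>R b)" by (simp only:)
  then show ?thesis by (simp only: onb_expansion)
qed

text \<open>A local section of q is built in charts. L is a linear right inverse of the derivative
  of the chart representation of q, and on the affine slice parametrised by \<open>m\<close> this
  representation has the identity as derivative at 0, so \<open>local_right_inverse\<close> applies.
  Composing \<open>f \<circ> q\<close> with the section recovers f.\<close>

lemma descend_differentiable:
  assumes p: "p \<in> U" and d: "(V, \<psi>) \<in> N" "q p \<in> V" and f: "M.sn p (f \<circ> q)"
  shows "f \<circ> inv_into V \<psi> differentiable at (\<psi> (q p))"
proof -
  obtain A \<phi> where c: "(A, \<phi>) \<in> M" "p \<in> A" by (rule M.ex_chart)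
  let ?k = "\<psi> \<circ> q \<circ> inv_into A \<phi>"
  let ?O = "A \<inter> U \<inter> q -` V"
  note o = q_chart[OF c(1) d(1)]
  have mem: "\<phi> p \<in> \<phi> ` ?O" using c d p by blast
  have kp: "?k (\<phi> p) = \<psi> (q p)" using c by simp
  let ?D = "frechet_derivative ?k (at (\<phi> p))"
  have k: "(?k has_derivative ?D) (at (\<phi> p))"
    using cinf_on_differentiable[OF o(3) mem] frechet_derivative_works by blast
  then have Dl: "linear ?D" using bounded_linear.linear has_derivative_bounded_linear by blast
  \<comment> \<open>Surjectivity of \<open>push p\<close> passes to its matrix in charts because a
    tangent vector determines its chart direction.\<close>
  have "\<exists>e. ?D e = b" for b
  proof -
    obtain v where v: "v \<in> M.T p" "push p v = N.partial_vec V \<psi> (q p) b" by (rule push_lift[OF p N.partial_vec_tangent[OF d]])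
    obtain e where "v = M.partial_vec A \<phi> p e" using M.tangent_iff[OF c] v(1) by blast
    then have "N.partial_vec V \<psi> (q p) (?D e) = N.partial_vec V \<psi> (q p) b" using push_partial_vec[OF c d p] v(2) by simp
    from partial_vec_inj[OF d this] show ?thesis by blast
  qed
  then obtain l where l: "\<And>b. ?D (l b) = b" by metis
  define L where "L y = (\<Sum>b\<in>onb. (y \<bullet> b) *\<^sub>R l b)" for y
  have "linear L" unfolding L_def
    by (intro linearI) (simp_all add: inner_add_left scaleR_add_left sum.distrib scaleR_sum_right)
  then have Lb: "bounded_linear L" by (rule linear_finite_dim_bounded)
  have DL: "?D (L y) = y" for y
  proof -
    have "?D (L y) = (\<Sum>b\<in>onb. (y \<bullet> b) *\<^sub>R ?D (l b))"
      unfolding L_def using Dl by (simp add: linear_sum linear_scale)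
    then show ?thesis by (simp add: l onb_expansion)
  qed
  define m where "m y = L y + \<phi> p" for y
  have mc: "cinf_on S m" if "open S" for S
    unfolding m_def[abs_def] by (intro cinf_on_add that cinf_on_const cinf_on_bounded_linear Lb)
  have md: "(m has_derivative L) (at y)" for y
    unfolding m_def[abs_def] using bounded_linear_imp_has_derivative[OF Lb] by (auto intro!: derivative_eq_intros)
  have m0: "m 0 = \<phi> p" by (simp add: m_def linear_0[OF \<open>linear L\<close>])
  define S where "S = m -` (\<phi> ` ?O)"
  have "continuous_on UNIV m" by (rule cinf_on_continuous[OF mc[OF open_UNIV]])
  then have S: "open S" "0 \<in> S" unfolding S_def using o(2) mem m0 by (auto simp: open_vimage)
  define g where "g = ?k \<circ> m"
  have gS: "ck_on 1 S g" unfolding g_def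
    by (rule ck_on_compose[OF S(1)]) (use o(3) mc[OF S(1)] in \<open>auto simp: cinf_on_def S_def simp del: ck_on.simps One_nat_def\<close>)
  have "(?k has_derivative ?D) (at (m 0))" using k m0 by simp
  from diff_chain_at[OF md this] have "(g has_derivative ?D \<circ> L) (at 0)" unfolding g_def .
  moreover have "?D \<circ> L = (\<lambda>v. v)" by (rule ext) (simp only: o_apply DL)
  ultimately have "(g has_derivative (\<lambda>v. v)) (at 0)" by simp
  then have "frechet_derivative g (at 0) v = v" for v by (simp add: frechet_at_eq)
  then obtain s T where T: "open T" "g 0 \<in> T" "s (g 0) = 0" "\<And>y. y \<in> T \<Longrightarrow> s y \<in> S \<and> g (s y) = y"
    "s differentiable at (g 0)" using local_right_inverse[OF S gS] by metis
  have g0: "g 0 = \<psi> (q p)" using m0 kp by (simp add: g_def)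
  let ?F = "(f \<circ> q) \<circ> inv_into A \<phi>"
  obtain s' where s': "(s has_derivative s') (at (\<psi> (q p)))" using T(5) g0 differentiable_def by metis
  have "(m has_derivative L) (at (s (\<psi> (q p))))" by (rule md)
  note ms = diff_chain_at[OF s' this]
  have "(?F has_derivative frechet_derivative ?F (at (\<phi> p))) (at ((m \<circ> s) (\<psi> (q p))))"
    using M.sn_chart_differentiable[OF f c] T(3) g0 m0 by simp
  from diff_chain_at[OF ms this]
  have D: "(?F \<circ> (m \<circ> s) has_derivative (frechet_derivative ?F (at (\<phi> p)) \<circ> (L \<circ> s'))) (at (\<psi> (q p)))" .
  have "(f \<circ> inv_into V \<psi> has_derivative (frechet_derivative ?F (at (\<phi> p)) \<circ> (L \<circ> s'))) (at (\<psi> (q p)))"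
  proof (rule has_derivative_transform_within_open[OF D T(1)])
    show "\<psi> (q p) \<in> T" using T(2) g0 by simp
    fix y assume "y \<in> T"
    then have y: "s y \<in> S" "g (s y) = y" using T(4) by auto
    then obtain r where r: "r \<in> ?O" "m (s y) = \<phi> r" unfolding S_def by blast
    have ri: "inv_into A \<phi> (\<phi> r) = r" using c(1) r(1) by simp
    have "y = \<psi> (q r)" using y(2) r ri by (simp add: g_def)
    moreover have "inv_into V \<psi> (\<psi> (q r)) = q r" using d(1) r(1) by simp
    ultimately show "(?F \<circ> (m \<circ> s)) y = (f \<circ> inv_into V \<psi>) y" using r(2) ri by simp
  qed
  then show ?thesis by (auto simp: differentiable_def)
qed

text \<open>The section above is known to be differentiable at one point only, so higher regularity
  comes by induction with f arbitrary: the derivative f' of f in a chart direction e again has a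
  smooth pull-back, because \<open>f' \<circ> q\<close> is locally the derivative of
  \<open>f \<circ> q\<close> along a lift of the coordinate field of e.\<close>

lemma descend_ck:
  assumes d: "(V, \<psi>) \<in> N"
  shows "open W \<Longrightarrow> W \<subseteq> V \<Longrightarrow> (\<And>p. p \<in> U \<Longrightarrow> q p \<in> W \<Longrightarrow> M.sn p (f \<circ> q)) \<Longrightarrow>
    ck_on k (\<psi> ` W) (f \<circ> inv_into V \<psi>)"
proof (induct k arbitrary: f)
  have dif: "f \<circ> inv_into V \<psi> differentiable at x"
    if W: "W \<subseteq> V" and f: "\<And>p. p \<in> U \<Longrightarrow> q p \<in> W \<Longrightarrow> M.sn p (f \<circ> q)" and x: "x \<in> \<psi> ` W" for f x
  proof -
    obtain y where y: "y \<in> W" "x = \<psi> y" using x by blast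
    have "y \<in> q ` U" using q_surj by simp
    then obtain p where "p \<in> U" "q p = y" by blast
    then show ?thesis using descend_differentiable[OF _ d] f y W by blast
  qed
  {
    case 0
    show ?case unfolding ck_on.simps
      by (intro continuous_at_imp_continuous_on ballI differentiable_imp_continuous_within dif[OF 0(2,3)])
  next
    case (Suc k)
    have Wo: "open (\<psi> ` W)" using N.open_chart_image[OF d Suc.prems(1)] Suc.prems(2) by (simp add: Int_absorb1)
    have "ck_on k (\<psi> ` W) (\<lambda>x. frechet_derivative (f \<circ> inv_into V \<psi>) (at x) e)" for e
    proof -
      define f' where "f' y = frechet_derivative (f \<circ> inv_into V \<psi>) (at (\<psi> y)) e" for y
      have "ck_on k (\<psi> ` W) (f' \<circ> inv_into V \<psi>)"
      proof (rule Suc.hyps[OF Suc.prems(1,2)])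
        fix p assume p: "p \<in> U" "q p \<in> W"
        then have pV: "q p \<in> V" using Suc.prems(2) by blast
        obtain G ys where G: "\<And>b. N.vfield (G b)" and ys: "\<And>b y. N.sn y (ys b)"
          and fr: "\<forall>\<^sub>F y in nhds (q p). N.frame y G ys" by (rule N.ex_frame[of "q p"]) blast
        have "\<exists>c. (\<forall>y. N.sn y c) \<and> (\<forall>\<^sub>F y in nhds (q p). c y = N.partial_vec V \<psi> y e (ys i))" for i
          using N.ex_global_extension[OF N.smooth_partial_vec[OF d pV ys[of "q p" i], of e]] by metis
        then obtain c where c: "\<And>i y. N.sn y (c i)" "\<And>i. \<forall>\<^sub>F y in nhds (q p). c i y = N.partial_vec V \<psi> y e (ys i)" by metis
        \<comment> \<open>The frame coefficients of the coordinate field of e have been extended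
          globally, so Y is a global field that equals this coordinate field near \<open>q p\<close>
          and can be lifted.\<close>
        define Y where "Y y = (\<Sum>i\<in>onb. c i y *\<^sub>R G i y)" for y
        have Y: "N.vfield Y" unfolding Y_def[abs_def] by (intro N.vfield_sum N.vfield_smult c G)
        have ce: "\<forall>\<^sub>F y in nhds (q p). \<forall>i\<in>onb. c i y = N.partial_vec V \<psi> y e (ys i)"
          using c(2) by (simp add: eventually_ball_finite)
        have Ve: "\<forall>\<^sub>F y in nhds (q p). y \<in> W" using Suc.prems(1) p eventually_nhds_in_open by blast
        have Ye: "\<forall>\<^sub>F y in nhds (q p). y \<in> W \<and> Y y = N.partial_vec V \<psi> y e"
          using ce fr Ve
        proof eventually_elim
          case (elim y)
          then have "y \<in> V" using Suc.prems(2) by blast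
          have "N.partial_vec V \<psi> y e = (\<Sum>i\<in>onb. N.partial_vec V \<psi> y e (ys i) *\<^sub>R G i y)"
            by (rule N.frame_tv[OF elim(2) N.partial_vec_tangent[OF d \<open>y \<in> V\<close>]])
          also have "\<dots> = Y y" unfolding Y_def by (rule sum.cong[OF refl]) (use elim(1) in simp)
          finally show ?case using elim(3) by simp
        qed
        obtain Y' where Y': "related p Y' Y" by (rule ex_related_any[OF p(1) Y])
        have ev: "\<forall>\<^sub>F r in nhds p. Y' r (f \<circ> q) = (f' \<circ> q) r"
          using related_open[OF p(1) Y'] q_eventually[OF p(1) Ye]
        proof eventually_elim
          case (elim r)
          then have r: "r \<in> U" "related r Y' Y" "q r \<in> W" "q r \<in> V" "Y (q r) = N.partial_vec V \<psi> (q r) e"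
            using Suc.prems(2) by auto
          obtain A \<phi> where a: "(A, \<phi>) \<in> M" "r \<in> A" by (rule M.ex_chart)
          have "Y' r \<in> M.T r" using r(2) by (simp add: related_def)
          then obtain e' where e': "Y' r = M.partial_vec A \<phi> r e'" using M.tangent_iff[OF a] by blast
          have "N.partial_vec V \<psi> (q r) (frechet_derivative (\<psi> \<circ> q \<circ> inv_into A \<phi>) (at (\<phi> r)) e') = N.partial_vec V \<psi> (q r) e"
            using push_partial_vec[OF a d r(4,1)] related_push[OF r(2)] r(5) e' by simp
          from partial_vec_inj[OF d r(4) this]
          have ee: "frechet_derivative (\<psi> \<circ> q \<circ> inv_into A \<phi>) (at (\<phi> r)) e' = e" .
          \<comment> \<open>At this stage f is only known to be differentiable in the chart, not
            smooth; this explains the weak hypothesis of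
            \<open>push_partial_vec_apply\<close>.\<close>
          have "f \<circ> inv_into V \<psi> differentiable at (\<psi> (q r))"
            by (rule dif[OF Suc.prems(2,3)]) (use r in auto)
          from push_partial_vec_apply[OF a d r(4,1) this Suc.prems(3)[OF r(1,3)], of e']
          show ?case by (simp add: e' ee f'_def)
        qed
        have "M.vfield Y'" using Y' by (simp add: related_def)
        from M.sn_cong[OF M.vfield_sn[OF this Suc.prems(3)[OF p]] ev] show "M.sn p (f' \<circ> q)" .
      qed
      then show ?thesis
        by (rule ck_on_cong[OF Wo, rotated]) (use d Suc.prems(2) in \<open>auto simp: f'_def subset_iff\<close>)
    qed
    then show ?case using dif[OF Suc.prems(2,3)] unfolding ck_on.simps by blast
  }
qed

lemma descend_sn:
  assumes W: "open W" and f: "\<And>p. p \<in> U \<Longrightarrow> q p \<in> W \<Longrightarrow> M.sn p (f \<circ> q)" and y: "y \<in> W"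
  shows "N.sn y f"
proof -
  obtain V \<psi> where d: "(V, \<psi>) \<in> N" "y \<in> V" by (rule N.ex_chart)
  have o: "open (W \<inter> V)" using W N.chart(1)[OF d(1)] by blast
  have "cinf_on (\<psi> ` (W \<inter> V)) (f \<circ> inv_into V \<psi>)"
    unfolding cinf_on_def by (intro allI descend_ck[OF d(1) o]) (use f in auto)
  then show ?thesis by (intro N.sn_chartI[OF d(1) o]) (use y d in auto)
qed

end


section \<open>The structure on the space of leaves\<close>

locale leaf_projection = contact M h P \<theta> F Z \<xi> + submersion M N U q
  for M :: "('m::{t2_space,second_countable_topology}, 'e::finite_dim_inner) atlas"
    and h P \<theta> F Z \<xi>
    and N :: "('n::{t2_space,second_countable_topology}, 'f::finite_dim_inner) atlas" and U q +
  assumes vertical: "p \<in> U \<Longrightarrow> {v \<in> tangent_space M p. push_vec N q p v = 0} = span ((\<lambda>a. Z a p) ` {1..h})"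
    and leaves: "x \<in> U \<Longrightarrow> y \<in> U \<Longrightarrow> q x = q y \<Longrightarrow> same_leaf M (\<lambda>p. span ((\<lambda>a. Z a p) ` {1..h})) U x y"
begin

section \<open>Vertical vectors and functions constant on the fibres\<close>

lemma push_Z: "p \<in> U \<Longrightarrow> a \<in> I \<Longrightarrow> push p (Z a p) = 0"
proof -
  assume p: "p \<in> U" and a: "a \<in> I"
  have "Z a p \<in> span ((\<lambda>a. Z a p) ` I)" using a by (intro span_base) blast
  then show ?thesis using vertical[OF p] by blast
qed

lemma push_sum_Z: "p \<in> U \<Longrightarrow> push p (\<Sum>a\<in>I. c a *\<^sub>R Z a p) = 0"
proof -
  assume p: "p \<in> U"
  have "(\<Sum>a\<in>I. c a *\<^sub>R Z a p) \<in> span ((\<lambda>a. Z a p) ` I)"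
    by (intro span_sum span_scale span_base) blast
  then show ?thesis using vertical[OF p] by blast
qed

text \<open>Regarding Z as a lift of the zero field turns computations with Z into instances of the
  rules for related objects: brackets of Z with lifts are vertical, and Lie derivatives of pulled
  back forms along Z vanish.\<close>

lemma related_Z: "p \<in> U \<Longrightarrow> a \<in> I \<Longrightarrow> related p (Z a) (\<lambda>y. 0)"
  unfolding related_def
proof (intro conjI)
  assume p: "p \<in> U" and a: "a \<in> I"
  show "vfield (Z a)" by (rule vfield_Z[OF a])
  show "N.vfield (\<lambda>y. 0)" by simp
  show "\<forall>\<^sub>F r in nhds p. push r (Z a r) = 0"
    using near_U[OF p] by eventually_elim (rule push_Z[OF _ a])
qed

lemma vertical_F: "p \<in> U \<Longrightarrow> v \<in> T p \<Longrightarrow> push p v = 0 \<Longrightarrow> F p v = 0"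
  and vertical_B: "p \<in> U \<Longrightarrow> v \<in> T p \<Longrightarrow> push p v = 0 \<Longrightarrow> B p v = 0"
  using vertical[of p] F_span_Z(2,3)[of v p] by blast+

lemma F_cong:
  assumes "p \<in> U" "v \<in> T p" "w \<in> T p" "push p v = push p w"
  shows "F p v = F p w"
  using vertical_F[OF assms(1) tangent_diff[OF assms(2,3)]] F_diff[OF assms(2,3)] assms(4)
  by (simp add: push_diff)

lemma B_cong:
  assumes "p \<in> U" "v \<in> T p" "w \<in> T p" "push p v = push p w"
  shows "B p v = B p w"
proof -
  have "B p (v - w) = 0" using vertical_B[OF assms(1) tangent_diff[OF assms(2,3)]] assms(4) by (simp add: push_diff)
  moreover have "B p v = B p (v - w) + B p w"
    using B_add[OF tangent_diff[OF assms(2,3)] assms(3)] by simp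
  ultimately show ?thesis by simp
qed

lemma bracket_Z_vertical:
  assumes p: "p \<in> U" and a: "a \<in> I" and X: "related p X' X"
  shows "push p (bracket (Z a) X' p) = 0"
  using related_bracket_at[OF p related_Z[OF p a] X] X by (simp add: related_def)

lemma constant_on_fibres:
  assumes f: "\<And>p. p \<in> U \<Longrightarrow> sn p f" and Zf: "\<And>p a. p \<in> U \<Longrightarrow> a \<in> I \<Longrightarrow> Z a p f = 0"
    and xy: "x \<in> U" "y \<in> U" "q x = q y"
  shows "f x = f y"
  by (rule constant_on_leaf[OF f _ leaves[OF xy]]) (use F_span_Z(4) Zf in blast)+

text \<open>A pointwise choice without any continuity. It occurs only as an argument of F and
  \<theta>, whose values do not depend on it by \<open>F_cong\<close> and
  \<open>theta_cong\<close>.\<close>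

definition lift :: "'m \<Rightarrow> 'n tvec \<Rightarrow> 'm tvec" where
  "lift p w = (SOME v. v \<in> T p \<and> push p v = w)"

lemma lift:
  assumes "p \<in> U" "w \<in> N.T (q p)"
  shows "lift p w \<in> T p" "push p (lift p w) = w"
proof -
  obtain v where "v \<in> T p" "push p v = w" by (rule push_lift[OF assms])
  then have "\<exists>v. v \<in> T p \<and> push p v = w" by blast
  from someI_ex[OF this] show "lift p w \<in> T p" "push p (lift p w) = w" unfolding lift_def by auto
qed

section \<open>Invariance of F, P and \<theta> along the fibres\<close>

lemma F_lift_eventually:
  assumes p: "p \<in> U" and X: "related p X' X"
  shows "\<forall>\<^sub>F r in nhds p. F r (lift r (X (q r))) = F r (X' r) \<and> B r (lift r (X (q r))) = B r (X' r)"
  using related_open[OF p X]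
proof eventually_elim
  case (elim r)
  then have r0: "r \<in> U" "related r X' X" by auto
  then have r: "r \<in> U" "X' r \<in> T r" "X (q r) \<in> N.T (q r)" "push r (X' r) = X (q r)"
    using related_push[OF r0(2)] by (simp_all add: related_def)
  have l: "lift r (X (q r)) \<in> T r" "push r (lift r (X (q r))) = push r (X' r)"
    using lift[OF r(1,3)] r(4) by auto
  show ?case using F_cong[OF r(1) l(1) r(2) l(2)] B_cong[OF r(1) l(1) r(2) l(2)] by blast
qed

text \<open>For a local lift X' of X, the Z-derivative of \<open>F X' (g \<circ> q)\<close> splits
  into \<open>[Z, F X'] = F [Z, X']\<close>, which is 0 as the bracket is vertical, and
  \<open>F X'\<close> applied to \<open>Z (g \<circ> q)\<close>, which is 0 near p. The function
  \<open>?f\<close> is written with \<open>lift\<close> because X' varies with p.\<close>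

lemma F_invariant:
  assumes x: "x \<in> U" and y: "y \<in> U" and e: "q x = q y" and v: "v \<in> T x" and w: "w \<in> T y"
    and vw: "push x v = push y w"
  shows "push x (F x v) = push y (F y w)"
proof -
  obtain X where X: "N.vfield X" "X (q x) = push x v" by (rule N.ex_vf_through[OF push_T[OF x v]]) blast
  have Fx: "push x (F x v) \<in> N.T (q x)" by (rule push_T[OF x F_T[OF v]])
  have Fy: "push y (F y w) \<in> N.T (q x)" unfolding e by (rule push_T[OF y F_T[OF w]])
  show ?thesis
  proof (rule N.tv_eqI[OF Fx Fy])
    fix g0 assume "N.sn (q x) g0"
    \<comment> \<open>g0 is controlled only near \<open>q x\<close>, whereas the argument along the
      leaf needs a function that is smooth on all of N.\<close>
    then obtain g where g: "\<And>z. N.sn z g" "\<forall>\<^sub>F z in nhds (q x). g z = g0 z"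
      by (rule N.ex_global_extension) blast
    let ?f = "\<lambda>r. F r (lift r (X (q r))) (g \<circ> q)"
    have "?f x = ?f y"
    proof (rule constant_on_fibres[OF _ _ x y e])
      fix p assume p: "p \<in> U"
      obtain X' where X': "related p X' X" by (rule ex_related_any[OF p X(1)])
      have vX: "vfield X'" using X' by (simp add: related_def)
      note FX = vfield_F[OF vX]
      have gq: "sn p (g \<circ> q)" by (rule sn_pull[OF p g(1)])
      have ev: "\<forall>\<^sub>F r in nhds p. F r (X' r) (g \<circ> q) = ?f r"
        using F_lift_eventually[OF p X'] by eventually_elim simp
      show "sn p ?f" by (rule sn_cong[OF vfield_sn[OF FX gq] ev])
      fix a assume a: "a \<in> I"
      have "Z a p ?f = Z a p (\<lambda>r. F r (X' r) (g \<circ> q))"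
        by (rule tv_cong[OF vfield_T[OF vfield_Z[OF a]], symmetric]) (rule ev)
      also have "\<dots> = bracket (Z a) (\<lambda>r. F r (X' r)) p (g \<circ> q) + F p (X' p) (\<lambda>r. Z a r (g \<circ> q))"
        by (simp add: lie_bracket_apply[OF gq])
      also have "bracket (Z a) (\<lambda>r. F r (X' r)) p = 0"
        unfolding Z_F[OF a vX]
        by (rule vertical_F[OF p _ bracket_Z_vertical[OF p a X']]) (intro lie_bracket_tangent vfield_Z a vX)
      also have "F p (X' p) (\<lambda>r. Z a r (g \<circ> q)) = F p (X' p) (\<lambda>r. 0)"
        by (rule tv_cong[OF vfield_T[OF FX]]) (use related_apply[OF p related_Z[OF p a] g(1)] in simp)
      also have "F p (X' p) (\<lambda>r. 0) = 0" by (rule tv_const[OF vfield_T[OF FX]])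
      finally show "Z a p ?f = 0" by (simp only: zero_fun_apply add_0)
    qed
    moreover have "F x (lift x (X (q x))) = F x v"
      using lift[OF x, of "X (q x)"] X push_T[OF x v] by (intro F_cong x v) auto
    moreover have "F y (lift y (X (q y))) = F y w"
      using lift[OF y, of "X (q y)"] X push_T[OF y w] vw e by (intro F_cong y w) auto
    ultimately have "push x (F x v) g = push y (F y w) g"
      by (simp add: push_apply[OF g(1)])
    then show "push x (F x v) g0 = push y (F y w) g0"
      using N.tv_cong[OF Fx g(2)] N.tv_cong[OF Fy g(2)] by simp
  qed
qed

lemma P_pull_eventually:
  assumes "related_form p \<alpha>' \<alpha>" "related_form p \<beta>' \<beta>"
  shows "\<forall>\<^sub>F r in nhds p. \<beta>' r (S r (\<alpha>' r)) = P r (pull r (\<alpha> (q r))) (pull r (\<beta> (q r)))"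
proof -
  have of: "form \<alpha>'" "form \<beta>'" and ev: "\<forall>\<^sub>F r in nhds p. \<alpha>' r = pull r (\<alpha> (q r))"
    "\<forall>\<^sub>F r in nhds p. \<beta>' r = pull r (\<beta> (q r))" using assms by (auto simp: related_form_def)
  show ?thesis using ev
  proof eventually_elim
    case (elim r)
    show ?case using S_apply[OF form_Ts[OF of(1), of r] form_Ts[OF of(2), of r]] unfolding elim .
  qed
qed

lemma lie_Z_related_form:
  assumes p: "p \<in> U" and a: "a \<in> I" and r: "related_form p \<alpha>' \<alpha>"
  shows "lie_form M (Z a) \<alpha>' p = 0"
proof -
  have "N.form \<alpha>" using r by (simp add: related_form_def)
  then show ?thesis using related_form_lie_at[OF p related_Z[OF p a] r] by (simp only: N.lie_form_zero pull_zero)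
qed

text \<open>P on two pulled back forms is \<open>\<nu>' (S \<mu>')\<close>. The Leibniz rule along Z
  leaves only Lie derivatives of \<mu>' and \<nu>', which vanish; for \<mu>' the derivative is moved
  past \<open>S\<close> by \<open>Z_S\<close>.\<close>

lemma P_invariant:
  assumes x: "x \<in> U" and y: "y \<in> U" and e: "q x = q y" and a: "\<alpha> \<in> N.Ts (q x)" and b: "\<beta> \<in> N.Ts (q x)"
  shows "P x (pull x \<alpha>) (pull x \<beta>) = P y (pull y \<alpha>) (pull y \<beta>)"
proof -
  obtain \<mu> where mu: "N.form \<mu>" "\<mu> (q x) = \<alpha>" by (rule N.ex_of_through[OF a]) blast
  obtain \<nu> where nu: "N.form \<nu>" "\<nu> (q x) = \<beta>" by (rule N.ex_of_through[OF b]) blast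
  let ?f = "\<lambda>r. P r (pull r (\<mu> (q r))) (pull r (\<nu> (q r)))"
  have "?f x = ?f y"
  proof (rule constant_on_fibres[OF _ _ x y e])
    fix p assume p: "p \<in> U"
    obtain \<mu>' where mu': "related_form p \<mu>' \<mu>" by (rule ex_related_form[OF p mu(1)])
    obtain \<nu>' where nu': "related_form p \<nu>' \<nu>" by (rule ex_related_form[OF p nu(1)])
    have of: "form \<mu>'" "form \<nu>'" using mu' nu' by (auto simp: related_form_def)
    note SX = vfield_sharp[OF bivector_P of(1)]
    note ev = P_pull_eventually[OF mu' nu']
    show "sn p ?f" by (rule sn_cong[OF form_sn[OF of(2) SX] ev])
    fix a assume a: "a \<in> I"
    have "Z a p ?f = Z a p (\<lambda>r. \<nu>' r (S r (\<mu>' r)))"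
      by (rule tv_cong[OF vfield_T[OF vfield_Z[OF a]], symmetric]) (rule ev)
    also have "\<dots> = lie_form M (Z a) \<nu>' p (S p (\<mu>' p)) + \<nu>' p (bracket (Z a) (\<lambda>r. S r (\<mu>' r)) p)"
      by (simp add: lie_form_apply[OF vfield_Z[OF a] of(2) SX])
    also have "lie_form M (Z a) \<nu>' p = 0" by (rule lie_Z_related_form[OF p a nu'])
    also have "bracket (Z a) (\<lambda>r. S r (\<mu>' r)) p = 0"
      unfolding Z_S[OF a of(1)] lie_Z_related_form[OF p a mu'] by (rule S_zero)
    finally show "Z a p ?f = 0" unfolding cot_zero[OF form_Ts[OF of(2)]] by simp
  qed
  then show ?thesis using mu nu e by simp
qed

lemma theta_B: "w \<in> T p \<Longrightarrow> \<theta> p v w = B p v w"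
  by simp

lemma theta_lift_eventually:
  assumes p: "p \<in> U" and X: "related p X' X" and Y: "related p Y' Y"
  shows "\<forall>\<^sub>F r in nhds p. \<theta> r (X' r) (Y' r) = \<theta> r (lift r (X (q r))) (lift r (Y (q r)))"
  using F_lift_eventually[OF p X] F_lift_eventually[OF p Y] related_open[OF p X] related_open[OF p Y]
proof eventually_elim
  case (elim r)
  then have T: "X' r \<in> T r" "Y' r \<in> T r" "lift r (X (q r)) \<in> T r" "lift r (Y (q r)) \<in> T r"
    by (simp_all add: related_def lift)
  have "\<theta> r (X' r) (Y' r) = B r (lift r (X (q r))) (Y' r)" using elim(1) T by simp
  also have "\<dots> = - \<theta> r (Y' r) (lift r (X (q r)))" using theta_skew[OF T(3,2)] T by simp
  also have "\<dots> = - B r (lift r (Y (q r))) (lift r (X (q r)))" using elim(2) T by simp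
  also have "\<dots> = \<theta> r (lift r (X (q r))) (lift r (Y (q r)))" using theta_skew[OF T(3,4)] T by simp
  finally show ?case .
qed

lemma theta_cong:
  assumes "p \<in> U" "v \<in> T p" "v' \<in> T p" "w \<in> T p" "w' \<in> T p" "push p v = push p v'" "push p w = push p w'"
  shows "\<theta> p v w = \<theta> p v' w'"
proof -
  have "\<theta> p v w = \<theta> p v' w" using B_cong[OF assms(1-3,6)] theta_B[OF assms(4)] by metis
  also have "\<dots> = - \<theta> p w v'" by (rule theta_skew[OF assms(3,4)])
  also have "\<theta> p w v' = \<theta> p w' v'" using B_cong[OF assms(1,4,5,7)] theta_B[OF assms(3)] by metis
  also have "- \<dots> = \<theta> p v' w'" using theta_skew[OF assms(3,5)] by simp
  finally show ?thesis .
qed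

text \<open>The Leibniz rule for \<open>B X'\<close> evaluated on Y' leaves, by \<open>Z_B\<close>,
  two terms in which \<theta> has a bracket of Z with a lift as one argument. Such a bracket is
  vertical and so annihilated by \<theta>.\<close>

lemma theta_invariant:
  assumes x: "x \<in> U" and y: "y \<in> U" and e: "q x = q y"
    and v: "v \<in> T x" "v' \<in> T x" and w: "w \<in> T y" "w' \<in> T y"
    and vw: "push x v = push y w" "push x v' = push y w'"
  shows "\<theta> x v v' = \<theta> y w w'"
proof -
  obtain X where X: "N.vfield X" "X (q x) = push x v" by (rule N.ex_vf_through[OF push_T[OF x v(1)]]) blast
  obtain Y where Y: "N.vfield Y" "Y (q x) = push x v'" by (rule N.ex_vf_through[OF push_T[OF x v(2)]]) blast
  let ?f = "\<lambda>r. \<theta> r (lift r (X (q r))) (lift r (Y (q r)))"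
  have "?f x = ?f y"
  proof (rule constant_on_fibres[OF _ _ x y e])
    fix p assume p: "p \<in> U"
    obtain X' where X': "related p X' X" by (rule ex_related_any[OF p X(1)])
    obtain Y' where Y': "related p Y' Y" by (rule ex_related_any[OF p Y(1)])
    have vX: "vfield X'" "vfield Y'" using X' Y' by (auto simp: related_def)
    note BX = form_flat[OF two_form_theta vX(1)]
    note ev = theta_lift_eventually[OF p X' Y']
    have bT: "bracket (Z a) X' p \<in> T p" "bracket (Z a) Y' p \<in> T p" if "a \<in> I" for a using vfield_Z[OF that] vX by auto
    show "sn p ?f" by (rule sn_cong[OF two_form_sn[OF two_form_theta vX] ev])
    fix a assume a: "a \<in> I"
    have "Z a p ?f = Z a p (\<lambda>r. \<theta> r (X' r) (Y' r))"
      by (rule tv_cong[OF vfield_T[OF vfield_Z[OF a]], symmetric]) (rule ev)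
    also have "(\<lambda>r. \<theta> r (X' r) (Y' r)) = (\<lambda>r. B r (X' r) (Y' r))" using vX by simp
    also have "Z a p \<dots> = lie_form M (Z a) (\<lambda>r. B r (X' r)) p (Y' p) + B p (X' p) (bracket (Z a) Y' p)"
      using lie_form_apply[OF vfield_Z[OF a] BX vX(2), of p] by linarith
    also have "lie_form M (Z a) (\<lambda>r. B r (X' r)) p = 0"
      unfolding Z_B[OF a vX(1)]
      by (rule vertical_B[OF p bT(1)[OF a] bracket_Z_vertical[OF p a X']])
    also have "B p (X' p) (bracket (Z a) Y' p) = - B p (bracket (Z a) Y' p) (X' p)"
      using theta_skew[OF vfield_T[OF vX(1)] bT(2)[OF a]] bT(2)[OF a] vX by simp
    also have "B p (bracket (Z a) Y' p) = 0"
      by (rule vertical_B[OF p bT(2)[OF a] bracket_Z_vertical[OF p a Y']])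
    finally show "Z a p ?f = 0" by simp
  qed
  moreover have "?f x = \<theta> x v v'"
    using lift[OF x, of "X (q x)"] lift[OF x, of "Y (q x)"] X Y push_T[OF x] v by (intro theta_cong x v) auto
  moreover have "?f y = \<theta> y w w'"
    using lift[OF y, of "X (q y)"] lift[OF y, of "Y (q y)"] X Y push_T[OF y] w vw e by (intro theta_cong y w) auto
  ultimately show ?thesis by simp
qed

section \<open>The projected tensors\<close>

definition base :: "'n \<Rightarrow> 'm" where "base y = (SOME p. p \<in> U \<and> q p = y)"

lemma base: "base y \<in> U" "q (base y) = y"
proof -
  have "y \<in> q ` U" using q_surj by simp
  then have "\<exists>p. p \<in> U \<and> q p = y" by blast
  from someI_ex[OF this] show "base y \<in> U" "q (base y) = y" unfolding base_def by auto
qed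

text \<open>All three tensors are evaluated at one chosen point of the fibre; \<open>A_push\<close>,
  \<open>pi_pull\<close> and \<open>sigma_push\<close> express the independence of this choice and
  of \<open>lift\<close>.\<close>

definition A where "A y w = push (base y) (F (base y) (lift (base y) w))"
definition \<pi> where "\<pi> y \<alpha> \<beta> = P (base y) (pull (base y) \<alpha>) (pull (base y) \<beta>)"
definition \<sigma> where "\<sigma> y v w = \<theta> (base y) (lift (base y) v) (lift (base y) w)"

lemma A_push: "p \<in> U \<Longrightarrow> v \<in> T p \<Longrightarrow> A (q p) (push p v) = push p (F p v)"
  unfolding A_def using base[of "q p"] lift[of "base (q p)" "push p v"] push_T[of p v]
  by (intro F_invariant) auto

lemma pi_pull:
  assumes "p \<in> U" "\<alpha> \<in> N.Ts (q p)" "\<beta> \<in> N.Ts (q p)"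
  shows "\<pi> (q p) \<alpha> \<beta> = P p (pull p \<alpha>) (pull p \<beta>)"
  unfolding \<pi>_def by (rule P_invariant) (use assms base[of "q p"] in simp_all)

lemma sigma_push: "p \<in> U \<Longrightarrow> v \<in> T p \<Longrightarrow> w \<in> T p \<Longrightarrow> \<sigma> (q p) (push p v) (push p w) = \<theta> p v w"
  unfolding \<sigma>_def using base[of "q p"] lift[of "base (q p)" "push p v"] lift[of "base (q p)" "push p w"] push_T[of p]
  by (intro theta_invariant) auto

lemma projects: "projects_to M U N q F P \<theta> A \<pi> \<sigma>"
  unfolding projects_to_def by (simp add: A_push pi_pull sigma_push)

lemma lift_at:
  assumes "w \<in> N.T y"
  obtains v where "v \<in> T (base y)" "push (base y) v = w"
  using lift[OF base(1), of w y] assms base(2)[of y] by auto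

lemma endo_A: "endomorphism_field N A"
  unfolding endomorphism_field_def linear_on_subspace_def
proof (intro conjI allI ballI impI)
  note bp = base
  fix y v w c assume v: "v \<in> N.T y"
  obtain v' where v': "v' \<in> T (base y)" "push (base y) v' = v" by (rule lift_at[OF v])
  note Av = A_push[OF bp(1) v'(1), unfolded bp(2) v'(2)]
  show "A y (c *\<^sub>R v) = c *\<^sub>R A y v"
    using A_push[OF bp(1) tangent_scale[OF v'(1)], of c, unfolded bp(2) push_scale v'(2)]
    unfolding Av F_scale[OF v'(1)] push_scale .
  assume w: "w \<in> N.T y"
  obtain w' where w': "w' \<in> T (base y)" "push (base y) w' = w" by (rule lift_at[OF w])
  note Aw = A_push[OF bp(1) w'(1), unfolded bp(2) w'(2)]
  show "A y (v + w) = A y v + A y w"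
    using A_push[OF bp(1) tangent_add[OF v'(1) w'(1)], unfolded bp(2) push_add v'(2) w'(2)]
    unfolding Av Aw F_add[OF v'(1) w'(1)] push_add .
next
  have AT: "A y v \<in> N.T y" if v: "v \<in> N.T y" for y v
  proof -
    obtain v' where v': "v' \<in> T (base y)" "push (base y) v' = v" by (rule lift_at[OF v])
    show ?thesis
      using push_T[OF base(1) F_T[OF v'(1)]] unfolding A_push[OF base(1) v'(1), symmetric] base(2) v'(2) .
  qed
  show "A y ` N.T y \<subseteq> N.T y" for y using AT by blast
  fix X assume X: "N.vfield X"
  show "N.vfield (\<lambda>y. A y (X y))"
  proof (rule N.vfieldI)
    show "A y (X y) \<in> N.T y" for y by (rule AT[OF N.vfield_T[OF X]])
    fix y and g :: "'n \<Rightarrow> real" assume g: "\<And>z. N.sn z g"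
    show "N.sn y (\<lambda>y. A y (X y) g)"
    \<comment> \<open>Smoothness is tested on the pull-back, which near p is the smooth function
      \<open>F X' (g \<circ> q)\<close> for a lift X' of X.\<close>
    proof (rule descend_sn[OF open_UNIV _ UNIV_I])
      fix p assume p: "p \<in> U"
      obtain X' where X': "related p X' X" by (rule ex_related_any[OF p X])
      have vX: "vfield X'" using X' by (simp add: related_def)
      have "\<forall>\<^sub>F r in nhds p. F r (X' r) (g \<circ> q) = ((\<lambda>y. A y (X y) g) \<circ> q) r"
        using related_open[OF p X']
      proof eventually_elim
        case (elim r)
        then have r: "r \<in> U" "related r X' X" by auto
        show ?case using A_push[OF r(1) vfield_T[OF vX]] related_push[OF r(2)] push_apply[OF g] by simp
      qed
      then show "sn p ((\<lambda>y. A y (X y) g) \<circ> q)"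
        by (rule sn_cong[OF vfield_sn[OF vfield_F[OF vX] sn_pull[OF p g]]])
    qed
  qed
qed

lemma bivector_pi: "bivector_field N \<pi>"
  unfolding bivector_field_def
proof (intro conjI allI impI)
  fix y
  have pc: "pull (base y) \<alpha> \<in> Ts (base y)" if "\<alpha> \<in> N.Ts y" for \<alpha>
    by (rule pull_cot[OF base(1)]) (use that base(2) in simp)
  note sk = bivectorD[OF bivector_P, of "base y"]
  show "skew_bilinear_on (N.Ts y) (\<pi> y)"
    unfolding skew_bilinear_on_def linear_on_subspace_def \<pi>_def pull_add pull_scale real_scaleR_def
    by (intro conjI ballI allI; (rule skewD[OF sk]; rule pc; assumption))
next
  fix \<alpha> \<beta> assume a: "N.form \<alpha>" and b: "N.form \<beta>"
  show "smooth_fun_on N UNIV (\<lambda>p. \<pi> p (\<alpha> p) (\<beta> p))"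
    unfolding N.smooth_near_iff_on[OF open_UNIV]
  proof
    fix y
    show "N.sn y (\<lambda>p. \<pi> p (\<alpha> p) (\<beta> p))"
    proof (rule descend_sn[OF open_UNIV _ UNIV_I])
      fix p assume p: "p \<in> U"
      obtain \<alpha>' where a': "related_form p \<alpha>' \<alpha>" by (rule ex_related_form[OF p a])
      obtain \<beta>' where b': "related_form p \<beta>' \<beta>" by (rule ex_related_form[OF p b])
      have of: "form \<alpha>'" "form \<beta>'" using a' b' by (auto simp: related_form_def)
      have "\<forall>\<^sub>F r in nhds p. \<beta>' r (S r (\<alpha>' r)) = ((\<lambda>p. \<pi> p (\<alpha> p) (\<beta> p)) \<circ> q) r"
        using P_pull_eventually[OF a' b'] near_U[OF p]
        by eventually_elim (simp add: pi_pull N.form_Ts a b)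
      then show "sn p ((\<lambda>p. \<pi> p (\<alpha> p) (\<beta> p)) \<circ> q)"
        by (rule sn_cong[OF form_sn[OF of(2) vfield_sharp[OF bivector_P of(1)]]])
    qed
  qed
qed

lemma two_form_sigma: "two_form N \<sigma>"
  unfolding two_form_def
proof (intro conjI allI impI)
  fix y
  note bp = base(1)[of y] and b2 = base(2)[of y]
  note sk = two_formD[OF two_form_theta, of "base y"]
  have s: "\<sigma> y (push (base y) v) (push (base y) w) = \<theta> (base y) v w" if "v \<in> T (base y)" "w \<in> T (base y)" for v w
    using sigma_push[OF bp that] b2 by simp
  show "skew_bilinear_on (N.T y) (\<sigma> y)"
    unfolding skew_bilinear_on_def linear_on_subspace_def
  proof (intro conjI ballI allI)
    fix x z w c assume "x \<in> N.T y"
    then obtain x' where x: "x' \<in> T (base y)" "x = push (base y) x'" by (metis lift_at)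
    assume "z \<in> N.T y"
    then obtain z' where z: "z' \<in> T (base y)" "z = push (base y) z'" by (metis lift_at)
    show "\<sigma> y x z = - \<sigma> y z x" unfolding x z s[OF x(1) z(1)] s[OF z(1) x(1)] by (rule skewD(1)[OF sk x(1) z(1)])
    show "\<sigma> y x (c *\<^sub>R z) = c *\<^sub>R \<sigma> y x z"
      unfolding x z push_scale[symmetric] s[OF x(1) tangent_scale[OF z(1)]] s[OF x(1) z(1)] real_scaleR_def
      by (rule skewD(3)[OF sk x(1) z(1)])
    show "\<sigma> y (c *\<^sub>R z) x = c *\<^sub>R \<sigma> y z x"
      unfolding x z push_scale[symmetric] s[OF tangent_scale[OF z(1)] x(1)] s[OF z(1) x(1)] real_scaleR_def
      by (rule skewD(5)[OF sk z(1) x(1)])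
    assume "w \<in> N.T y"
    then obtain w' where w: "w' \<in> T (base y)" "w = push (base y) w'" by (metis lift_at)
    show "\<sigma> y x (z + w) = \<sigma> y x z + \<sigma> y x w"
      unfolding x z w push_add[symmetric] s[OF x(1) tangent_add[OF z(1) w(1)]] s[OF x(1) z(1)] s[OF x(1) w(1)]
      by (rule skewD(2)[OF sk x(1) z(1) w(1)])
    show "\<sigma> y (z + w) x = \<sigma> y z x + \<sigma> y w x"
      unfolding x z w push_add[symmetric] s[OF tangent_add[OF z(1) w(1)] x(1)] s[OF z(1) x(1)] s[OF w(1) x(1)]
      by (rule skewD(4)[OF sk z(1) x(1) w(1)])
  qed
next
  fix X Y assume X: "N.vfield X" and Y: "N.vfield Y"
  show "smooth_fun_on N UNIV (\<lambda>p. \<sigma> p (X p) (Y p))"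
    unfolding N.smooth_near_iff_on[OF open_UNIV]
  proof
    fix y
    show "N.sn y (\<lambda>p. \<sigma> p (X p) (Y p))"
    proof (rule descend_sn[OF open_UNIV _ UNIV_I])
      fix p assume p: "p \<in> U"
      obtain X' where X': "related p X' X" by (rule ex_related_any[OF p X])
      obtain Y' where Y': "related p Y' Y" by (rule ex_related_any[OF p Y])
      have v: "vfield X'" "vfield Y'" using X' Y' by (auto simp: related_def)
      have "\<forall>\<^sub>F r in nhds p. \<theta> r (X' r) (Y' r) = ((\<lambda>p. \<sigma> p (X p) (Y p)) \<circ> q) r"
        using related_open[OF p X'] related_open[OF p Y']
      proof eventually_elim
        case (elim r)
        then have r: "r \<in> U" "related r X' X" "related r Y' Y" by auto
        show ?case using sigma_push[OF r(1) vfield_T[OF v(1)] vfield_T[OF v(2)]] related_push[OF r(2)] related_push[OF r(3)] by simp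
      qed
      then show "sn p ((\<lambda>p. \<sigma> p (X p) (Y p)) \<circ> q)"
        by (rule sn_cong[OF two_form_sn[OF two_form_theta v]])
    qed
  qed
qed

section \<open>The endomorphism on N\<close>

abbreviation SN where "SN y \<equiv> sharp N \<pi> y"
abbreviation BN where "BN y \<equiv> flat N \<sigma> y"
abbreviation CN where "CN y \<equiv> cov_comp N A y"

lemma S_push:
  assumes p: "p \<in> U" and a: "\<alpha> \<in> N.Ts (q p)"
  shows "push p (S p (pull p \<alpha>)) = SN (q p) \<alpha>"
proof (rule N.cot_separates[of _ "q p"])
  note pa = pull_cot[OF p a]
  show "push p (S p (pull p \<alpha>)) \<in> N.T (q p)" by (rule push_T[OF p S_T[OF pa]])
  show "SN (q p) \<alpha> \<in> N.T (q p)"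
    by (rule N.sharp_tangent[where P=\<pi>, OF N.bivectorD[OF bivector_pi] a])
  fix \<beta> assume b: "\<beta> \<in> N.Ts (q p)"
  have "\<beta> (push p (S p (pull p \<alpha>))) = pull p \<beta> (S p (pull p \<alpha>))" by (rule pull_apply[OF S_T[OF pa], symmetric])
  also have "\<dots> = P p (pull p \<alpha>) (pull p \<beta>)" by (rule S_apply[OF pa pull_cot[OF p b]])
  also have "\<dots> = \<pi> (q p) \<alpha> \<beta>" by (rule pi_pull[OF p a b, symmetric])
  also have "\<dots> = \<beta> (SN (q p) \<alpha>)"
    by (rule N.sharp_apply[where P=\<pi>, OF N.bivectorD[OF bivector_pi] a b, symmetric])
  finally show "\<beta> (push p (S p (pull p \<alpha>))) = \<beta> (SN (q p) \<alpha>)" .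
qed

lemma B_pull:
  assumes p: "p \<in> U" and v: "v \<in> T p"
  shows "B p v = pull p (BN (q p) (push p v))"
proof (rule cot_eqI[of _ p])
  show "B p v \<in> Ts p" by (rule B_cot[OF v])
  show "pull p (BN (q p) (push p v)) \<in> Ts p"
    by (intro pull_cot p N.flat_cot two_form_sigma push_T v)
  fix w assume w: "w \<in> T p"
  show "B p v w = pull p (BN (q p) (push p v)) w"
    using w sigma_push[OF p v w] push_T[OF p w] by (simp add: pull_apply)
qed

lemma C_pull:
  assumes p: "p \<in> U" and a: "\<alpha> \<in> N.Ts (q p)"
  shows "C p (pull p \<alpha>) = pull p (CN (q p) \<alpha>)"
proof (rule cot_eqI[of _ p])
  show "C p (pull p \<alpha>) \<in> Ts p" by (intro cov_comp_cot endo_F pull_cot p a)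
  show "pull p (CN (q p) \<alpha>) \<in> Ts p" by (intro pull_cot p N.cov_comp_cot endo_A a)
  fix v assume v: "v \<in> T p"
  show "C p (pull p \<alpha>) v = pull p (CN (q p) \<alpha>) v"
    using v F_T[OF v] push_T[OF p v] A_push[OF p v] by (simp add: pull_apply)
qed

definition J_vec :: "('n \<Rightarrow> 'n tvec) \<Rightarrow> ('n \<Rightarrow> 'n covec) \<Rightarrow> 'n \<Rightarrow> 'n tvec" where
  "J_vec X \<alpha> y = A y (X y) + SN y (\<alpha> y)"
definition J_cov :: "('n \<Rightarrow> 'n tvec) \<Rightarrow> ('n \<Rightarrow> 'n covec) \<Rightarrow> 'n \<Rightarrow> 'n covec" where
  "J_cov X \<alpha> y = BN y (X y) - CN y (\<alpha> y)"

lemma vfield_J_vec: "N.vfield X \<Longrightarrow> N.form \<alpha> \<Longrightarrow> N.vfield (J_vec X \<alpha>)"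
  unfolding J_vec_def[abs_def] by (intro N.vfield_add N.endoD(4)[OF endo_A] N.vfield_sharp bivector_pi)

lemma form_J_cov: "N.vfield X \<Longrightarrow> N.form \<alpha> \<Longrightarrow> N.form (J_cov X \<alpha>)"
  unfolding J_cov_def[abs_def] by (intro N.form_diff N.form_cov_comp endo_A N.form_flat two_form_sigma)

text \<open>Since \<open>Phi_vec\<close> and \<open>Phi_cov\<close> contain no sums over Z and
  \<xi>, they match their counterparts on N exactly, not merely up to vertical vectors. The result
  is again a pair of related objects, so the lemma can be iterated.\<close>

lemma related_Phi:
  assumes p: "p \<in> U" and X: "related p X' X" and a: "related_form p \<alpha>' \<alpha>"
  shows "related p (Phi_vec X' \<alpha>') (J_vec X \<alpha>)" "related_form p (Phi_cov X' \<alpha>') (J_cov X \<alpha>)"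
proof -
  have v: "vfield X'" "N.vfield X" "form \<alpha>'" "N.form \<alpha>" using X a by (auto simp: related_def related_form_def)
  have both: "\<forall>\<^sub>F r in nhds p. push r (Phi_vec X' \<alpha>' r) = J_vec X \<alpha> (q r) \<and> Phi_cov X' \<alpha>' r = pull r (J_cov X \<alpha> (q r))"
    using related_open[OF p X] related_form_open[OF p a]
  proof eventually_elim
    case (elim r)
    then have r: "r \<in> U" "related r X' X" "related_form r \<alpha>' \<alpha>" by auto
    note XT = vfield_T[OF v(1), of r] and aT = N.form_Ts[OF v(4), of "q r"]
    show ?case
      unfolding Phi_vec_def J_vec_def Phi_cov_def J_cov_def related_form_pull[OF r(3)] related_push[OF r(2), symmetric]
        push_add A_push[OF r(1) XT] S_push[OF r(1) aT] pull_diff B_pull[OF r(1) XT] C_pull[OF r(1) aT]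
      by simp
  qed
  show "related p (Phi_vec X' \<alpha>') (J_vec X \<alpha>)" unfolding related_def
    using vfield_Phi_vec[OF v(1,3)] vfield_J_vec[OF v(2,4)] both by (auto elim: eventually_mono)
  show "related_form p (Phi_cov X' \<alpha>') (J_cov X \<alpha>)" unfolding related_form_def
    using form_Phi_cov[OF v(1,3)] form_J_cov[OF v(2,4)] both by (auto elim: eventually_mono)
qed

text \<open>A pulled back form kills the vertical Z. Vanishing is needed near p and not only at p,
  because these functions are differentiated in the stable bracket.\<close>

lemma at_Z_eventually:
  assumes p: "p \<in> U" and a: "related_form p \<alpha>' \<alpha>"
  shows "\<forall>\<^sub>F r in nhds p. at_Z \<alpha>' a r = 0"
  using related_form_open[OF p a]
proof eventually_elim
  case (elim r)
  then have r: "r \<in> U" "related_form r \<alpha>' \<alpha>" by auto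
  then have "N.form \<alpha>" by (simp add: related_form_def)
  then show ?case
    unfolding at_Z_def related_form_pull[OF r(2)]
    using push_Z[OF r(1)] by (simp add: pull_apply[OF vfield_T[OF vfield_Z]] N.cot_zero[OF N.form_Ts] del: atLeastAtMost_iff)
qed

text \<open>The identity for \<open>Phi\<close> is read through the projection: the sum over Z is
  vertical and disappears under \<open>push\<close>, and the sum over \<xi> has coefficients
  \<open>at_Z\<close>, which vanish for pulled back forms.\<close>

lemma J_vec_J_cov:
  assumes X: "N.vfield X" and a: "N.form \<alpha>"
  shows "J_vec (J_vec X \<alpha>) (J_cov X \<alpha>) y = - X y" "J_cov (J_vec X \<alpha>) (J_cov X \<alpha>) y = - \<alpha> y"
proof -
  let ?p = "base y"
  note p = base(1)[of y] and qp = base(2)[of y]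
  obtain X' where X': "related ?p X' X" by (rule ex_related_any[OF p X])
  obtain \<alpha>' where a': "related_form ?p \<alpha>' \<alpha>" by (rule ex_related_form[OF p a])
  have v: "vfield X'" "form \<alpha>'" using X' a' by (auto simp: related_def related_form_def)
  note g = related_Phi[OF p X' a']
  note gg = related_Phi[OF p g]
  note pp = Phi_Phi_components[OF v, of ?p]
  have "push ?p (Phi_vec (Phi_vec X' \<alpha>') (Phi_cov X' \<alpha>') ?p) = push ?p (- X' ?p + (\<Sum>a\<in>I. at_xi X' a ?p *\<^sub>R Z a ?p))"
    using pp(1) by (simp only: Phi_vec_def[of "Phi_vec X' \<alpha>'" "Phi_cov X' \<alpha>'"] diff_eq_eq)
  then show "J_vec (J_vec X \<alpha>) (J_cov X \<alpha>) y = - X y"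
    unfolding related_push[OF gg(1)] push_add push_minus push_sum_Z[OF p] related_push[OF X'] qp by simp
  have "at_Z \<alpha>' a ?p = 0" for a by (rule eventually_nhds_x_imp_x[OF at_Z_eventually[OF p a']])
  then have "Phi_cov (Phi_vec X' \<alpha>') (Phi_cov X' \<alpha>') ?p = - \<alpha>' ?p"
    using pp(2) by (simp add: Phi_cov_def[of "Phi_vec X' \<alpha>'" "Phi_cov X' \<alpha>'"])
  then have "pull ?p (J_cov (J_vec X \<alpha>) (J_cov X \<alpha>) y) = pull ?p (- \<alpha> y)"
    unfolding related_form_pull[OF gg(2)] related_form_pull[OF a'] qp pull_minus .
  then show "J_cov (J_vec X \<alpha>) (J_cov X \<alpha>) y = - \<alpha> y"
    by (rule pull_inj[OF p, rotated 2])
       (unfold qp, intro N.form_Ts form_J_cov vfield_J_vec X a, intro N.cot_closed_minus N.form_Ts a)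
qed

section \<open>The Courant bracket on N\<close>

definition courant_cov :: "('n \<Rightarrow> 'n tvec) \<Rightarrow> ('n \<Rightarrow> 'n covec) \<Rightarrow> ('n \<Rightarrow> 'n tvec) \<Rightarrow> ('n \<Rightarrow> 'n covec) \<Rightarrow> 'n \<Rightarrow> 'n covec" where
  "courant_cov X \<alpha> Y \<beta> y = lie_form N X \<beta> y - lie_form N Y \<alpha> y
     - (1/2) *\<^sub>R ext_d N (\<lambda>x. \<beta> x (X x) - \<alpha> x (Y x)) y"

lemma form_courant_cov:
  assumes X: "N.vfield X" and a: "N.form \<alpha>" and Y: "N.vfield Y" and b: "N.form \<beta>"
  shows "N.form (courant_cov X \<alpha> Y \<beta>)"
proof -
  have s: "N.sn x (\<lambda>x. \<beta> x (X x) - \<alpha> x (Y x))" for x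
    by (rule N.sn_diff[OF N.form_sn[OF b X] N.form_sn[OF a Y]])
  note l = N.form_lie_form[OF X b] N.form_lie_form[OF Y a]
  show ?thesis unfolding courant_cov_def[abs_def]
    by (rule N.form_diff[OF N.form_diff[OF l] N.form_cmult[OF N.form_ext_d[OF s]]])
qed

text \<open>Every R^h term of the stable bracket contains some u or du, so it dies when the u's
  vanish near p, whatever the v's are. This matters because the v's will be \<open>at_xi\<close> of
  lifts, on which the choice of lift imposes nothing.\<close>

lemma stable_cov_pull:
  assumes p: "p \<in> U" and X: "related p X' X" and a: "related_form p \<alpha>' \<alpha>" and Y: "related p Y' Y" and b: "related_form p \<beta>' \<beta>"
    and u: "\<And>a. \<forall>\<^sub>F r in nhds p. u1 a r = 0" "\<And>a. \<forall>\<^sub>F r in nhds p. u2 a r = 0"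
  shows "stable_cov X' u1 \<alpha>' v1 Y' u2 \<beta>' v2 p = pull p (courant_cov X \<alpha> Y \<beta> (q p))"
proof -
  have v: "vfield X'" "N.vfield X" "form \<alpha>'" "N.form \<alpha>" "vfield Y'" "N.vfield Y" "form \<beta>'" "N.form \<beta>"
    using X a Y b by (auto simp: related_def related_form_def)
  have z: "u1 a p = 0" "u2 a p = 0" "ext_d M (u1 a) p = 0" "ext_d M (u2 a) p = 0" for a
    using eventually_nhds_x_imp_x[OF u(1)] eventually_nhds_x_imp_x[OF u(2)]
      ext_d_cong[OF u(1)[of a]] ext_d_cong[OF u(2)[of a]] by auto
  have s: "N.sn (q p) (\<lambda>y. \<beta> y (X y) - \<alpha> y (Y y))" by (rule N.sn_diff[OF N.form_sn[OF v(8,2)] N.form_sn[OF v(4,6)]])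
  \<comment> \<open>The two brackets write the contraction term with opposite sign and opposite
    order of the differences; the minus sign reconciles them.\<close>
  have "\<forall>\<^sub>F r in nhds p. \<alpha>' r (Y' r) - \<beta>' r (X' r) = ((\<lambda>y. - (\<beta> y (X y) - \<alpha> y (Y y))) \<circ> q) r"
    using related_form_eval[OF p a Y] related_form_eval[OF p b X] by eventually_elim simp
  then have "ext_d M (\<lambda>r. \<alpha>' r (Y' r) - \<beta>' r (X' r)) p = ext_d M ((\<lambda>y. - (\<beta> y (X y) - \<alpha> y (Y y))) \<circ> q) p"
    by (rule ext_d_cong)
  also have "\<dots> = pull p (ext_d N (\<lambda>y. - (\<beta> y (X y) - \<alpha> y (Y y))) (q p))"
    by (rule ext_d_pull[OF p N.sn_minus[OF s]])
  also have "\<dots> = - pull p (ext_d N (\<lambda>y. \<beta> y (X y) - \<alpha> y (Y y)) (q p))"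
    by (simp only: N.ext_d_minus[OF s] pull_minus)
  finally have d: "ext_d M (\<lambda>r. \<alpha>' r (Y' r) - \<beta>' r (X' r)) p = \<dots>" .
  show ?thesis
    unfolding stable_cov_def courant_cov_def d z related_form_lie_at[OF p X b] related_form_lie_at[OF p Y a] pull_diff pull_scale by simp
qed

text \<open>Obtained from the second equation of \<open>star\<close> for lifts. In the tangent slot
  the sum over Z is vertical; in the cotangent slot the sum over \<xi> vanishes because its
  coefficients are derivatives of functions \<open>at_Z\<close>.\<close>

lemma star_N:
  assumes X: "N.vfield X" and a: "N.form \<alpha>" and Y: "N.vfield Y" and b: "N.form \<beta>"
  defines "X2 \<equiv> J_vec X \<alpha>" and "\<alpha>2 \<equiv> J_cov X \<alpha>" and "Y2 \<equiv> J_vec Y \<beta>" and "\<beta>2 \<equiv> J_cov Y \<beta>"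
  shows "A y (N.bracket X2 Y y + N.bracket X Y2 y) + SN y (courant_cov X2 \<alpha>2 Y \<beta> y + courant_cov X \<alpha> Y2 \<beta>2 y) = N.bracket X2 Y2 y - N.bracket X Y y"
    and "BN y (N.bracket X2 Y y + N.bracket X Y2 y) - CN y (courant_cov X2 \<alpha>2 Y \<beta> y + courant_cov X \<alpha> Y2 \<beta>2 y) = courant_cov X2 \<alpha>2 Y2 \<beta>2 y - courant_cov X \<alpha> Y \<beta> y"
proof -
  let ?p = "base y"
  note p = base(1)[of y] and qp = base(2)[of y]
  obtain X' where X': "related ?p X' X" by (rule ex_related_any[OF p X])
  obtain \<alpha>' where a': "related_form ?p \<alpha>' \<alpha>" by (rule ex_related_form[OF p a])
  obtain Y' where Y': "related ?p Y' Y" by (rule ex_related_any[OF p Y])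
  obtain \<beta>' where b': "related_form ?p \<beta>' \<beta>" by (rule ex_related_form[OF p b])
  have v: "vfield X'" "form \<alpha>'" "vfield Y'" "form \<beta>'" using X' a' Y' b' by (auto simp: related_def related_form_def)
  have n2: "N.vfield X2" "N.form \<alpha>2" "N.vfield Y2" "N.form \<beta>2"
    unfolding X2_def \<alpha>2_def Y2_def \<beta>2_def by (intro vfield_J_vec form_J_cov X Y a b)+
  note gx = related_Phi[OF p X' a', folded X2_def \<alpha>2_def] and gy = related_Phi[OF p Y' b', folded Y2_def \<beta>2_def]
  note ua = at_Z_eventually[OF p a'] and ub = at_Z_eventually[OF p b']
  have z: "\<forall>\<^sub>F r in nhds ?p. zeros a r = 0" for a by simp
  note st = star_R[where p="?p", OF v]
  let ?w = "bracket (Phi_vec X' \<alpha>') Y' ?p + bracket X' (Phi_vec Y' \<beta>') ?p"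
  let ?c = "courant_cov X2 \<alpha>2 Y \<beta> y + courant_cov X \<alpha> Y2 \<beta>2 y"
  have wT: "?w \<in> T ?p" by (intro tangent_add lie_bracket_tangent vfield_Phi_vec v)
  have w: "push ?p ?w = N.bracket X2 Y y + N.bracket X Y2 y"
    by (simp only: push_add related_bracket_at[OF p gx(1) Y'] related_bracket_at[OF p X' gy(1)] qp)
  have cT: "?c \<in> N.Ts y" by (intro N.cot_closed N.form_Ts form_courant_cov n2 X Y a b)
  have J3: "stable_cov (Phi_vec X' \<alpha>') (at_Z \<alpha>') (Phi_cov X' \<alpha>') (at_xi X') Y' zeros \<beta>' zeros ?p
        + stable_cov X' zeros \<alpha>' zeros (Phi_vec Y' \<beta>') (at_Z \<beta>') (Phi_cov Y' \<beta>') (at_xi Y') ?p = pull ?p ?c"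
    unfolding stable_cov_pull[OF p gx Y' b' ua z] stable_cov_pull[OF p X' a' gy z ub] qp pull_add ..
  have R3: "stable_cov (Phi_vec X' \<alpha>') (at_Z \<alpha>') (Phi_cov X' \<alpha>') (at_xi X') (Phi_vec Y' \<beta>') (at_Z \<beta>') (Phi_cov Y' \<beta>') (at_xi Y') ?p
        - stable_cov X' zeros \<alpha>' zeros Y' zeros \<beta>' zeros ?p = pull ?p (courant_cov X2 \<alpha>2 Y2 \<beta>2 y - courant_cov X \<alpha> Y \<beta> y)"
    unfolding stable_cov_pull[OF p gx gy ua ub] stable_cov_pull[OF p X' a' Y' b' z z] qp pull_diff ..
  have cq: "?c \<in> N.Ts (q ?p)" using cT qp by simp
  note AP = A_push[OF p wT, unfolded qp w] and SP = S_push[OF p cq, unfolded qp]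
    and BP = B_pull[OF p wT, unfolded qp w] and CP = C_pull[OF p cq, unfolded qp]
  have "push ?p (F ?p ?w + S ?p (pull ?p ?c)) = push ?p (bracket (Phi_vec X' \<alpha>') (Phi_vec Y' \<beta>') ?p - bracket X' Y' ?p +
     (\<Sum>a\<in>I. (X' ?p (at_xi Y' a) - Y' ?p (at_xi X' a)) *\<^sub>R Z a ?p))"
    using st(4)[unfolded J3] by (simp only: diff_eq_eq)
  then show "A y (N.bracket X2 Y y + N.bracket X Y2 y) + SN y ?c = N.bracket X2 Y2 y - N.bracket X Y y"
    unfolding push_add push_diff push_sum_Z[OF p] AP[symmetric] SP
      related_bracket_at[OF p gx(1) gy(1)] related_bracket_at[OF p X' Y'] qp by simp
  have um0: "X' ?p (at_Z \<beta>' a) = 0" "Y' ?p (at_Z \<alpha>' a) = 0" for a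
    using tv_cong[OF vfield_T[OF v(1)] ub[of a]] tv_cong[OF vfield_T[OF v(3)] ua[of a]] v by simp_all
  have "B ?p ?w - C ?p (pull ?p ?c) = pull ?p (courant_cov X2 \<alpha>2 Y2 \<beta>2 y - courant_cov X \<alpha> Y \<beta> y)"
    using st(5)[unfolded J3 R3 um0] by simp
  then have "pull ?p (BN y (N.bracket X2 Y y + N.bracket X Y2 y) - CN y ?c) = pull ?p (courant_cov X2 \<alpha>2 Y2 \<beta>2 y - courant_cov X \<alpha> Y \<beta> y)"
    unfolding BP CP pull_diff .
  then show "BN y (N.bracket X2 Y y + N.bracket X Y2 y) - CN y ?c = courant_cov X2 \<alpha>2 Y2 \<beta>2 y - courant_cov X \<alpha> Y \<beta> y"
  proof (rule pull_inj[OF p, rotated 2, unfolded qp])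
    show "BN y (N.bracket X2 Y y + N.bracket X Y2 y) - CN y ?c \<in> N.Ts y"
      by (intro N.cot_closed_diff N.flat_cot two_form_sigma N.cov_comp_cot endo_A cT N.tangent_add
          N.lie_bracket_tangent n2 X Y)
    show "courant_cov X2 \<alpha>2 Y2 \<beta>2 y - courant_cov X \<alpha> Y \<beta> y \<in> N.Ts y"
      by (intro N.cot_closed_diff N.form_Ts form_courant_cov n2 X Y a b)
  qed
qed

definition gen_sec :: "('n \<Rightarrow> 'n tvec) \<Rightarrow> ('n \<Rightarrow> 'n covec) \<Rightarrow> 'n \<Rightarrow> 'n tvec \<times> 'n covec" where
  "gen_sec X \<alpha> = (\<lambda>y. (X y, \<alpha> y))"

abbreviation J where "J \<equiv> gen_endo N A \<pi> \<sigma>"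

lemma J_gen_sec: "J y (gen_sec X \<alpha> y) = gen_sec (J_vec X \<alpha>) (J_cov X \<alpha>) y"
  by (simp add: gen_endo_def gen_sec_def J_vec_def J_cov_def)

text \<open>J acts pointwise, so the identity for sections transfers after extending the given
  vector and covector to a global field and form.\<close>

lemma J_J:
  assumes "z \<in> N.T y \<times> N.Ts y"
  shows "J y (J y z) = - z"
proof -
  obtain w \<beta> where z: "z = (w, \<beta>)" "w \<in> N.T y" "\<beta> \<in> N.Ts y" using assms by blast
  obtain X where X: "N.vfield X" "X y = w" by (rule N.ex_vf_through[OF z(2)]) blast
  obtain \<alpha> where a: "N.form \<alpha>" "\<alpha> y = \<beta>" by (rule N.ex_of_through[OF z(3)]) blast
  have e: "z = gen_sec X \<alpha> y" by (simp add: gen_sec_def z(1) X a)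
  show ?thesis unfolding e J_gen_sec by (simp add: gen_sec_def J_vec_J_cov[OF X(1) a(1)])
qed

lemma gen_sec_sections: "N.vfield X \<Longrightarrow> N.form \<alpha> \<Longrightarrow> gen_sec X \<alpha> \<in> gen_sections N"
  unfolding gen_sections_def gen_sec_def by blast

lemma sections_gen_sec:
  assumes "s \<in> gen_sections N"
  obtains X \<alpha> where "N.vfield X" "N.form \<alpha>" "s = gen_sec X \<alpha>"
  using assms unfolding gen_sections_def gen_sec_def by blast

lemma courant_gen_sec: "courant_bracket N (gen_sec X \<alpha>) (gen_sec Y \<beta>) = gen_sec (N.bracket X Y) (courant_cov X \<alpha> Y \<beta>)"
  by (simp add: courant_bracket_def gen_sec_def courant_cov_def fun_eq_iff)

lemma gen_sec_add: "gen_sec X \<alpha> + gen_sec Y \<beta> = gen_sec (\<lambda>y. X y + Y y) (\<lambda>y. \<alpha> y + \<beta> y)"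
  and gen_sec_diff: "gen_sec X \<alpha> - gen_sec Y \<beta> = gen_sec (\<lambda>y. X y - Y y) (\<lambda>y. \<alpha> y - \<beta> y)"
  by (simp_all add: gen_sec_def fun_eq_iff)

text \<open>An eigensection is determined by its imaginary part t, being \<open>J t + i t\<close>.
  The bracket of two of them is therefore \<open>R + i K\<close> with R and K the two sides of the
  torsion identity; \<open>J K = R\<close> is \<open>star_N\<close>, and applying J gives the other
  half of the eigenvalue equation.\<close>

lemma closed_N: "eigenbundle_closed (gen_sections N) J (courant_bracket N)"
  unfolding eigenbundle_closed_def
proof (intro ballI)
  fix z w assume z: "z \<in> eigen_sections (gen_sections N) J" and w: "w \<in> eigen_sections (gen_sections N) J"
  have repr: "\<exists>X \<alpha>. N.vfield X \<and> N.form \<alpha> \<and> z = (gen_sec (J_vec X \<alpha>) (J_cov X \<alpha>), gen_sec X \<alpha>)"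
    if z: "z \<in> eigen_sections (gen_sections N) J" for z
  proof -
    obtain s t where st: "z = (s, t)" "t \<in> gen_sections N" "\<And>y. J y (t y) = s y"
      using z unfolding eigen_sections_def by blast
    obtain X \<alpha> where X: "N.vfield X" "N.form \<alpha>" "t = gen_sec X \<alpha>" by (rule sections_gen_sec[OF st(2)])
    have "s = gen_sec (J_vec X \<alpha>) (J_cov X \<alpha>)" using st(3) X(3) J_gen_sec by (simp add: fun_eq_iff)
    then show ?thesis using st(1) X by blast
  qed
  obtain X \<alpha> where X: "N.vfield X" "N.form \<alpha>" "z = (gen_sec (J_vec X \<alpha>) (J_cov X \<alpha>), gen_sec X \<alpha>)" using repr[OF z] by blast
  obtain Y \<beta> where Y: "N.vfield Y" "N.form \<beta>" "w = (gen_sec (J_vec Y \<beta>) (J_cov Y \<beta>), gen_sec Y \<beta>)" using repr[OF w] by blast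
  let ?X = "J_vec X \<alpha>" and ?a = "J_cov X \<alpha>" and ?Y = "J_vec Y \<beta>" and ?b = "J_cov Y \<beta>"
  note n = vfield_J_vec[OF X(1,2)] form_J_cov[OF X(1,2)] vfield_J_vec[OF Y(1,2)] form_J_cov[OF Y(1,2)] X(1,2) Y(1,2)
  define R where "R = gen_sec (\<lambda>y. N.bracket ?X ?Y y - N.bracket X Y y) (\<lambda>y. courant_cov ?X ?a ?Y ?b y - courant_cov X \<alpha> Y \<beta> y)"
  define K where "K = gen_sec (\<lambda>y. N.bracket ?X Y y + N.bracket X ?Y y) (\<lambda>y. courant_cov ?X ?a Y \<beta> y + courant_cov X \<alpha> ?Y ?b y)"
  have RK: "complex_bracket (courant_bracket N) z w = (R, K)"
    unfolding complex_bracket_def X(3) Y(3) fst_conv snd_conv courant_gen_sec gen_sec_add gen_sec_diff R_def K_def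
    by (simp add: add.commute)
  have RG: "R \<in> gen_sections N" unfolding R_def
    by (intro gen_sec_sections N.vfield_diff N.vfield_lie_bracket N.form_diff form_courant_cov n)
  have KG: "K \<in> gen_sections N" unfolding K_def
    by (intro gen_sec_sections N.vfield_add N.vfield_lie_bracket N.form_add form_courant_cov n)
  have JK: "J y (K y) = R y" for y
    unfolding K_def R_def J_gen_sec J_vec_def J_cov_def
    using star_N[OF X(1,2) Y(1,2), of y] by (simp only: gen_sec_def J_vec_def[symmetric] J_cov_def[symmetric])
  have "K y \<in> N.T y \<times> N.Ts y" for y
    by (rule sections_gen_sec[OF KG]) (simp add: gen_sec_def)
  then have "J y (R y) = - K y" for y using J_J JK by metis
  then show "complex_bracket (courant_bracket N) z w \<in> eigen_sections (gen_sections N) J"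
    unfolding RK eigen_sections_def using RG KG JK by simp
qed

lemma gen_complex_N: "gen_complex N A \<pi> \<sigma>"
  unfolding gen_complex_def using endo_A bivector_pi two_form_sigma J_J closed_N by blast

end

theorem theorem3p2:
  fixes M :: "('m::{t2_space,second_countable_topology}, 'e::finite_dim_inner) atlas"
    and h :: nat
    and P :: "'m \<Rightarrow> 'm covec \<Rightarrow> 'm covec \<Rightarrow> real"
    and \<theta> :: "'m \<Rightarrow> 'm tvec \<Rightarrow> 'm tvec \<Rightarrow> real"
    and F :: "'m \<Rightarrow> 'm tvec \<Rightarrow> 'm tvec"
    and Z :: "nat \<Rightarrow> 'm \<Rightarrow> 'm tvec"
    and \<xi> :: "nat \<Rightarrow> 'm \<Rightarrow> 'm covec"
  assumes "smooth_manifold M"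
    and "normal_gen_almost_contact M h P \<theta> F Z \<xi>"
  shows "(\<forall>a\<in>{1..h}. \<forall>b\<in>{1..h}. \<forall>p. lie_bracket M (Z a) (Z b) p = 0) \<and>
    (\<forall>p. inj_on (\<lambda>a. Z a p) {1..h} \<and> independent ((\<lambda>a. Z a p) ` {1..h})) \<and>
    (\<forall>(N :: ('n::{t2_space,second_countable_topology}, 'f::finite_dim_inner) atlas) U q.
       leaf_space M (\<lambda>p. span ((\<lambda>a. Z a p) ` {1..h})) U N q \<longrightarrow>
       (\<exists>A \<pi> \<sigma>. projects_to M U N q F P \<theta> A \<pi> \<sigma> \<and> gen_complex N A \<pi> \<sigma>))"
proof -
  interpret contact M h P \<theta> F Z \<xi>
    using assms by (simp add: contact_def contact_axioms_def manifold_def)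
  have "\<exists>A \<pi> \<sigma>. projects_to M U N q F P \<theta> A \<pi> \<sigma> \<and> gen_complex N A \<pi> \<sigma>"
    if l: "leaf_space M (\<lambda>p. span ((\<lambda>a. Z a p) ` {1..h})) U N q"
    for N :: "('n, 'f) atlas" and U q
  proof -
    interpret leaf_projection M h P \<theta> F Z \<xi> N U q
    proof
      show "smooth_manifold N" "open U" "smooth_map_on M N U q" "q ` U = UNIV"
        using l by (auto simp: leaf_space_def)
      show "push_vec N q p ` tangent_space M p = tangent_space N (q p)" if "p \<in> U" for p
        using l that by (simp add: leaf_space_def)
      show "{v \<in> tangent_space M p. push_vec N q p v = 0} = span ((\<lambda>a. Z a p) ` {1..h})" if "p \<in> U" for p
        using l that by (simp add: leaf_space_def)
      show "same_leaf M (\<lambda>p. span ((\<lambda>a. Z a p) ` {1..h})) U x y" if "x \<in> U" "y \<in> U" "q x = q y" for x y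
        using l that by (simp add: leaf_space_def)
    qed
    show ?thesis using projects gen_complex_N by blast
  qed
  then show ?thesis using Z_commute Z_independent by blast
qed

end
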